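(* Consider the $d$-dimensional Gaussian Volterra principal-agent model described in the context and assume that the effort cost function is radial, i.e. $\Gamma=\kappa I_d$ for some $\kappa>0$. Then the optimal level of effort for the enlarged principal's problem $V_{SB}(y)$ is deterministic and given by $\Gamma^{-1}\beta^*$ with $$\beta^*_t=\frac{\gamma_P+1/\kappa}{\gamma_A+\gamma_P+1/\kappa}\,K(T,t),\qquad t\le T.$$ In particular, the optimal contract $\xi^*$ (the one attaining $V_{SB}$) is linear in profits and given by $$\xi^*=y_0-\frac{\gamma_P+1/\kappa}{\gamma_A+\gamma_P+1/\kappa}\,g_0(T)+\frac{\gamma_A-1/\kappa}{2}\int_0^T\langle\beta^*_s,\beta^*_s\rangle\,ds+\frac{\gamma_P+1/\kappa}{\gamma_A+\gamma_P+1/\kappa}\,X_T .$$ Furthermore, $V_{SB}=V_0^P$.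
   Context: Setting. Let $T>0$, $d\ge1$, and let $(\Omega,\mathcal{F},\mathbb{F}=(\mathcal{F}_t)_{t\le T},\mathbb{P}_0)$ be a filtered probability space carrying a $d$-dimensional standard $\mathbb{F}$-Brownian motion $B$. $\langle\cdot,\cdot\rangle$ and $\|\cdot\|$ are the canonical inner product and norm of $\mathbb{R}^d$. Let $g_0:[0,T]\to\mathbb{R}$ be a measurable deterministic function and $K:[0,T]^2\to\mathbb{R}^d$ a measurable Volterra kernel, i.e. $K(t,s)=0$ for $s\ge t$, with $\sup_{t\le T}\int_0^T\|K(t,s)\|^2ds<\infty$. The (real-valued) aggregate output is $X_t=g_0(t)+\int_0^t\langle K(t,s),dB_s\rangle$; $\mathbb{F}^X$ is its augmented filtration. $\mathcal{A}$ is the set of $\mathbb{F}$-progressively measurable $\mathbb{R}^d$-valued processes $a$ for which there is $A>0$ with $\int_0^T\|a_s\|^2ds<A$, $\mathbb{P}_0$-a.s. For $a\in\mathcal{A}$, $\frac{d\mathbb{P}_a}{d\mathbb{P}_0}=\exp\big(\int_0^T\langle a_s,dB_s\rangle-\frac12\int_0^T\|a_s\|^2ds\big)$, with expectation $\mathbb{E}^a$. Preferences: $U_P(x)=-e^{-\gamma_Px}$, $U_A(x)=-e^{-\gamma_Ax}$ with $\gamma_P,\gamma_A>0$; the agent's reservation utility is $U_A(y_0)$, $y_0\in\mathbb{R}$. Effort cost: $k(a)=\frac12\langle a,\Gamma a\rangle$, $\Gamma$ symmetric positive definite. Contracts: with $f^*(z)=\frac12\langle z,(\gamma_AI_d-\Gamma^{-1})z\rangle$,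 for $y\ge y_0$ and $\beta\in\mathcal{A}$ set $Y_T^{y,\beta}=y+\int_0^Tf^*(\beta_s)ds+\int_0^T\langle\beta_s,dB_s\rangle$. The agent's best reply to the contract $Y_T^{y,\beta}$ (maximizer over $a\in\mathcal{A}$ of $\mathbb{E}^a[U_A(Y_T^{y,\beta}-\int_0^Tk(a_s)ds)]$) is the effort $a=\Gamma^{-1}\beta$. Enlarged principal's problem: $V_{SB}=\sup_{y\ge y_0}V_{SB}(y)$ with $V_{SB}(y)=\sup_{\beta\in\mathcal{A}}\mathbb{E}^{\Gamma^{-1}\beta}\big[U_P(X_T-Y_T^{y,\beta})\big]$. Principal's problem: $V_0^P=\sup\mathbb{E}^{\Gamma^{-1}\beta}\big[U_P(X_T-Y_T^{y,\beta})\big]$, where the supremum is over those pairs $y\ge y_0$, $\beta\in\mathcal{A}$ for which the contract $Y_T^{y,\beta}$ is $\mathcal{F}^X_T$-measurable. *)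

theory Defs
  imports "HOL-Probability.Probability"
begin

section \<open>Filtrations and Brownian motion on a finite horizon\<close>

text \<open>Only the restriction of \<open>F\<close> and of all processes to the time interval \<open>[0,T]\<close> matters.
  The usual conditions are not imposed.\<close>

definition filtration_upto :: "'a measure \<Rightarrow> (real \<Rightarrow> 'a measure) \<Rightarrow> real \<Rightarrow> bool" where
  "filtration_upto M F T \<longleftrightarrow>
     (\<forall>t\<in>{0..T}. subalgebra M (F t)) \<and>
     (\<forall>s t. 0 \<le> s \<and> s \<le> t \<and> t \<le> T \<longrightarrow> sets (F s) \<subseteq> sets (F t))"

definition standard_brownian_motion ::
  "'a measure \<Rightarrow> (real \<Rightarrow> 'a measure) \<Rightarrow> real \<Rightarrow> (real \<Rightarrow> 'a \<Rightarrow> real ^ 'd) \<Rightarrow> bool" where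
  "standard_brownian_motion M F T B \<longleftrightarrow>
     (\<forall>t\<in>{0..T}. B t \<in> borel_measurable (F t)) \<and>
     (AE \<omega> in M. B 0 \<omega> = 0) \<and>
     (AE \<omega> in M. continuous_on {0..T} (\<lambda>t. B t \<omega>)) \<and>
     (\<forall>s t. 0 \<le> s \<and> s < t \<and> t \<le> T \<longrightarrow>
        distributed M lborel (\<lambda>\<omega>. B t \<omega> - B s \<omega>)
          (\<lambda>x. \<Prod>i\<in>UNIV. ennreal (normal_density 0 (sqrt (t - s)) (x $ i))) \<and>
        prob_space.indep_set M (sets (F s))
          {(\<lambda>\<omega>. B t \<omega> - B s \<omega>) -` A \<inter> space M | A. A \<in> sets borel})"

definition progressively_measurable ::
  "(real \<Rightarrow> 'a measure) \<Rightarrow> real \<Rightarrow> (real \<Rightarrow> 'a \<Rightarrow> 'b::topological_space) \<Rightarrow> bool" where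
  "progressively_measurable F T a \<longleftrightarrow>
     (\<forall>t\<in>{0..T}. (\<lambda>(s, \<omega>). a s \<omega>) \<in> borel_measurable (restrict_space borel {0..t} \<Otimes>\<^sub>M F t))"

text \<open>The sigma-algebra at time \<open>t\<close> of the augmented filtration generated by \<open>X\<close>; the null sets
  of the completion of \<open>M\<close> are all subsets of measurable null sets.\<close>

definition augmented_filtration ::
  "'a measure \<Rightarrow> (real \<Rightarrow> 'a \<Rightarrow> real) \<Rightarrow> real \<Rightarrow> 'a measure" where
  "augmented_filtration M X t =
     sigma (space M)
       ({X s -` A \<inter> space M | s A. s \<in> {0..t} \<and> A \<in> sets borel} \<union> null_sets (completion M))"


section \<open>The Ito integral for square integrable integrands\<close>

text \<open>The triple \<open>(n, \<tau>, \<eta>)\<close> encodes the simple process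
  \<open>\<Sum>i<n. \<eta>\<^sub>i 1\<^bsub>(\<tau>\<^sub>i, \<tau>\<^sub>i\<^sub>+\<^sub>1]\<^esub>\<close> with deterministic times \<open>\<tau>\<^sub>i\<close> and bounded,
  \<open>F\<close>-measurable (at time \<open>\<tau>\<^sub>i\<close>) coefficients \<open>\<eta>\<^sub>i\<close>.\<close>

definition simple_integrand ::
  "'a measure \<Rightarrow> (real \<Rightarrow> 'a measure) \<Rightarrow> real \<Rightarrow> nat \<Rightarrow> (nat \<Rightarrow> real) \<Rightarrow> (nat \<Rightarrow> 'a \<Rightarrow> real ^ 'd) \<Rightarrow> bool"
  where
  "simple_integrand M F t n \<tau> \<eta> \<longleftrightarrow>
     0 \<le> \<tau> 0 \<and> \<tau> n \<le> t \<and> (\<forall>i<n. \<tau> i \<le> \<tau> (Suc i)) \<and>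
     (\<forall>i<n. \<eta> i \<in> borel_measurable (F (\<tau> i)) \<and> (\<exists>C. \<forall>\<omega>\<in>space M. norm (\<eta> i \<omega>) \<le> C))"

definition simple_process ::
  "nat \<Rightarrow> (nat \<Rightarrow> real) \<Rightarrow> (nat \<Rightarrow> 'a \<Rightarrow> real ^ 'd) \<Rightarrow> real \<Rightarrow> 'a \<Rightarrow> real ^ 'd" where
  "simple_process n \<tau> \<eta> s \<omega> = (\<Sum>i<n. indicator {\<tau> i<..\<tau> (Suc i)} s *\<^sub>R \<eta> i \<omega>)"

definition simple_integral ::
  "(real \<Rightarrow> 'a \<Rightarrow> real ^ 'd) \<Rightarrow> nat \<Rightarrow> (nat \<Rightarrow> real) \<Rightarrow> (nat \<Rightarrow> 'a \<Rightarrow> real ^ 'd) \<Rightarrow> 'a \<Rightarrow> real" where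
  "simple_integral B n \<tau> \<eta> \<omega> = (\<Sum>i<n. \<eta> i \<omega> \<bullet> (B (\<tau> (Suc i)) \<omega> - B (\<tau> i) \<omega>))"

text \<open>\<open>Y\<close> is a version of \<open>\<integral>\<^sub>0\<^sup>t \<langle>a\<^sub>s, dB\<^sub>s\<rangle>\<close>: the mean square limit of integrals of simple
  processes that converge to \<open>a\<close> in mean square with respect to \<open>ds \<Otimes> M\<close>.\<close>

definition is_ito_integral ::
  "'a measure \<Rightarrow> (real \<Rightarrow> 'a measure) \<Rightarrow> (real \<Rightarrow> 'a \<Rightarrow> real ^ 'd) \<Rightarrow> real \<Rightarrow>
   (real \<Rightarrow> 'a \<Rightarrow> real ^ 'd) \<Rightarrow> ('a \<Rightarrow> real) \<Rightarrow> bool" where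
  "is_ito_integral M F B t a Y \<longleftrightarrow>
     Y \<in> borel_measurable M \<and>
     (\<exists>n \<tau> \<eta>. (\<forall>k::nat. simple_integrand M F t (n k) (\<tau> k) (\<eta> k)) \<and>
        (\<lambda>k. \<integral>\<^sup>+\<omega>. (\<integral>\<^sup>+s\<in>{0..t}. ennreal ((norm (simple_process (n k) (\<tau> k) (\<eta> k) s \<omega> - a s \<omega>))\<^sup>2)
                 \<partial>lborel) \<partial>M) \<longlonglongrightarrow> 0 \<and>
        (\<lambda>k. \<integral>\<^sup>+\<omega>. ennreal ((simple_integral B (n k) (\<tau> k) (\<eta> k) \<omega> - Y \<omega>)\<^sup>2) \<partial>M) \<longlonglongrightarrow> 0)"

text \<open>The integral is determined up to almost sure equality only; a version is chosen once and
  for all.  Every integrand below is progressively measurable and square integrable.\<close>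

definition ito_integral ::
  "'a measure \<Rightarrow> (real \<Rightarrow> 'a measure) \<Rightarrow> (real \<Rightarrow> 'a \<Rightarrow> real ^ 'd) \<Rightarrow> real \<Rightarrow>
   (real \<Rightarrow> 'a \<Rightarrow> real ^ 'd) \<Rightarrow> 'a \<Rightarrow> real" where
  "ito_integral M F B t a = (SOME Y. is_ito_integral M F B t a Y)"


section \<open>The Gaussian Volterra principal-agent model\<close>

definition volterra_kernel :: "real \<Rightarrow> (real \<Rightarrow> real \<Rightarrow> real ^ 'd) \<Rightarrow> bool" where
  "volterra_kernel T K \<longleftrightarrow>
     (\<lambda>(t, s). K t s) \<in> borel_measurable (restrict_space borel ({0..T} \<times> {0..T})) \<and>
     (\<forall>t\<in>{0..T}. \<forall>s\<in>{0..T}. t \<le> s \<longrightarrow> K t s = 0) \<and>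
     (SUP t\<in>{0..T}. \<integral>\<^sup>+s\<in>{0..T}. ennreal ((norm (K t s))\<^sup>2) \<partial>lborel) < \<infinity>"

definition volterra_output ::
  "'a measure \<Rightarrow> (real \<Rightarrow> 'a measure) \<Rightarrow> (real \<Rightarrow> 'a \<Rightarrow> real ^ 'd) \<Rightarrow> (real \<Rightarrow> real) \<Rightarrow>
   (real \<Rightarrow> real \<Rightarrow> real ^ 'd) \<Rightarrow> real \<Rightarrow> 'a \<Rightarrow> real" where
  "volterra_output M F B g0 K t \<omega> = g0 t + ito_integral M F B t (\<lambda>s _. K t s) \<omega>"

definition admissible ::
  "'a measure \<Rightarrow> (real \<Rightarrow> 'a measure) \<Rightarrow> real \<Rightarrow> (real \<Rightarrow> 'a \<Rightarrow> real ^ 'd) set" where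
  "admissible M F T =
     {a. progressively_measurable F T a \<and>
         (\<exists>A>0. AE \<omega> in M. (\<integral>\<^sup>+s\<in>{0..T}. ennreal ((norm (a s \<omega>))\<^sup>2) \<partial>lborel) < ennreal A)}"

definition effort_measure ::
  "'a measure \<Rightarrow> (real \<Rightarrow> 'a measure) \<Rightarrow> (real \<Rightarrow> 'a \<Rightarrow> real ^ 'd) \<Rightarrow> real \<Rightarrow>
   (real \<Rightarrow> 'a \<Rightarrow> real ^ 'd) \<Rightarrow> 'a measure" where
  "effort_measure M F B T a =
     density M (\<lambda>\<omega>. ennreal (exp (ito_integral M F B T a \<omega> - (LBINT s:{0..T}. (norm (a s \<omega>))\<^sup>2) / 2)))"

definition cara_utility :: "real \<Rightarrow> real \<Rightarrow> real" where
  "cara_utility \<gamma> x = - exp (- \<gamma> * x)"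

text \<open>Expectations take values in the extended reals, so that a utility with divergent expectation
  counts as \<open>-\<infinity>\<close> (the Bochner integral would give 0, exceeding every attainable CARA utility).\<close>

definition extended_expectation :: "'a measure \<Rightarrow> ('a \<Rightarrow> real) \<Rightarrow> ereal" where
  "extended_expectation N f =
     enn2ereal (\<integral>\<^sup>+\<omega>. ennreal (f \<omega>) \<partial>N) - enn2ereal (\<integral>\<^sup>+\<omega>. ennreal (- f \<omega>) \<partial>N)"

definition fstar :: "real \<Rightarrow> real ^ 'd ^ 'd \<Rightarrow> real ^ 'd \<Rightarrow> real" where
  "fstar \<gamma>A \<Gamma> z = (z \<bullet> ((\<gamma>A *\<^sub>R mat 1 - matrix_inv \<Gamma>) *v z)) / 2"

definition contract ::
  "'a measure \<Rightarrow> (real \<Rightarrow> 'a measure) \<Rightarrow> (real \<Rightarrow> 'a \<Rightarrow> real ^ 'd) \<Rightarrow> real \<Rightarrow> real \<Rightarrow> real ^ 'd ^ 'd \<Rightarrow>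
   real \<Rightarrow> (real \<Rightarrow> 'a \<Rightarrow> real ^ 'd) \<Rightarrow> 'a \<Rightarrow> real" where
  "contract M F B T \<gamma>A \<Gamma> y \<beta> \<omega> =
     y + (LBINT s:{0..T}. fstar \<gamma>A \<Gamma> (\<beta> s \<omega>)) + ito_integral M F B T \<beta> \<omega>"

text \<open>The agent's best reply \<open>\<Gamma>\<^sup>-\<^sup>1 \<beta>\<close> to the contract indexed by \<open>(y, \<beta>)\<close>.\<close>

definition reply :: "real ^ 'd ^ 'd \<Rightarrow> (real \<Rightarrow> 'a \<Rightarrow> real ^ 'd) \<Rightarrow> real \<Rightarrow> 'a \<Rightarrow> real ^ 'd" where
  "reply \<Gamma> \<beta> s \<omega> = matrix_inv \<Gamma> *v \<beta> s \<omega>"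

definition principal_utility ::
  "'a measure \<Rightarrow> (real \<Rightarrow> 'a measure) \<Rightarrow> (real \<Rightarrow> 'a \<Rightarrow> real ^ 'd) \<Rightarrow> real \<Rightarrow> (real \<Rightarrow> real) \<Rightarrow>
   (real \<Rightarrow> real \<Rightarrow> real ^ 'd) \<Rightarrow> real \<Rightarrow> real \<Rightarrow> real ^ 'd ^ 'd \<Rightarrow>
   real \<Rightarrow> (real \<Rightarrow> 'a \<Rightarrow> real ^ 'd) \<Rightarrow> ereal" where
  "principal_utility M F B T g0 K \<gamma>P \<gamma>A \<Gamma> y \<beta> =
     extended_expectation (effort_measure M F B T (reply \<Gamma> \<beta>))
       (\<lambda>\<omega>. cara_utility \<gamma>P (volterra_output M F B g0 K T \<omega> - contract M F B T \<gamma>A \<Gamma> y \<beta> \<omega>))"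

definition V_SB_at ::
  "'a measure \<Rightarrow> (real \<Rightarrow> 'a measure) \<Rightarrow> (real \<Rightarrow> 'a \<Rightarrow> real ^ 'd) \<Rightarrow> real \<Rightarrow> (real \<Rightarrow> real) \<Rightarrow>
   (real \<Rightarrow> real \<Rightarrow> real ^ 'd) \<Rightarrow> real \<Rightarrow> real \<Rightarrow> real ^ 'd ^ 'd \<Rightarrow> real \<Rightarrow> ereal" where
  "V_SB_at M F B T g0 K \<gamma>P \<gamma>A \<Gamma> y =
     (SUP \<beta>\<in>admissible M F T. principal_utility M F B T g0 K \<gamma>P \<gamma>A \<Gamma> y \<beta>)"

definition V_SB ::
  "'a measure \<Rightarrow> (real \<Rightarrow> 'a measure) \<Rightarrow> (real \<Rightarrow> 'a \<Rightarrow> real ^ 'd) \<Rightarrow> real \<Rightarrow> (real \<Rightarrow> real) \<Rightarrow>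
   (real \<Rightarrow> real \<Rightarrow> real ^ 'd) \<Rightarrow> real \<Rightarrow> real \<Rightarrow> real ^ 'd ^ 'd \<Rightarrow> real \<Rightarrow> ereal" where
  "V_SB M F B T g0 K \<gamma>P \<gamma>A \<Gamma> y0 = (SUP y\<in>{y0..}. V_SB_at M F B T g0 K \<gamma>P \<gamma>A \<Gamma> y)"

definition V_P ::
  "'a measure \<Rightarrow> (real \<Rightarrow> 'a measure) \<Rightarrow> (real \<Rightarrow> 'a \<Rightarrow> real ^ 'd) \<Rightarrow> real \<Rightarrow> (real \<Rightarrow> real) \<Rightarrow>
   (real \<Rightarrow> real \<Rightarrow> real ^ 'd) \<Rightarrow> real \<Rightarrow> real \<Rightarrow> real ^ 'd ^ 'd \<Rightarrow> real \<Rightarrow> ereal" where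
  "V_P M F B T g0 K \<gamma>P \<gamma>A \<Gamma> y0 =
     (SUP (y, \<beta>)\<in>{(y, \<beta>). y0 \<le> y \<and> \<beta> \<in> admissible M F T \<and>
          contract M F B T \<gamma>A \<Gamma> y \<beta>
            \<in> borel_measurable (augmented_filtration M (volterra_output M F B g0 K) T)}.
        principal_utility M F B T g0 K \<gamma>P \<gamma>A \<Gamma> y \<beta>)"

definition optimal_effort ::
  "'a measure \<Rightarrow> (real \<Rightarrow> 'a measure) \<Rightarrow> (real \<Rightarrow> 'a \<Rightarrow> real ^ 'd) \<Rightarrow> real \<Rightarrow> (real \<Rightarrow> real) \<Rightarrow>
   (real \<Rightarrow> real \<Rightarrow> real ^ 'd) \<Rightarrow> real \<Rightarrow> real \<Rightarrow> real ^ 'd ^ 'd \<Rightarrow>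
   real \<Rightarrow> (real \<Rightarrow> 'a \<Rightarrow> real ^ 'd) \<Rightarrow> bool" where
  "optimal_effort M F B T g0 K \<gamma>P \<gamma>A \<Gamma> y a \<longleftrightarrow>
     (\<exists>\<beta>\<in>admissible M F T. a = reply \<Gamma> \<beta> \<and>
        principal_utility M F B T g0 K \<gamma>P \<gamma>A \<Gamma> y \<beta> = V_SB_at M F B T g0 K \<gamma>P \<gamma>A \<Gamma> y)"

definition optimal_contract ::
  "'a measure \<Rightarrow> (real \<Rightarrow> 'a measure) \<Rightarrow> (real \<Rightarrow> 'a \<Rightarrow> real ^ 'd) \<Rightarrow> real \<Rightarrow> (real \<Rightarrow> real) \<Rightarrow>
   (real \<Rightarrow> real \<Rightarrow> real ^ 'd) \<Rightarrow> real \<Rightarrow> real \<Rightarrow> real ^ 'd ^ 'd \<Rightarrow> real \<Rightarrow> ('a \<Rightarrow> real) \<Rightarrow> bool" where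
  "optimal_contract M F B T g0 K \<gamma>P \<gamma>A \<Gamma> y0 \<xi> \<longleftrightarrow>
     (\<exists>y\<ge>y0. \<exists>\<beta>\<in>admissible M F T. (AE \<omega> in M. \<xi> \<omega> = contract M F B T \<gamma>A \<Gamma> y \<beta> \<omega>) \<and>
        principal_utility M F B T g0 K \<gamma>P \<gamma>A \<Gamma> y \<beta> = V_SB M F B T g0 K \<gamma>P \<gamma>A \<Gamma> y0)"

end

theory Submission
  imports Defs
begin

text \<open>Put \<open>k = 1 / \<kappa>\<close>, \<open>D = \<gamma>\<^sub>A + \<gamma>\<^sub>P + k\<close> and \<open>c = (\<gamma>\<^sub>P + k) / D\<close>. Under the measure induced by the
  reply \<open>k \<beta>\<close>, completing the square turns the principal's expected disutility for the contract
  \<open>(y, \<beta>)\<close> into a constant, increasing in \<open>y\<close>, times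
  \<open>E[\<E>(\<theta>) exp (\<gamma>\<^sub>P D / 2 \<integral>\<parallel>\<beta> - c K\<parallel>\<^sup>2)]\<close>, where \<open>\<E>(\<theta>)\<close> is the stochastic exponential
  of \<open>\<theta> = (\<gamma>\<^sub>P + k) \<beta> - \<gamma>\<^sub>P K\<close>. Since \<open>\<theta>\<close> has bounded energy, \<open>\<E>(\<theta>)\<close> has mean one, so this
  expectation is at least one, with equality only if \<open>\<beta> = c K\<close> almost everywhere. The resulting
  contract is affine in \<open>X\<^sub>T\<close>, hence available to the principal who observes only \<open>X\<close>.

  Ito integrals are computed through averages of the integrand over the preceding cell of a uniform
  time grid: this approximation is linear in the integrand, adapted, and does not increase the
  pathwise energy.\<close>

section \<open>Step averages of square integrable functions\<close>

text \<open>The tilt \<open>\<theta>\<close> collects all dB-terms of the exponent: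
  \<open>k * \<beta>\<close> from the density of the effort, \<open>\<gamma>P * \<beta>\<close> from
  the contract and \<open>- \<gamma>P * K\<close> from the output. Adding and subtracting half its
  energy leaves a quadratic in \<open>\<beta>\<close> with leading coefficient
  \<open>\<gamma>P * D / 2\<close>. The terms in k^2 cancel, so this coefficient is positive
  whatever the sign of \<open>\<gamma>A - k\<close>, and \<open>c * K\<close> is the minimiser.
  Radial cost makes \<open>c\<close> a scalar; a matrix in its place would in general destroy the
  affine dependence on the final output. The obstacle is that the Ito integral is a choice among
  versions: nothing is known about it before existence is shown for every process of bounded energy,
  and then linearity and uniqueness hold only almost surely. The pathwise energy bound does the work
  twice: it dominates the approximation error, and it bounds the second moments of the discrete
  exponentials, which keeps their mean in the limit. The cell averages are delayed because an
  average over the current cell would look into the future.\<close>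

lemma ennreal_norm_add_square_le:
  fixes u v :: "'b::real_normed_vector"
  shows "ennreal ((norm (u + v))\<^sup>2) \<le> 2 * ennreal ((norm u)\<^sup>2) + 2 * ennreal ((norm v)\<^sup>2)"
proof -
  have "(norm (u + v))\<^sup>2 \<le> (norm u + norm v)\<^sup>2"
    by (intro power_mono norm_triangle_ineq) auto
  also have "\<dots> \<le> 2 * (norm u)\<^sup>2 + 2 * (norm v)\<^sup>2"
    using sum_squares_bound[of "norm u" "norm v"] by (simp add: power2_sum)
  finally have "ennreal ((norm (u + v))\<^sup>2) \<le> ennreal (2 * (norm u)\<^sup>2 + 2 * (norm v)\<^sup>2)"
    by (rule ennreal_leI)
  then show ?thesis
    by (simp add: ennreal_plus ennreal_mult)
qed

lemma nn_integral_norm_add_square_le: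
  fixes u v :: "'a \<Rightarrow> 'b::{real_normed_vector, second_countable_topology}"
  assumes [measurable]: "u \<in> borel_measurable N" "v \<in> borel_measurable N"
  shows "(\<integral>\<^sup>+x. ennreal ((norm (u x + v x))\<^sup>2) \<partial>N)
    \<le> 2 * (\<integral>\<^sup>+x. ennreal ((norm (u x))\<^sup>2) \<partial>N) + 2 * (\<integral>\<^sup>+x. ennreal ((norm (v x))\<^sup>2) \<partial>N)"
proof -
  have "(\<integral>\<^sup>+x. ennreal ((norm (u x + v x))\<^sup>2) \<partial>N)
    \<le> (\<integral>\<^sup>+x. 2 * ennreal ((norm (u x))\<^sup>2) + 2 * ennreal ((norm (v x))\<^sup>2) \<partial>N)"
    by (intro nn_integral_mono ennreal_norm_add_square_le)
  also have "\<dots> = 2 * (\<integral>\<^sup>+x. ennreal ((norm (u x))\<^sup>2) \<partial>N) + 2 * (\<integral>\<^sup>+x. ennreal ((norm (v x))\<^sup>2) \<partial>N)"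
    by (simp add: nn_integral_add nn_integral_cmult)
  finally show ?thesis .
qed

definition sq_norm :: "real \<Rightarrow> (real \<Rightarrow> 'b::real_normed_vector) \<Rightarrow> ennreal" where
  "sq_norm T f = (\<integral>\<^sup>+s\<in>{0..T}. ennreal ((norm (f s))\<^sup>2) \<partial>lborel)"

lemma sq_norm_add_le:
  fixes u v :: "real \<Rightarrow> 'b::{real_normed_vector, second_countable_topology}"
  assumes [measurable]: "u \<in> borel_measurable borel" "v \<in> borel_measurable borel"
  shows "sq_norm T (\<lambda>s. u s + v s) \<le> 2 * sq_norm T u + 2 * sq_norm T v"
proof -
  have "sq_norm T (\<lambda>s. u s + v s)
    \<le> (\<integral>\<^sup>+s. (2 * ennreal ((norm (u s))\<^sup>2) + 2 * ennreal ((norm (v s))\<^sup>2)) * indicator {0..T} s \<partial>lborel)"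
    unfolding sq_norm_def by (intro nn_integral_mono mult_right_mono ennreal_norm_add_square_le) auto
  also have "\<dots> = 2 * sq_norm T u + 2 * sq_norm T v"
    by (simp add: sq_norm_def nn_integral_add nn_integral_cmult distrib_right mult.assoc)
  finally show ?thesis .
qed

lemma sq_norm_scaleR:
  fixes u :: "real \<Rightarrow> 'b::{real_normed_vector, second_countable_topology}"
  assumes [measurable]: "u \<in> borel_measurable borel"
  shows "sq_norm T (\<lambda>s. r *\<^sub>R u s) = ennreal (r\<^sup>2) * sq_norm T u"
  by (simp add: sq_norm_def power_mult_distrib ennreal_mult mult.assoc nn_integral_cmult)

text \<open>The intervals are disjoint, so at most one summand is nonzero and any map fixing 0
  passes through the sum. It is applied to the norm and its square, which are not linear.\<close>

lemma sum_intervals_apply: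
  fixes \<tau> :: "nat \<Rightarrow> real" and c :: "nat \<Rightarrow> 'b::real_vector"
  assumes "g 0 = (0::'c::real_vector)" and "\<And>i. i < n \<Longrightarrow> \<tau> i \<le> \<tau> (Suc i)"
  shows "g (\<Sum>i<n. indicat_real {\<tau> i<..\<tau> (Suc i)} s *\<^sub>R c i)
    = (\<Sum>i<n. indicat_real {\<tau> i<..\<tau> (Suc i)} s *\<^sub>R g (c i))"
  using assms(2)
proof (induction n)
  case (Suc n)
  have mono: "\<tau> i \<le> \<tau> j" if "i \<le> j" "j \<le> Suc n" for i j
    using that
  proof (induction j)
    case (Suc j)
    then show ?case
      using Suc.prems(2) \<open>\<And>i. i < Suc n \<Longrightarrow> \<tau> i \<le> \<tau> (Suc i)\<close>[of j] by (cases "i = Suc j") auto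
  qed simp
  show ?case
  proof (cases "s \<in> {\<tau> n<..\<tau> (Suc n)}")
    case True
    then have "indicat_real {\<tau> i<..\<tau> (Suc i)} s = 0" if "i < n" for i
      using mono[of "Suc i" n] that by (auto simp: indicator_def)
    then show ?thesis
      using True by (simp add: assms(1))
  next
    case False
    then show ?thesis
      using Suc by simp
  qed
qed (simp add: assms(1))

section \<open>Delayed averages over a uniform grid\<close>

definition grid :: "real \<Rightarrow> nat \<Rightarrow> nat \<Rightarrow> real" where
  "grid T n i = T * real i / real (Suc n)"

text \<open>Cell \<open>i\<close> carries the mean over cell \<open>i - 1\<close>, so the
  coefficient is known at the left end of its own cell. Cell 0 has no predecessor and gets 0; there
  are \<open>Suc n\<close> cells, which keeps the mesh meaningful at \<open>n = 0\<close>.\<close>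

definition step_coeff :: "real \<Rightarrow> nat \<Rightarrow> (real \<Rightarrow> 'b::euclidean_space) \<Rightarrow> nat \<Rightarrow> 'b" where
  "step_coeff T n f i = (if i = 0 then 0 else
     (real (Suc n) / T) *\<^sub>R (LBINT s:{grid T n (i - 1)<..grid T n i}. f s))"

definition step_avg :: "real \<Rightarrow> nat \<Rightarrow> (real \<Rightarrow> 'b::euclidean_space) \<Rightarrow> real \<Rightarrow> 'b" where
  "step_avg T n f s =
     (\<Sum>i<Suc n. indicator {grid T n i<..grid T n (Suc i)} s *\<^sub>R step_coeff T n f i)"

lemma grid_0 [simp]: "grid T n 0 = 0" and grid_Suc [simp]: "grid T n (Suc n) = T"
  by (auto simp: grid_def)

lemma grid_mono: "0 < T \<Longrightarrow> i \<le> j \<Longrightarrow> grid T n i \<le> grid T n j"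
  by (simp add: grid_def divide_right_mono)

lemma grid_diff: "grid T n (Suc i) - grid T n i = T / real (Suc n)"
  unfolding grid_def by (subst diff_divide_distrib[symmetric]) (simp add: algebra_simps)

lemma step_avg_measurable [measurable]: "step_avg T n f \<in> borel_measurable borel"
  unfolding step_avg_def[abs_def] by measurable

abbreviation cell :: "real \<Rightarrow> nat \<Rightarrow> nat \<Rightarrow> real set" where
  "cell T n i \<equiv> {grid T n i<..grid T n (Suc i)}"

lemma sum_grid_indicator:
  assumes "0 < T"
  shows "(\<Sum>i<m. indicator (cell T n i) s) = (indicator {0<..grid T n m} s :: 'c::semiring_1)"
proof (induction m)
  case (Suc m)
  then show ?case
    using grid_mono[OF assms, of 0 m n] grid_mono[OF assms, of m "Suc m" n]
    by (auto simp: indicator_def)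
qed simp

text \<open>Cauchy-Schwarz on one cell: the square of a mean is at most the mean of the square. If
  \<open>f\<close> is not integrable on the cell, the Bochner integral is 0 and the bound is
  trivial.\<close>

lemma step_coeff_square_le:
  fixes f :: "real \<Rightarrow> 'b::euclidean_space"
  assumes "0 < T" and [measurable]: "f \<in> borel_measurable borel"
  shows "ennreal ((norm (step_coeff T n f (Suc i)))\<^sup>2) * ennreal (T / real (Suc n))
    \<le> (\<integral>\<^sup>+s\<in>cell T n i. ennreal ((norm (f s))\<^sup>2) \<partial>lborel)"
proof -
  let ?I = "cell T n i" and ?h = "T / real (Suc n)"
  have h: "?h > 0" using assms(1) by simp
  let ?N = "\<integral>\<^sup>+s. ennreal (norm (f s)) * indicator ?I s \<partial>lborel"
  have le: "ennreal (norm (LBINT s:?I. f s)) \<le> ?N"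
  proof (cases "set_integrable lborel ?I f")
    case True
    then show ?thesis
      using integral_norm_bound_ennreal[of lborel "\<lambda>s. indicator ?I s *\<^sub>R f s"]
      unfolding set_integrable_def set_lebesgue_integral_def
      by (auto elim!: order_trans intro!: nn_integral_mono simp: indicator_def)
  next
    case False
    then show ?thesis
      by (simp add: set_integrable_def set_lebesgue_integral_def not_integrable_integral_eq)
  qed
  \<comment> \<open>The indicator is doubled so that one copy becomes the second factor in
    Cauchy-Schwarz and contributes the cell length.\<close>
  have "?N\<^sup>2 = (\<integral>\<^sup>+s. (ennreal (norm (f s)) * indicator ?I s) * indicator ?I s \<partial>lborel)\<^sup>2"
    by (intro arg_cong[where f="\<lambda>x. x\<^sup>2"] nn_integral_cong) (auto simp: indicator_def)
  also have "\<dots> \<le> (\<integral>\<^sup>+s. (ennreal (norm (f s)) * indicator ?I s)\<^sup>2 \<partial>lborel) * (\<integral>\<^sup>+s. (indicator ?I s)\<^sup>2 \<partial>lborel)"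
    by (intro Cauchy_Schwarz_nn_integral) auto
  also have "(\<integral>\<^sup>+s. (indicator ?I s :: ennreal)\<^sup>2 \<partial>lborel) = emeasure lborel ?I"
  proof -
    have "(indicator ?I s :: ennreal)\<^sup>2 = indicator ?I s" for s
      by (auto simp: indicator_def)
    then show ?thesis by simp
  qed
  also have "\<dots> = ennreal ?h"
    using grid_mono[OF assms(1), of i "Suc i" n] by (simp add: grid_diff)
  also have "(\<integral>\<^sup>+s. (ennreal (norm (f s)) * indicator ?I s)\<^sup>2 \<partial>lborel)
      = (\<integral>\<^sup>+s\<in>?I. ennreal ((norm (f s))\<^sup>2) \<partial>lborel)" (is "_ = ?R")
    by (intro nn_integral_cong) (auto simp: indicator_def ennreal_power)
  finally have CS: "?N\<^sup>2 \<le> ?R * ennreal ?h" .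
  have "ennreal ((norm (step_coeff T n f (Suc i)))\<^sup>2) * ennreal ?h
      = ennreal ((1 / ?h)) * (ennreal (norm (LBINT s:?I. f s)))\<^sup>2"
  proof -
    define x where "x = norm (LBINT s:?I. f s)"
    have x: "norm (step_coeff T n f (Suc i)) = 1 / ?h * x"
      using assms(1) by (simp add: step_coeff_def x_def del: of_nat_Suc)
    have "(1 / ?h * x)\<^sup>2 * ?h = 1 / ?h * x\<^sup>2"
      using h by (simp add: power2_eq_square del: of_nat_Suc)
    then have "ennreal ((1 / ?h * x)\<^sup>2) * ennreal ?h = ennreal (1 / ?h) * ennreal (x\<^sup>2)"
      using h assms(1) by (simp add: ennreal_mult[symmetric] del: of_nat_Suc)
    then show ?thesis
      unfolding x by (simp add: ennreal_power x_def del: of_nat_Suc)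
  qed
  also have "\<dots> \<le> ennreal (1 / ?h) * (?R * ennreal ?h)"
    by (intro mult_left_mono order_trans[OF power_mono[OF le] CS]) auto
  also have "\<dots> = ennreal (1 / ?h * ?h) * ?R"
    using h assms(1) by (subst ennreal_mult) (simp_all add: mult_ac del: of_nat_Suc)
  also have "\<dots> = ?R" using h assms(1) by (simp del: of_nat_Suc)
  finally show ?thesis .
qed

lemma norm_step_avg_square:
  assumes "0 < T"
  shows "ennreal ((norm (step_avg T n f s))\<^sup>2)
    = (\<Sum>i<Suc n. indicator (cell T n i) s * ennreal ((norm (step_coeff T n f i))\<^sup>2))"
proof -
  have "(norm (step_avg T n f s))\<^sup>2
    = (\<Sum>i<Suc n. indicator (cell T n i) s *\<^sub>R (norm (step_coeff T n f i))\<^sup>2)"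
    unfolding step_avg_def
    using grid_mono[OF assms]
    by (subst sum_intervals_apply[where g="\<lambda>x. (norm x)\<^sup>2"]) auto
  then show ?thesis
    by (simp add: ennreal_mult ennreal_indicator flip: sum_ennreal del: sum.lessThan_Suc)
qed

text \<open>The coefficients on the cells 1 to \<open>n\<close> see the cells 0 to
  \<open>n - 1\<close>, so the cell-wise bounds add up to the energy of \<open>f\<close> on
  \<open>{0<..grid T n n}\<close>; the delay drops the last cell.\<close>

lemma sq_norm_step_avg_le:
  fixes f :: "real \<Rightarrow> 'b::euclidean_space"
  assumes "0 < T" and [measurable]: "f \<in> borel_measurable borel"
  shows "sq_norm T (step_avg T n f) \<le> sq_norm T f"
proof -
  let ?I = "\<lambda>i. cell T n i"
  have "sq_norm T (step_avg T n f) \<le> (\<integral>\<^sup>+s. ennreal ((norm (step_avg T n f s))\<^sup>2) \<partial>lborel)"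
    unfolding sq_norm_def by (intro nn_integral_mono) (auto simp: indicator_def)
  also have "\<dots> = (\<Sum>i<Suc n. (\<integral>\<^sup>+s. indicator (?I i) s * ennreal ((norm (step_coeff T n f i))\<^sup>2) \<partial>lborel))"
    unfolding norm_step_avg_square[OF assms(1)] by (intro nn_integral_sum) auto
  also have "\<dots> = (\<Sum>i<Suc n. ennreal ((norm (step_coeff T n f i))\<^sup>2) * ennreal (T / real (Suc n)))"
    using grid_mono[OF assms(1), of _ "Suc _" n]
    by (intro sum.cong refl) (simp add: nn_integral_multc grid_diff mult.commute nn_integral_cmult_indicator)
  also have "\<dots> = (\<Sum>i<n. ennreal ((norm (step_coeff T n f (Suc i)))\<^sup>2) * ennreal (T / real (Suc n)))"
    by (subst sum.lessThan_Suc_shift) (simp add: step_coeff_def)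
  also have "\<dots> \<le> (\<Sum>i<n. \<integral>\<^sup>+s\<in>?I i. ennreal ((norm (f s))\<^sup>2) \<partial>lborel)"
    by (intro sum_mono step_coeff_square_le assms)
  also have "\<dots> = (\<integral>\<^sup>+s. (\<Sum>i<n. ennreal ((norm (f s))\<^sup>2) * indicator (?I i) s) \<partial>lborel)"
    by (intro nn_integral_sum[symmetric]) auto
  also have "\<dots> = (\<integral>\<^sup>+s. ennreal ((norm (f s))\<^sup>2) * indicator {0<..grid T n n} s \<partial>lborel)"
    by (simp only: sum_distrib_left[symmetric] sum_grid_indicator[OF assms(1)])
  also have "\<dots> \<le> sq_norm T f"
    unfolding sq_norm_def
    using grid_mono[OF assms(1), of n "Suc n" n] by (intro nn_integral_mono) (auto simp: indicator_def)
  finally show ?thesis .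
qed

lemma ennreal_tendsto_0I:
  fixes f :: "'a \<Rightarrow> ennreal"
  assumes "\<And>e::real. 0 < e \<Longrightarrow> eventually (\<lambda>x. f x \<le> ennreal e) F"
  shows "(f \<longlongrightarrow> 0) F"
proof (rule order_tendstoI)
  fix a :: ennreal assume "0 < a"
  then obtain e where e: "0 < e" "ennreal e < a"
    by (metis ennreal_less_zero_iff ennreal_rat_dense ennreal_cases leI not_less_zero ennreal_neg dense ennreal_top_neq_zero less_top top.extremum_strict)
  show "eventually (\<lambda>x. f x < a) F"
    using assms[OF e(1)] by eventually_elim (use e(2) in auto)
qed auto

text \<open>Borel measurability is asked on the whole line although only \<open>{0..T}\<close>
  enters the norm; paths of processes are therefore first multiplied by the indicator of
  \<open>{0..T}\<close>.\<close>

definition L2 :: "real \<Rightarrow> (real \<Rightarrow> 'b::euclidean_space) \<Rightarrow> bool" where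
  "L2 T f \<longleftrightarrow> f \<in> borel_measurable borel \<and> sq_norm T f < \<infinity>"

lemma L2_add: "L2 T f \<Longrightarrow> L2 T g \<Longrightarrow> L2 T (\<lambda>s. f s + g s)"
  using sq_norm_add_le[of f g T]
  by (auto simp: L2_def ennreal_mult_less_top ennreal_add_less_top intro: le_less_trans)

lemma L2_scaleR: "L2 T f \<Longrightarrow> L2 T (\<lambda>s. r *\<^sub>R f s)"
  by (auto simp: L2_def sq_norm_scaleR ennreal_mult_less_top)

lemma L2_sum: "finite I \<Longrightarrow> (\<And>i. i \<in> I \<Longrightarrow> L2 T (f i)) \<Longrightarrow> L2 T (\<lambda>s. \<Sum>i\<in>I. f i s)"
proof (induction I rule: finite_induct)
  case empty
  then show ?case by (simp add: L2_def sq_norm_def)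
qed (auto intro!: L2_add)

lemma L2_bounded:
  assumes [measurable]: "f \<in> borel_measurable borel" and "\<And>s. norm (f s) \<le> C"
  shows "L2 T f"
proof -
  have "sq_norm T f \<le> (\<integral>\<^sup>+s. ennreal (C\<^sup>2) * indicator {0..T} s \<partial>lborel)"
    unfolding sq_norm_def
    by (intro nn_integral_mono mult_right_mono ennreal_leI power_mono assms) auto
  also have "\<dots> < \<infinity>"
    by (cases "0 \<le> T") (simp_all add: nn_integral_cmult_indicator ennreal_mult_less_top)
  finally show ?thesis by (simp add: L2_def)
qed

lemma sq_norm_dominated_convergence:
  fixes f :: "nat \<Rightarrow> real \<Rightarrow> 'b::euclidean_space" and w :: "real \<Rightarrow> real"
  assumes [measurable]: "\<And>n. f n \<in> borel_measurable borel" and w: "L2 T w" "\<And>n s. norm (f n s) \<le> w s"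
    and lim: "AE s in lborel. s \<in> {0..T} \<longrightarrow> (\<lambda>n. f n s) \<longlonglongrightarrow> 0"
  shows "(\<lambda>n. sq_norm T (f n)) \<longlonglongrightarrow> 0"
proof -
  have [measurable]: "w \<in> borel_measurable borel" using w by (simp add: L2_def)
  have "(\<lambda>n. \<integral>\<^sup>+s. ennreal ((norm (f n s))\<^sup>2) * indicator {0..T} s \<partial>lborel) \<longlonglongrightarrow> (\<integral>\<^sup>+(s::real). 0 \<partial>lborel)"
  proof (rule nn_integral_dominated_convergence[where w="\<lambda>s. ennreal ((norm (w s))\<^sup>2) * indicator {0..T} s"])
    show "(\<integral>\<^sup>+s. ennreal ((norm (w s))\<^sup>2) * indicator {0..T} s \<partial>lborel) < \<infinity>"
      using w(1) by (simp add: L2_def sq_norm_def)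
    show "AE s in lborel. ennreal ((norm (f n s))\<^sup>2) * indicator {0..T} s
      \<le> ennreal ((norm (w s))\<^sup>2) * indicator {0..T} s" for n
      using w(2)[of n] by (intro AE_I2 mult_right_mono ennreal_leI power_mono) (auto intro: order_trans[OF _ abs_ge_self])
    show "AE s in lborel. (\<lambda>n. ennreal ((norm (f n s))\<^sup>2) * indicator {0..T} s) \<longlonglongrightarrow> 0"
      using lim
    proof eventually_elim
      case (elim s)
      show ?case
      proof (cases "s \<in> {0..T}")
        case True
        then have "(\<lambda>n. ennreal ((norm (f n s))\<^sup>2)) \<longlonglongrightarrow> ennreal ((norm (0::'b))\<^sup>2)"
          using elim by (intro tendsto_ennrealI tendsto_power tendsto_norm) simp
        then show ?thesis using True by simp
      qed simp
    qed
  qed auto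
  then show ?thesis by (simp add: sq_norm_def)
qed

text \<open>Since \<open>{0..T}\<close> has finite length, the bound of \<open>norm (f s)\<close> by
  one plus its square is enough.\<close>

lemma L2_set_integrable:
  fixes f :: "real \<Rightarrow> 'b::euclidean_space"
  assumes "L2 T f" "A \<subseteq> {0..T}" and [measurable]: "A \<in> sets borel"
  shows "set_integrable lborel A f"
  unfolding set_integrable_def
proof (rule integrableI_bounded)
  have [measurable]: "f \<in> borel_measurable borel" using assms by (simp add: L2_def)
  show "(\<lambda>s. indicat_real A s *\<^sub>R f s) \<in> borel_measurable lborel" by simp
  have "(\<integral>\<^sup>+s. ennreal (norm (indicat_real A s *\<^sub>R f s)) \<partial>lborel)
    \<le> (\<integral>\<^sup>+s. (1 + ennreal ((norm (f s))\<^sup>2)) * indicator {0..T} s \<partial>lborel)"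
  proof (intro nn_integral_mono)
    fix s
    have "norm (f s) \<le> 1 + (norm (f s))\<^sup>2"
      using sum_squares_bound[of "norm (f s)" 1] by (auto simp: power2_eq_square) (smt (verit) norm_ge_zero)
    then have "ennreal (norm (f s)) \<le> 1 + ennreal ((norm (f s))\<^sup>2)"
      by (metis ennreal_1 ennreal_leI ennreal_plus zero_le_one zero_le_power2)
    then show "ennreal (norm (indicat_real A s *\<^sub>R f s))
      \<le> (1 + ennreal ((norm (f s))\<^sup>2)) * indicator {0..T} s"
      using assms(2) by (auto simp: indicator_def)
  qed
  also have "\<dots> = emeasure lborel {0..T} + sq_norm T f"
    by (simp add: distrib_right nn_integral_add sq_norm_def)
  also have "\<dots> < \<infinity>"
    using assms by (cases "0 \<le> T") (auto simp: L2_def)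
  finally show "(\<integral>\<^sup>+s. ennreal (norm (indicat_real A s *\<^sub>R f s)) \<partial>lborel) < \<infinity>" .
qed

text \<open>Additivity of the Bochner integral requires integrability on the averaged cell;
  \<open>i \<le> n\<close> keeps this cell inside \<open>{0..T}\<close>, where \<open>L2\<close>
  provides it.\<close>

lemma step_coeff_add:
  assumes "0 < T" "L2 T f" "L2 T g" "i \<le> n"
  shows "step_coeff T n (\<lambda>s. f s + g s) i = step_coeff T n f i + step_coeff T n g i"
proof -
  have "{grid T n (i - 1)<..grid T n i} \<subseteq> {0..T}"
    using grid_mono[OF assms(1), of 0 "i - 1" n] grid_mono[OF assms(1), of i "Suc n" n] assms(4) by auto
  then show ?thesis
    using assms by (auto simp: step_coeff_def L2_set_integrable set_integral_add scaleR_add_right)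
qed

lemma step_coeff_scaleR: "step_coeff T n (\<lambda>s. r *\<^sub>R f s) i = r *\<^sub>R step_coeff T n f i"
  by (simp add: step_coeff_def set_integral_scaleR_right)

lemma step_avg_add:
  assumes "0 < T" "L2 T f" "L2 T g"
  shows "step_avg T n (\<lambda>s. f s + g s) s = step_avg T n f s + step_avg T n g s"
  unfolding step_avg_def sum.distrib[symmetric]
  by (intro sum.cong refl) (auto simp: step_coeff_add[OF assms] scaleR_add_right)

lemma step_avg_scaleR: "step_avg T n (\<lambda>s. r *\<^sub>R f s) s = r *\<^sub>R step_avg T n f s"
  unfolding step_avg_def scaleR_sum_right
  by (intro sum.cong refl) (simp add: step_coeff_scaleR)

lemma step_avg_diff:
  assumes "0 < T" "L2 T f" "L2 T g"
  shows "step_avg T n (\<lambda>s. f s - g s) s = step_avg T n f s - step_avg T n g s"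
  using step_avg_add[OF assms(1,2) L2_scaleR[OF assms(3), of "-1"]] step_avg_scaleR[of T n "-1" g s] by simp

section \<open>L2 convergence of the averages\<close>

definition step_avg_conv :: "real \<Rightarrow> (real \<Rightarrow> 'b::euclidean_space) \<Rightarrow> bool" where
  "step_avg_conv T f \<longleftrightarrow> (\<lambda>n. sq_norm T (\<lambda>s. step_avg T n f s - f s)) \<longlonglongrightarrow> 0"

lemma step_avg_conv_add:
  assumes "0 < T" "L2 T f" "L2 T g" "step_avg_conv T f" "step_avg_conv T g"
  shows "step_avg_conv T (\<lambda>s. f s + g s)"
  unfolding step_avg_conv_def
proof (rule tendsto_sandwich[OF _ _ tendsto_const])
  have [measurable]: "f \<in> borel_measurable borel" "g \<in> borel_measurable borel"
    using assms by (auto simp: L2_def)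
  show "\<forall>\<^sub>F n in sequentially. sq_norm T (\<lambda>s. step_avg T n (\<lambda>s. f s + g s) s - (f s + g s))
      \<le> 2 * sq_norm T (\<lambda>s. step_avg T n f s - f s) + 2 * sq_norm T (\<lambda>s. step_avg T n g s - g s)"
    using sq_norm_add_le[of "\<lambda>s. step_avg T _ f s - f s" "\<lambda>s. step_avg T _ g s - g s" T]
    by (simp add: step_avg_add[OF assms(1-3)] algebra_simps)
  have "(\<lambda>n. 2 * sq_norm T (\<lambda>s. step_avg T n f s - f s) + 2 * sq_norm T (\<lambda>s. step_avg T n g s - g s))
      \<longlonglongrightarrow> 2 * 0 + 2 * 0"
    using assms(4,5) unfolding step_avg_conv_def
    by (intro tendsto_add ennreal_tendsto_cmult) auto
  then show "(\<lambda>n. 2 * sq_norm T (\<lambda>s. step_avg T n f s - f s) + 2 * sq_norm T (\<lambda>s. step_avg T n g s - g s))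
      \<longlonglongrightarrow> 0" by simp
qed auto

lemma step_avg_conv_scaleR:
  assumes "L2 T f" "step_avg_conv T f"
  shows "step_avg_conv T (\<lambda>s. r *\<^sub>R f s)"
proof -
  have [measurable]: "f \<in> borel_measurable borel"
    using assms by (auto simp: L2_def)
  have "sq_norm T (\<lambda>s. step_avg T n (\<lambda>s. r *\<^sub>R f s) s - r *\<^sub>R f s)
      = ennreal (r\<^sup>2) * sq_norm T (\<lambda>s. step_avg T n f s - f s)" for n
    by (subst sq_norm_scaleR[symmetric]) (auto simp: step_avg_scaleR algebra_simps)
  moreover have "(\<lambda>n. ennreal (r\<^sup>2) * sq_norm T (\<lambda>s. step_avg T n f s - f s)) \<longlonglongrightarrow> ennreal (r\<^sup>2) * 0"
    using assms(2) unfolding step_avg_conv_def by (intro ennreal_tendsto_cmult) auto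
  ultimately show ?thesis by (simp add: step_avg_conv_def)
qed

lemma step_avg_conv_sum:
  fixes f :: "'i \<Rightarrow> real \<Rightarrow> 'b::euclidean_space"
  assumes "0 < T" "finite I" "\<And>i. i \<in> I \<Longrightarrow> L2 T (f i)" "\<And>i. i \<in> I \<Longrightarrow> step_avg_conv T (f i)"
  shows "step_avg_conv T (\<lambda>s. \<Sum>i\<in>I. f i s)"
  using assms(2-)
proof (induction I rule: finite_induct)
  case empty
  then show ?case
    using step_avg_scaleR[of T _ 0 "\<lambda>_. 0::'b"] by (simp add: step_avg_conv_def sq_norm_def)
qed (auto intro!: step_avg_conv_add L2_sum assms(1))

text \<open>With S for averaging, S f - f = S (f - g) + (S g - g) - (f - g), and S is a contraction.
  Two uses of the square bound give the factors 2 * (2 + 2) + 2 = 10, hence the thresholds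
  \<open>e / 10\<close>.\<close>

lemma step_avg_conv_limit:
  assumes "0 < T" "L2 T f" "\<And>k. L2 T (g k)" "\<And>k. step_avg_conv T (g k)"
    and "(\<lambda>k. sq_norm T (\<lambda>s. f s - g k s)) \<longlonglongrightarrow> 0"
  shows "step_avg_conv T f"
  unfolding step_avg_conv_def
proof (rule ennreal_tendsto_0I)
  fix e :: real assume "0 < e"
  have f[measurable]: "f \<in> borel_measurable borel" and g[measurable]: "g k \<in> borel_measurable borel" for k
    using assms(2,3) by (auto simp: L2_def)
  from \<open>0 < e\<close> have e: "ennreal (e / 10) > 0" by simp
  then obtain k where k: "sq_norm T (\<lambda>s. f s - g k s) < ennreal (e / 10)"
    using order_tendstoD(2)[OF assms(5) e] by (auto simp: eventually_sequentially)
  have "\<forall>\<^sub>F n in sequentially. sq_norm T (\<lambda>s. step_avg T n (g k) s - g k s) < ennreal (e / 10)"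
    using assms(4)[of k] e unfolding step_avg_conv_def by (rule order_tendstoD(2))
  then show "\<forall>\<^sub>F n in sequentially. sq_norm T (\<lambda>s. step_avg T n f s - f s) \<le> ennreal e"
  proof eventually_elim
    case (elim n)
    have neg: "sq_norm T (\<lambda>s. (-1) *\<^sub>R (f s - g k s)) = sq_norm T (\<lambda>s. f s - g k s)"
      by (subst sq_norm_scaleR) auto
    have "sq_norm T (\<lambda>s. step_avg T n f s - f s)
      = sq_norm T (\<lambda>s. (step_avg T n (\<lambda>s. f s - g k s) s + (step_avg T n (g k) s - g k s)) + (-1) *\<^sub>R (f s - g k s))"
      by (simp add: step_avg_diff assms)
    also have "\<dots> \<le> 2 * sq_norm T (\<lambda>s. step_avg T n (\<lambda>s. f s - g k s) s + (step_avg T n (g k) s - g k s))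
        + 2 * sq_norm T (\<lambda>s. (-1) *\<^sub>R (f s - g k s))"
      by (intro sq_norm_add_le) auto
    also have "\<dots> \<le> 2 * (2 * sq_norm T (step_avg T n (\<lambda>s. f s - g k s)) + 2 * sq_norm T (\<lambda>s. step_avg T n (g k) s - g k s))
        + 2 * (sq_norm T (\<lambda>s. f s - g k s))"
      unfolding neg by (intro add_mono mult_left_mono sq_norm_add_le) auto
    also have "\<dots> \<le> 2 * (2 * ennreal (e / 10) + 2 * ennreal (e / 10)) + 2 * ennreal (e / 10)"
      using elim k sq_norm_step_avg_le[OF assms(1), of "\<lambda>s. f s - g k s" n]
      by (intro add_mono mult_left_mono) auto
    also have "\<dots> = ennreal e"
      using \<open>0 < e\<close> by (simp flip: ennreal_plus ennreal_numeral ennreal_mult)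
    finally show ?case .
  qed
qed

text \<open>Comparing the cell energy of \<open>f\<close> with that of the constant \<open>C\<close>
  bounds each coefficient, and at most one coefficient is active at any time.\<close>

lemma norm_step_avg_le:
  fixes f :: "real \<Rightarrow> 'b::euclidean_space"
  assumes "0 < T" and [measurable]: "f \<in> borel_measurable borel" and f: "\<And>s. norm (f s) \<le> C"
  shows "norm (step_avg T n f s) \<le> C"
proof -
  have C: "0 \<le> C" using f[of 0] norm_ge_zero[of "f 0"] by linarith
  have coeff: "norm (step_coeff T n f i) \<le> C" for i
  proof (cases i)
    case (Suc j)
    have "ennreal ((norm (step_coeff T n f i))\<^sup>2) * ennreal (T / real (Suc n))
      \<le> (\<integral>\<^sup>+s\<in>cell T n j. ennreal (C\<^sup>2) \<partial>lborel)"
      unfolding Suc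
      by (intro order_trans[OF step_coeff_square_le] nn_integral_mono mult_right_mono ennreal_leI power_mono f assms) auto
    also have "\<dots> = ennreal (C\<^sup>2) * ennreal (T / real (Suc n))"
      using grid_mono[OF assms(1), of j "Suc j" n] by (simp add: nn_integral_cmult_indicator grid_diff del: of_nat_Suc)
    finally have "(norm (step_coeff T n f i))\<^sup>2 * (T / real (Suc n)) \<le> C\<^sup>2 * (T / real (Suc n))"
      using assms(1) by (simp add: ennreal_mult[symmetric] del: of_nat_Suc)
    then have "(norm (step_coeff T n f i))\<^sup>2 \<le> C\<^sup>2"
      by (rule mult_right_le_imp_le) (use assms(1) in simp)
    then show ?thesis using C by (simp add: power2_le_iff_abs_le)
  qed (use C in \<open>simp add: step_coeff_def\<close>)
  have eq: "norm (step_avg T n f s)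
    = (\<Sum>i<Suc n. indicat_real (cell T n i) s *\<^sub>R norm (step_coeff T n f i))"
    unfolding step_avg_def using grid_mono[OF assms(1)] by (subst sum_intervals_apply[where g=norm]) auto
  have "norm (step_avg T n f s) \<le> (\<Sum>i<Suc n. indicator (cell T n i) s * C)"
    unfolding eq real_scaleR_def by (intro sum_mono mult_left_mono coeff) auto
  also have "\<dots> \<le> C"
    unfolding sum_distrib_right[symmetric] sum_grid_indicator[OF assms(1)]
    using C by (auto simp: indicator_def)
  finally show ?thesis .
qed

text \<open>Once two mesh widths fit into the neighbourhood of \<open>s\<close> on which
  \<open>f\<close> is constant, the mean over the preceding cell equals \<open>f s\<close>.
  Boundedness turns this into L2 convergence by domination.\<close>

lemma step_avg_conv_locally_constant:
  fixes f :: "real \<Rightarrow> 'b::euclidean_space"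
  assumes T: "0 < T" and [measurable]: "f \<in> borel_measurable borel" and f: "\<And>s. norm (f s) \<le> C"
    and lc: "AE s in lborel. \<exists>d>0. \<forall>u. \<bar>u - s\<bar> < d \<longrightarrow> f u = f s"
  shows "step_avg_conv T f"
proof -
  have C: "0 \<le> C" using f[of 0] norm_ge_zero[of "f 0"] by linarith
  have pw: "\<forall>\<^sub>F n in sequentially. step_avg T n f s = f s"
    if s: "0 < s" "s \<le> T" and d: "0 < d" "\<And>u. \<bar>u - s\<bar> < d \<Longrightarrow> f u = f s" for s d
  proof -
    have "(\<lambda>n. T / real (Suc n)) \<longlonglongrightarrow> 0"
      by (rule LIMSEQ_Suc[OF lim_const_over_n])
    \<comment> \<open>Points of the preceding cell lie within two mesh widths of \<open>s\<close>,
      hence \<open>d / 2\<close>; the bound by \<open>s\<close> keeps \<open>s\<close> out of the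
      first cell, whose coefficient is 0.\<close>
    then have "\<forall>\<^sub>F n in sequentially. T / real (Suc n) < min (d / 2) s"
      by (rule order_tendstoD(2)) (use s d in auto)
    then show ?thesis
    proof eventually_elim
      case (elim n)
      let ?h = "T / real (Suc n)"
      have local_eq: "indicat_real (cell T n i) s *\<^sub>R step_coeff T n f i
        = indicat_real (cell T n i) s *\<^sub>R f s" for i
      proof (cases "s \<in> cell T n i")
        case True
        then have "i \<noteq> 0" using elim grid_diff[of T n 0] by (intro notI) auto
        then obtain j where i: "i = Suc j" by (cases i) auto
        have "\<bar>u - s\<bar> < d" if "u \<in> {grid T n j<..grid T n i}" for u
        proof -
          have "u \<le> s" "s - u < 2 * ?h"
            using that True grid_diff[of T n i] grid_diff[of T n j] unfolding i by (auto simp del: of_nat_Suc)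
          moreover have "?h < d / 2"
            using elim by (rule less_le_trans) simp
          ultimately show ?thesis by linarith
        qed
        then have "(LBINT u:{grid T n j<..grid T n i}. f u) = (LBINT u:{grid T n j<..grid T n i}. f s)"
          by (intro set_lebesgue_integral_cong) (auto intro!: d(2))
        also have "\<dots> = ?h *\<^sub>R f s"
          using grid_mono[OF T, of j i n] by (simp add: set_lebesgue_integral_def integral_scaleR_left[where M=lborel] i grid_diff measure_def less_imp_le[OF T] del: of_nat_Suc)
        finally have "step_coeff T n f i = f s"
          using T by (simp add: step_coeff_def i del: of_nat_Suc)
        then show ?thesis by simp
      qed simp
      have "step_avg T n f s = (\<Sum>i<Suc n. indicat_real (cell T n i) s) *\<^sub>R f s"
        unfolding step_avg_def scaleR_sum_left by (intro sum.cong refl local_eq)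
      also have "\<dots> = f s"
        using s by (simp only: sum_grid_indicator[OF T] grid_Suc) simp
      finally show ?case .
    qed
  qed
  show ?thesis
    unfolding step_avg_conv_def
  proof (rule sq_norm_dominated_convergence[where w="\<lambda>_. 2 * C"])
    show "L2 T (\<lambda>_. 2 * C)" by (intro L2_bounded[of _ "2 * C"]) (use C in auto)
    show "norm (step_avg T n f s - f s) \<le> 2 * C" for n s
      using norm_step_avg_le[OF T assms(2) f, of n s] f[of s] norm_triangle_ineq4[of "step_avg T n f s" "f s"] by simp
    show "AE s in lborel. s \<in> {0..T} \<longrightarrow> (\<lambda>n. step_avg T n f s - f s) \<longlonglongrightarrow> 0"
      using lc AE_lborel_singleton[of 0]
    proof eventually_elim
      case (elim s)
      show ?case
      proof
        assume "s \<in> {0..T}"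
        then have sT: "0 < s" "s \<le> T"
          using elim(2) by auto
        obtain d where d: "0 < d" "\<And>u. \<bar>u - s\<bar> < d \<Longrightarrow> f u = f s"
          using elim(1) by blast
        have "\<forall>\<^sub>F n in sequentially. step_avg T n f s = f s"
          by (rule pw[OF sT d])
        then have "\<forall>\<^sub>F n in sequentially. step_avg T n f s - f s = 0"
          by eventually_elim simp
        then show "(\<lambda>n. step_avg T n f s - f s) \<longlonglongrightarrow> 0" by (rule tendsto_eventually)
      qed
    qed
  qed auto
qed

text \<open>Half-lines are closed under intersection and generate the Borel sets, and their
  indicators are locally constant off one point. The sets with convergent averages are closed under
  complements and countable disjoint unions, so Dynkin's theorem yields all Borel sets.\<close>

lemma step_avg_conv_indicator:
  fixes c :: "'b::euclidean_space"
  assumes T: "0 < T" and A: "A \<in> sets borel"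
  shows "step_avg_conv T (\<lambda>s. indicat_real A s *\<^sub>R c)"
proof -
  have L2_ind: "L2 T (\<lambda>s. indicat_real A s *\<^sub>R c)" if "A \<in> sets borel" for A
    using that by (intro L2_bounded[of _ "norm c"]) (auto simp: indicator_def)
  have const: "step_avg_conv T (\<lambda>s. c)"
    using T by (intro step_avg_conv_locally_constant[of _ _ "norm c"]) (auto intro!: AE_I2 exI[of _ 1])
  have borel: "borel = sigma UNIV (range (\<lambda>a::real. {..a}))" by (rule borel_eq_atMost)
  have A': "A \<in> sigma_sets UNIV (range (\<lambda>a::real. {..a}))"
    using A unfolding borel by simp
  have sb: "A \<in> sets borel" if "A \<in> sigma_sets UNIV (range (\<lambda>a::real. {..a}))" for A
    using that unfolding borel by simp
  have "Int_stable (range (\<lambda>a::real. {..a}))"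
    by (auto simp: Int_stable_def Int_atMost)
  moreover have "range (\<lambda>a::real. {..a}) \<subseteq> Pow UNIV"
    by simp
  ultimately show ?thesis
    using A'
  proof (induction A rule: sigma_sets_induct_disjoint)
    case (basic A)
    then obtain a where [simp]: "A = {..a}" by auto
    show ?case
    proof (rule step_avg_conv_locally_constant[of _ _ "norm c"])
      show "AE s in lborel. \<exists>d>0. \<forall>u. \<bar>u - s\<bar> < d \<longrightarrow> indicat_real A u *\<^sub>R c = indicat_real A s *\<^sub>R c"
        using AE_lborel_singleton[of a]
      proof eventually_elim
        case (elim s)
        then show ?case by (intro exI[of _ "\<bar>s - a\<bar>"]) (auto simp: indicator_def)
      qed
    qed (auto simp: indicator_def T)
  next
    case empty
    then show ?case
      using step_avg_conv_scaleR[OF _ const, of 0] L2_bounded[of "\<lambda>_. c" "norm c" T] by simp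
  next
    case (compl A)
    have "step_avg_conv T (\<lambda>s. c + (-1) *\<^sub>R (indicat_real A s *\<^sub>R c))"
      by (intro step_avg_conv_add T const step_avg_conv_scaleR compl L2_scaleR L2_ind sb L2_bounded[of _ "norm c"]) auto
    moreover have "c + (-1) *\<^sub>R (indicat_real A s *\<^sub>R c) = indicat_real (UNIV - A) s *\<^sub>R c" for s
      by (simp add: indicator_def)
    ultimately show ?case by simp
  next
    case (union A)
    have A[measurable]: "A i \<in> sets borel" for i
      using union(2) by (intro sb) auto
    have part: "step_avg_conv T (\<lambda>s. indicat_real (\<Union>i<k. A i) s *\<^sub>R c)" for k
    proof (induction k)
      case 0
      then show ?case
        using step_avg_conv_scaleR[OF _ const, of 0] L2_bounded[of "\<lambda>_. c" "norm c" T] by simp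
    next
      case (Suc k)
      have dis: False if "s \<in> A k" "s \<in> A i" "i < k" for s i
        using disjoint_family_onD[OF union(1), of i k] that by auto
      have "indicat_real (\<Union>i<Suc k. A i) s *\<^sub>R c = indicat_real (\<Union>i<k. A i) s *\<^sub>R c + indicat_real (A k) s *\<^sub>R c" for s
        by (auto simp: indicator_def less_Suc_eq dest: dis)
      then show ?case
        by (simp only:) (intro step_avg_conv_add T Suc union L2_ind, auto)
    qed
    show ?case
    proof (rule step_avg_conv_limit[OF T _ _ part])
      show "(\<lambda>k. sq_norm T (\<lambda>s. indicat_real (\<Union>i. A i) s *\<^sub>R c - indicat_real (\<Union>i<k. A i) s *\<^sub>R c)) \<longlonglongrightarrow> 0"
      proof (rule sq_norm_dominated_convergence[where w="\<lambda>_. norm c"])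
        show "L2 T (\<lambda>_. norm c)" by (intro L2_bounded[of _ "norm c"]) auto
        have "(\<lambda>k. indicat_real (\<Union>i. A i) s *\<^sub>R c - indicat_real (\<Union>i<k. A i) s *\<^sub>R c)
            \<longlonglongrightarrow> indicat_real (\<Union>i. A i) s *\<^sub>R c - indicat_real (\<Union>i. A i) s *\<^sub>R c" for s
          by (intro tendsto_intros LIMSEQ_indicator_UN)
        then show "AE s in lborel. s \<in> {0..T} \<longrightarrow>
            (\<lambda>k. indicat_real (\<Union>i. A i) s *\<^sub>R c - indicat_real (\<Union>i<k. A i) s *\<^sub>R c) \<longlonglongrightarrow> 0"
          by simp
      qed (auto simp: indicator_def)
    qed (auto intro!: L2_ind)
  qed
qed

text \<open>Simple functions are finite combinations of indicators. The approximants stay below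
  \<open>2 * norm (f s)\<close>, so the error is dominated by \<open>3 * norm (f s)\<close>.\<close>

lemma step_avg_conv_L2:
  fixes f :: "real \<Rightarrow> 'b::euclidean_space"
  assumes T: "0 < T" and f: "L2 T f"
  shows "step_avg_conv T f"
proof -
  have [measurable]: "f \<in> borel_measurable borel" using f by (simp add: L2_def)
  obtain F where F: "\<And>i. simple_function borel (F i)" "\<And>x. (\<lambda>i. F i x) \<longlonglongrightarrow> f x"
    "\<And>i x. norm (F i x) \<le> 2 * norm (f x)"
    using borel_measurable_implies_sequence_metric[of f borel 0] by auto
  have [measurable]: "F i \<in> borel_measurable borel" for i
    using F(1) by (rule borel_measurable_simple_function)
  have ind: "L2 T (\<lambda>s. indicat_real (F i -` {y}) s *\<^sub>R y) \<and> step_avg_conv T (\<lambda>s. indicat_real (F i -` {y}) s *\<^sub>R y)" for i y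
  proof -
    have "F i -` {y} \<in> sets borel"
      using simple_functionD(2)[OF F(1)[of i], of "{y}"] by simp
    then show ?thesis
      by (intro conjI step_avg_conv_indicator[OF T] L2_bounded[of _ "norm y"]) (auto simp: indicator_def)
  qed
  have rep: "F i = (\<lambda>s. \<Sum>y\<in>range (F i). indicat_real (F i -` {y}) s *\<^sub>R y)" for i
    by (intro ext simple_function_indicator_representation_banach[OF F(1)[of i],
          unfolded space_borel Int_UNIV_right, OF UNIV_I])
  have fin: "finite (range (F i))" for i
    using simple_functionD(1)[OF F(1)[of i]] by simp
  show ?thesis
  proof (rule step_avg_conv_limit[OF T f])
    show "L2 T (F i)" for i by (subst rep) (intro L2_sum fin, use ind in auto)
    show "step_avg_conv T (F i)" for i by (subst rep) (intro step_avg_conv_sum T fin, use ind in auto)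
    show "(\<lambda>k. sq_norm T (\<lambda>s. f s - F k s)) \<longlonglongrightarrow> 0"
    proof (rule sq_norm_dominated_convergence[where w="\<lambda>s. 3 * norm (f s)"])
      have "L2 T (\<lambda>s. norm (f s))" using f by (simp add: L2_def sq_norm_def)
      from L2_scaleR[OF this, of 3] show "L2 T (\<lambda>s. 3 * norm (f s))" by simp
      show "norm (f s - F k s) \<le> 3 * norm (f s)" for k s
        using F(3)[of k s] norm_triangle_ineq4[of "f s" "F k s"] by simp
      have "(\<lambda>k. f s - F k s) \<longlonglongrightarrow> f s - f s" for s
        by (intro tendsto_intros F)
      then show "AE s in lborel. s \<in> {0..T} \<longrightarrow> (\<lambda>k. f s - F k s) \<longlonglongrightarrow> 0" by simp
    qed auto
  qed
qed

section \<open>Gaussian increments\<close>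

lemma vec_nth_measurable [measurable (raw)]:
  "f \<in> borel_measurable N \<Longrightarrow> (\<lambda>x. (f x :: real ^ 'd) $ i) \<in> borel_measurable N"
  unfolding cart_eq_inner_axis by (intro borel_measurable_inner measurable_const) auto

lemma bij_betw_axis_Basis: "bij_betw (\<lambda>i. axis i (1::real)) UNIV (Basis :: (real ^ 'd) set)"
  by (auto simp: bij_betw_def inj_on_def axis_eq_axis Basis_vec_def)

text \<open>The product formula for \<open>lborel\<close> runs over \<open>Basis\<close>;
  \<open>axis\<close> reindexes it by coordinates.\<close>

lemma nn_integral_lborel_vec_prod:
  fixes f :: "'d::finite \<Rightarrow> real \<Rightarrow> ennreal"
  assumes [measurable]: "\<And>i. f i \<in> borel_measurable borel"
  shows "(\<integral>\<^sup>+x. (\<Prod>i\<in>UNIV. f i ((x :: real ^ 'd) $ i)) \<partial>lborel) = (\<Prod>i\<in>UNIV. \<integral>\<^sup>+x. f i x \<partial>lborel)"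
proof -
  let ?ax = "\<lambda>i. axis i (1::real) :: real ^ 'd"
  define g where "g b = f (inv_into UNIV ?ax b)" for b
  have inv: "inv_into UNIV ?ax (?ax i) = i" for i
    using bij_betw_axis_Basis by (intro inv_into_f_f) (auto simp: bij_betw_def)
  have "(\<Prod>i\<in>UNIV. f i (x $ i)) = (\<Prod>b\<in>Basis. g b (x \<bullet> b))" for x :: "real ^ 'd"
    by (subst prod.reindex_bij_betw[OF bij_betw_axis_Basis, symmetric]) (simp add: g_def inv inner_axis)
  moreover have "(\<Prod>i\<in>UNIV. \<integral>\<^sup>+x. f i x \<partial>lborel) = (\<Prod>b\<in>(Basis::(real^'d) set). \<integral>\<^sup>+x. g b x \<partial>lborel)"
    by (subst prod.reindex_bij_betw[OF bij_betw_axis_Basis, symmetric]) (simp add: g_def inv)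
  moreover have "g b \<in> borel_measurable borel" for b
    by (simp add: g_def)
  ultimately show ?thesis
    by (simp add: nn_integral_lborel_prod)
qed

text \<open>Completing the square turns the exponentially tilted centred density into the normal
  density with mean \<open>\<sigma>\<^sup>2 * a\<close>, which integrates to 1.\<close>

lemma nn_integral_normal_density_exp:
  assumes "0 < \<sigma>"
  shows "(\<integral>\<^sup>+x. ennreal (normal_density 0 \<sigma> x) * ennreal (exp (a * x)) \<partial>lborel) = ennreal (exp (\<sigma>\<^sup>2 * a\<^sup>2 / 2))"
proof -
  have sq: "a * x - x\<^sup>2 / (2 * \<sigma>\<^sup>2) = \<sigma>\<^sup>2 * a\<^sup>2 / 2 - (x - \<sigma>\<^sup>2 * a)\<^sup>2 / (2 * \<sigma>\<^sup>2)" for x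
    using assms by (simp add: field_simps power2_eq_square)
  have "normal_density 0 \<sigma> x * exp (a * x) = exp (\<sigma>\<^sup>2 * a\<^sup>2 / 2) * normal_density (\<sigma>\<^sup>2 * a) \<sigma> x" for x
    using sq[of x] by (simp add: normal_density_def exp_add[symmetric])
  then have "(\<integral>\<^sup>+x. ennreal (normal_density 0 \<sigma> x) * ennreal (exp (a * x)) \<partial>lborel)
    = (\<integral>\<^sup>+x. ennreal (exp (\<sigma>\<^sup>2 * a\<^sup>2 / 2)) * ennreal (normal_density (\<sigma>\<^sup>2 * a) \<sigma> x) \<partial>lborel)"
    by (intro nn_integral_cong) (simp add: ennreal_mult[symmetric])
  also have "\<dots> = ennreal (exp (\<sigma>\<^sup>2 * a\<^sup>2 / 2))"
    using assms by (simp add: nn_integral_cmult nn_integral_eq_integral)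
  finally show ?thesis .
qed

section \<open>Independence and moments of Gaussian vectors\<close>

context prob_space
begin

lemma indep_var_borelI:
  assumes [measurable]: "random_variable S X" "random_variable N Y"
    and eq: "\<And>A C. A \<in> sets S \<Longrightarrow> C \<in> sets N \<Longrightarrow>
      prob ((X -` A \<inter> space M) \<inter> (Y -` C \<inter> space M)) = prob (X -` A \<inter> space M) * prob (Y -` C \<inter> space M)"
  shows "indep_var S X N Y"
  unfolding indep_var_eq
proof (intro conjI indep_set_sigma_sets)
  show "indep_set {X -` A \<inter> space M |A. A \<in> sets S} {Y -` A \<inter> space M |A. A \<in> sets N}"
    by (intro indep_setI) (auto simp: eq)
  have *: "Int_stable {f -` A \<inter> space M |A. A \<in> sets L}" for f :: "'a \<Rightarrow> 'z" and L
  proof (rule Int_stableI)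
    fix a b assume "a \<in> {f -` A \<inter> space M |A. A \<in> sets L}" "b \<in> {f -` A \<inter> space M |A. A \<in> sets L}"
    then obtain A C where "A \<in> sets L" "C \<in> sets L" "a = f -` A \<inter> space M" "b = f -` C \<inter> space M"
      by auto
    then show "a \<inter> b \<in> {f -` A \<inter> space M |A. A \<in> sets L}"
      by (auto intro!: exI[of _ "A \<inter> C"])
  qed
  show "Int_stable {X -` A \<inter> space M |A. A \<in> sets S}" "Int_stable {Y -` A \<inter> space M |A. A \<in> sets N}"
    by (rule *)+
qed auto

context
  fixes X :: "'a \<Rightarrow> real ^ 'd" and \<sigma> :: real
  assumes X [measurable]: "X \<in> borel_measurable M"
    and D: "distributed M lborel X (\<lambda>x. \<Prod>i\<in>UNIV. ennreal (normal_density 0 \<sigma> (x $ i)))"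
    and \<sigma>: "0 < \<sigma>"
begin

text \<open>The joint density is a product, so by Tonelli the mean of a product of coordinate
  functions factorises. Exponential moments, marginals and pairwise independence all come from a
  choice of \<open>g\<close>.\<close>

lemma normal_vec_nn_integral_prod:
  assumes [measurable]: "\<And>i. g i \<in> borel_measurable borel"
  shows "(\<integral>\<^sup>+\<omega>. (\<Prod>i\<in>UNIV. g i (X \<omega> $ i)) \<partial>M)
    = (\<Prod>i\<in>UNIV. \<integral>\<^sup>+x. ennreal (normal_density 0 \<sigma> x) * g i x \<partial>lborel)"
proof -
  have "(\<integral>\<^sup>+\<omega>. (\<Prod>i\<in>UNIV. g i (X \<omega> $ i)) \<partial>M)
    = (\<integral>\<^sup>+x. (\<Prod>i\<in>UNIV. ennreal (normal_density 0 \<sigma> (x $ i))) * (\<Prod>i\<in>UNIV. g i (x $ i)) \<partial>lborel)"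
    by (subst distributed_nn_integral[OF D]) auto
  also have "\<dots> = (\<integral>\<^sup>+x. (\<Prod>i\<in>UNIV. ennreal (normal_density 0 \<sigma> (x $ i)) * g i (x $ i)) \<partial>lborel)"
    by (simp add: prod.distrib)
  also have "\<dots> = (\<Prod>i\<in>UNIV. \<integral>\<^sup>+x. ennreal (normal_density 0 \<sigma> x) * g i x \<partial>lborel)"
    by (rule nn_integral_lborel_vec_prod) auto
  finally show ?thesis .
qed

lemma normal_vec_exp:
  "(\<integral>\<^sup>+\<omega>. ennreal (exp (v \<bullet> X \<omega>)) \<partial>M) = ennreal (exp (\<sigma>\<^sup>2 * (norm v)\<^sup>2 / 2))"
proof -
  have "(\<integral>\<^sup>+\<omega>. ennreal (exp (v \<bullet> X \<omega>)) \<partial>M) = (\<integral>\<^sup>+\<omega>. (\<Prod>i\<in>UNIV. ennreal (exp (v $ i * X \<omega> $ i))) \<partial>M)"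
    by (simp add: inner_vec_def exp_sum prod_ennreal)
  also have "\<dots> = (\<Prod>i\<in>UNIV. ennreal (exp (\<sigma>\<^sup>2 * (v $ i)\<^sup>2 / 2)))"
    by (subst normal_vec_nn_integral_prod) (auto simp: nn_integral_normal_density_exp[OF \<sigma>])
  also have "\<dots> = ennreal (exp (\<Sum>i\<in>UNIV. \<sigma>\<^sup>2 * (v $ i)\<^sup>2 / 2))"
    by (simp add: exp_sum prod_ennreal)
  also have "(\<Sum>i\<in>UNIV. \<sigma>\<^sup>2 * (v $ i)\<^sup>2 / 2) = \<sigma>\<^sup>2 * (norm v)\<^sup>2 / 2"
    by (simp add: norm_vec_def L2_set_def sum_nonneg sum_distrib_left sum_divide_distrib)
  finally show ?thesis .
qed

lemma normal_vec_pair: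
  assumes "j \<noteq> k" and [measurable]: "A \<in> sets borel" "C \<in> sets borel"
  shows "(\<integral>\<^sup>+\<omega>. indicator A (X \<omega> $ j) * indicator C (X \<omega> $ k) \<partial>M)
    = (\<integral>\<^sup>+x. ennreal (normal_density 0 \<sigma> x) * indicator A x \<partial>lborel)
      * (\<integral>\<^sup>+x. ennreal (normal_density 0 \<sigma> x) * indicator C x \<partial>lborel)"
proof -
  let ?N = "\<lambda>A. (\<integral>\<^sup>+x. ennreal (normal_density 0 \<sigma> x) * indicator A x \<partial>lborel)"
  let ?g = "\<lambda>i x. (if i = j then indicator A x else 1) * (if i = k then indicator C x else 1) :: ennreal"
  have one: "(\<integral>\<^sup>+x. ennreal (normal_density 0 \<sigma> x) \<partial>lborel) = 1"
    using \<sigma> by (simp add: nn_integral_eq_integral)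
  have "(\<integral>\<^sup>+\<omega>. indicator A (X \<omega> $ j) * indicator C (X \<omega> $ k) \<partial>M) = (\<integral>\<^sup>+\<omega>. (\<Prod>i\<in>UNIV. ?g i (X \<omega> $ i)) \<partial>M)"
    by (simp add: prod.distrib prod.delta)
  also have "\<dots> = (\<Prod>i\<in>UNIV. \<integral>\<^sup>+x. ennreal (normal_density 0 \<sigma> x) * ?g i x \<partial>lborel)"
    by (rule normal_vec_nn_integral_prod) auto
  also have "\<dots> = (\<Prod>i\<in>UNIV. (if i = j then ?N A else 1) * (if i = k then ?N C else 1))"
    using \<open>j \<noteq> k\<close> by (intro prod.cong refl) (auto simp: one)
  also have "\<dots> = ?N A * ?N C"
    by (simp add: prod.distrib prod.delta)
  finally show ?thesis .
qed

lemma normal_vec_component_nn: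
  assumes [measurable]: "A \<in> sets borel"
  shows "(\<integral>\<^sup>+\<omega>. indicator A (X \<omega> $ j) \<partial>M) = (\<integral>\<^sup>+x. ennreal (normal_density 0 \<sigma> x) * indicator A x \<partial>lborel)"
proof -
  let ?N = "\<lambda>A. (\<integral>\<^sup>+x. ennreal (normal_density 0 \<sigma> x) * indicator A x \<partial>lborel)"
  let ?g = "\<lambda>i x. (if i = j then indicator A x else 1) :: ennreal"
  have one: "(\<integral>\<^sup>+x. ennreal (normal_density 0 \<sigma> x) \<partial>lborel) = 1"
    using \<sigma> by (simp add: nn_integral_eq_integral)
  have "(\<integral>\<^sup>+\<omega>. indicator A (X \<omega> $ j) \<partial>M) = (\<integral>\<^sup>+\<omega>. (\<Prod>i\<in>UNIV. ?g i (X \<omega> $ i)) \<partial>M)"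
    by (simp add: prod.delta)
  also have "\<dots> = (\<Prod>i\<in>UNIV. \<integral>\<^sup>+x. ennreal (normal_density 0 \<sigma> x) * ?g i x \<partial>lborel)"
    by (rule normal_vec_nn_integral_prod) auto
  also have "\<dots> = (\<Prod>i\<in>UNIV. (if i = j then ?N A else 1))"
    by (intro prod.cong refl) (auto simp: one)
  also have "\<dots> = ?N A"
    by (simp add: prod.delta)
  finally show ?thesis .
qed

lemma normal_vec_component: "distributed M lborel (\<lambda>\<omega>. X \<omega> $ j) (normal_density 0 \<sigma>)"
  unfolding distributed_def
proof (intro conjI measure_eqI)
  fix A assume "A \<in> sets (distr M lborel (\<lambda>\<omega>. X \<omega> $ j))"
  then have [measurable]: "A \<in> sets borel" by simp
  have "emeasure (distr M lborel (\<lambda>\<omega>. X \<omega> $ j)) A = (\<integral>\<^sup>+\<omega>. indicator A (X \<omega> $ j) \<partial>M)"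
    using nn_integral_distr[of "\<lambda>\<omega>. X \<omega> $ j" M lborel "indicator A"] by simp
  then show "emeasure (distr M lborel (\<lambda>\<omega>. X \<omega> $ j)) A = emeasure (density lborel (normal_density 0 \<sigma>)) A"
    by (simp add: normal_vec_component_nn emeasure_density)
qed auto

lemma normal_vec_integrable: "integrable M (\<lambda>\<omega>. X \<omega> $ j)"
  using distributed_integrable[OF normal_vec_component, of "\<lambda>x. x" j] integrable_normal_moment_nz_1[OF \<sigma>, of 0]
  by simp

lemma normal_vec_expectation: "(\<integral>\<omega>. X \<omega> $ j \<partial>M) = 0"
  by (rule normal_distributed_expectation[OF \<sigma> normal_vec_component])

lemma normal_vec_square: "has_bochner_integral M (\<lambda>\<omega>. X \<omega> $ j * X \<omega> $ j) (\<sigma>\<^sup>2)"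
proof -
  have "integrable M (\<lambda>\<omega>. (X \<omega> $ j)\<^sup>2)"
    using distributed_integrable[OF normal_vec_component, of "\<lambda>x. x\<^sup>2" j] integrable_normal_moment[OF \<sigma>, of 0 2]
    by simp
  moreover have "(\<integral>\<omega>. (X \<omega> $ j)\<^sup>2 \<partial>M) = \<sigma>\<^sup>2"
    using normal_distributed_variance[OF \<sigma> normal_vec_component, of j] by (simp add: normal_vec_expectation)
  ultimately show ?thesis
    by (simp add: has_bochner_integral_iff power2_eq_square)
qed

lemma normal_vec_indep:
  assumes "j \<noteq> k"
  shows "indep_var borel (\<lambda>\<omega>. X \<omega> $ j) borel (\<lambda>\<omega>. X \<omega> $ k)"
proof (rule indep_var_borelI)
  fix A C :: "real set" assume [measurable]: "A \<in> sets borel" "C \<in> sets borel"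
  have em: "emeasure M ((\<lambda>\<omega>. X \<omega> $ i) -` A \<inter> space M) = (\<integral>\<^sup>+\<omega>. indicator A (X \<omega> $ i) \<partial>M)"
    if [measurable]: "A \<in> sets borel" for A i
  proof -
    have mem: "(\<lambda>\<omega>. X \<omega> $ i) -` A \<inter> space M \<in> events"
      by (rule measurable_sets[of _ _ borel]) auto
    show ?thesis
      unfolding nn_integral_indicator[OF mem, symmetric]
      by (intro nn_integral_cong) (auto simp: indicator_def)
  qed
  have "emeasure M (((\<lambda>\<omega>. X \<omega> $ j) -` A \<inter> space M) \<inter> ((\<lambda>\<omega>. X \<omega> $ k) -` C \<inter> space M))
      = (\<integral>\<^sup>+\<omega>. indicator A (X \<omega> $ j) * indicator C (X \<omega> $ k) \<partial>M)"
  proof -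
    have mem: "((\<lambda>\<omega>. X \<omega> $ j) -` A \<inter> space M) \<inter> ((\<lambda>\<omega>. X \<omega> $ k) -` C \<inter> space M) \<in> events"
      by (intro sets.Int measurable_sets[of _ _ borel]) auto
    show ?thesis
      unfolding nn_integral_indicator[OF mem, symmetric]
      by (intro nn_integral_cong) (auto simp: indicator_def)
  qed
  also have "\<dots> = emeasure M ((\<lambda>\<omega>. X \<omega> $ j) -` A \<inter> space M) * emeasure M ((\<lambda>\<omega>. X \<omega> $ k) -` C \<inter> space M)"
    by (simp add: normal_vec_pair[OF assms] em normal_vec_component_nn)
  finally show "prob (((\<lambda>\<omega>. X \<omega> $ j) -` A \<inter> space M) \<inter> ((\<lambda>\<omega>. X \<omega> $ k) -` C \<inter> space M))
      = prob ((\<lambda>\<omega>. X \<omega> $ j) -` A \<inter> space M) * prob ((\<lambda>\<omega>. X \<omega> $ k) -` C \<inter> space M)"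
    by (simp add: emeasure_eq_measure ennreal_mult[symmetric])
qed auto

lemma normal_vec_covariance:
  "has_bochner_integral M (\<lambda>\<omega>. X \<omega> $ j * X \<omega> $ k) (if j = k then \<sigma>\<^sup>2 else 0)"
proof (cases "j = k")
  case False
  then show ?thesis
    using indep_var_lebesgue_integral[OF normal_vec_indep[OF False] normal_vec_integrable normal_vec_integrable]
      indep_var_integrable[OF normal_vec_indep[OF False] normal_vec_integrable normal_vec_integrable]
    by (simp add: has_bochner_integral_iff normal_vec_expectation)
qed (simp add: normal_vec_square)

end

end

section \<open>Brownian increments and the past\<close>

type_synonym ('a, 'd) process = "real \<Rightarrow> 'a \<Rightarrow> real ^ 'd"

locale brownian = prob_space M
  for M :: "'a measure" +
  fixes F :: "real \<Rightarrow> 'a measure" and T :: real and B :: "real \<Rightarrow> 'a \<Rightarrow> real ^ 'd"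
  assumes T_pos: "0 < T" and filt: "filtration_upto M F T" and bm: "standard_brownian_motion M F T B"
begin

lemma subalg: "0 \<le> t \<Longrightarrow> t \<le> T \<Longrightarrow> subalgebra M (F t)"
  using filt by (auto simp: filtration_upto_def)

lemma filt_mono:
  assumes "0 \<le> s" "s \<le> t" "t \<le> T" "f \<in> measurable (F s) N"
  shows "f \<in> measurable (F t) N"
proof -
  have "subalgebra (F t) (F s)"
    using filt assms subalg[of s] subalg[of t] by (auto simp: filtration_upto_def subalgebra_def)
  then show ?thesis using assms(4) by (rule measurable_from_subalg)
qed

lemma filt_measurable: "0 \<le> s \<Longrightarrow> s \<le> T \<Longrightarrow> f \<in> measurable (F s) N \<Longrightarrow> f \<in> measurable M N"
  by (rule measurable_from_subalg[OF subalg])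

lemma B_adapted: "0 \<le> s \<Longrightarrow> s \<le> t \<Longrightarrow> t \<le> T \<Longrightarrow> B s \<in> borel_measurable (F t)"
  using bm filt_mono[of s t "B s" borel] by (auto simp: standard_brownian_motion_def)

lemma B_measurable: "0 \<le> s \<Longrightarrow> s \<le> T \<Longrightarrow> B s \<in> borel_measurable M"
  using filt_measurable B_adapted by blast

lemma increment_normal:
  assumes "0 \<le> s" "s < t" "t \<le> T"
  shows "distributed M lborel (\<lambda>\<omega>. B t \<omega> - B s \<omega>) (\<lambda>x. \<Prod>i\<in>UNIV. ennreal (normal_density 0 (sqrt (t - s)) (x $ i)))"
  using bm assms by (auto simp: standard_brownian_motion_def)

lemma increment_measurable:
  assumes "0 \<le> s" "s < t" "t \<le> T"
  shows "(\<lambda>\<omega>. B t \<omega> - B s \<omega>) \<in> borel_measurable M"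
  using assms by (intro borel_measurable_diff B_measurable) auto

lemma increment_prob:
  assumes "0 \<le> s" "s < t" "t \<le> T" "A \<in> sets (F s)" "C \<in> sets borel"
  shows "prob (A \<inter> ((\<lambda>\<omega>. B t \<omega> - B s \<omega>) -` C \<inter> space M)) = prob A * prob ((\<lambda>\<omega>. B t \<omega> - B s \<omega>) -` C \<inter> space M)"
proof -
  have "indep_set (sets (F s)) {(\<lambda>\<omega>. B t \<omega> - B s \<omega>) -` A \<inter> space M |A. A \<in> sets borel}"
    using bm assms by (auto simp: standard_brownian_motion_def)
  then show ?thesis
    using assms(4,5) unfolding indep_sets2_eq by blast
qed

text \<open>The function \<open>g\<close> of the increment is arbitrary because the isometry uses
  products of two coordinates besides single coordinates.\<close>

lemma increment_indep:
  assumes "0 \<le> s" "s < t" "t \<le> T" "Y \<in> measurable (F s) S" "g \<in> measurable borel N"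
  shows "indep_var S Y N (\<lambda>\<omega>. g (B t \<omega> - B s \<omega>))"
proof (rule indep_var_borelI)
  have [measurable]: "B s \<in> borel_measurable M" "B t \<in> borel_measurable M" "Y \<in> measurable M S"
    using assms by (auto intro!: B_measurable filt_measurable[of s Y])
  note assms(5)[measurable]
  show "random_variable S Y" "random_variable N (\<lambda>\<omega>. g (B t \<omega> - B s \<omega>))" by auto
  fix A C assume A: "A \<in> sets S" and C: "C \<in> sets N"
  have "Y -` A \<inter> space M \<in> sets (F s)"
    using measurable_sets[OF assms(4) A] subalg[of s] assms by (simp add: subalgebra_def)
  moreover have "(\<lambda>\<omega>. g (B t \<omega> - B s \<omega>)) -` C \<inter> space M = (\<lambda>\<omega>. B t \<omega> - B s \<omega>) -` (g -` C) \<inter> space M"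
    by auto
  moreover have "g -` C \<in> sets borel"
    using measurable_sets[OF assms(5) C] by simp
  ultimately show "prob ((Y -` A \<inter> space M) \<inter> ((\<lambda>\<omega>. g (B t \<omega> - B s \<omega>)) -` C \<inter> space M))
      = prob (Y -` A \<inter> space M) * prob ((\<lambda>\<omega>. g (B t \<omega> - B s \<omega>)) -` C \<inter> space M)"
    using increment_prob[OF assms(1-3), of "Y -` A \<inter> space M" "g -` C"] by simp
qed

text \<open>With the past frozen, the Gaussian exponential moment cancels the quadratic correction
  exactly. The arbitrary weight \<open>Z\<close>, known at time \<open>s\<close>, plays the role of
  conditioning on \<open>F s\<close>.\<close>

lemma exp_increment:
  assumes "0 \<le> s" "s \<le> t" "t \<le> T"
    and Z[measurable]: "Z \<in> borel_measurable (F s)" and \<eta>[measurable]: "\<eta> \<in> borel_measurable (F s)"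
  shows "(\<integral>\<^sup>+\<omega>. Z \<omega> * ennreal (exp (\<eta> \<omega> \<bullet> (B t \<omega> - B s \<omega>) - (norm (\<eta> \<omega>))\<^sup>2 * (t - s) / 2)) \<partial>M) = (\<integral>\<^sup>+\<omega>. Z \<omega> \<partial>M)"
proof (cases "s = t")
  case False
  then have st: "s < t" using assms by simp
  let ?X = "\<lambda>\<omega>. B t \<omega> - B s \<omega>"
  let ?f = "\<lambda>(\<omega>, x). Z \<omega> * ennreal (exp (\<eta> \<omega> \<bullet> x - (norm (\<eta> \<omega>))\<^sup>2 * (t - s) / 2))"
  have id: "(\<lambda>\<omega>. \<omega>) \<in> measurable M (F s)"
    using filt_measurable[of s "\<lambda>\<omega>. \<omega>" "F s"] assms by auto
  have [measurable]: "?X \<in> borel_measurable M"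
    using assms by (intro borel_measurable_diff B_measurable) auto
  interpret I: prob_space "distr M (F s) (\<lambda>\<omega>. \<omega>)" by (rule prob_space_distr[OF id])
  have pair[measurable]: "(\<lambda>\<omega>. (\<omega>, ?X \<omega>)) \<in> measurable M (F s \<Otimes>\<^sub>M borel)"
    using id by simp
  interpret X: prob_space "distr M borel ?X" by (rule prob_space_distr) simp
  \<comment> \<open>Independence in integral form: the identity map into \<open>F s\<close> carries
    the whole past, and its joint law with the increment is a product measure, so Tonelli
    applies.\<close>
  have eq: "distr M (F s) (\<lambda>\<omega>. \<omega>) \<Otimes>\<^sub>M distr M borel ?X = distr M (F s \<Otimes>\<^sub>M borel) (\<lambda>\<omega>. (\<omega>, ?X \<omega>))"
  proof (rule pair_measure_eqI)
    fix A C assume "A \<in> sets (distr M (F s) (\<lambda>\<omega>. \<omega>))" "C \<in> sets (distr M borel ?X)"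
    then have A: "A \<in> sets (F s)" and C: "C \<in> sets borel" by auto
    have "A \<subseteq> space M"
      using sets.sets_into_space[OF A] subalg[of s] assms by (simp add: subalgebra_def)
    then have "(\<lambda>\<omega>. \<omega>) -` A \<inter> space M = A" and
      "(\<lambda>\<omega>. (\<omega>, ?X \<omega>)) -` (A \<times> C) \<inter> space M = A \<inter> (?X -` C \<inter> space M)"
      by auto
    then show "emeasure (distr M (F s) (\<lambda>\<omega>. \<omega>)) A * emeasure (distr M borel ?X) C
        = emeasure (distr M (F s \<Otimes>\<^sub>M borel) (\<lambda>\<omega>. (\<omega>, ?X \<omega>))) (A \<times> C)"
      using increment_prob[OF assms(1) st assms(3) A C] A C
      by (simp add: emeasure_distr[OF id] emeasure_distr[OF pair] emeasure_distr emeasure_eq_measure ennreal_mult[symmetric])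
  qed (auto intro!: I.sigma_finite_measure_axioms X.sigma_finite_measure_axioms cong: sets_pair_measure_cong)
  have f: "?f \<in> borel_measurable (F s \<Otimes>\<^sub>M borel)" by measurable
  have "(\<integral>\<^sup>+\<omega>. ?f (\<omega>, ?X \<omega>) \<partial>M) = (\<integral>\<^sup>+p. ?f p \<partial>distr M (F s \<Otimes>\<^sub>M borel) (\<lambda>\<omega>. (\<omega>, ?X \<omega>)))"
    by (rule nn_integral_distr[symmetric, OF pair]) (use f in simp)
  also have "\<dots> = (\<integral>\<^sup>+\<omega>. \<integral>\<^sup>+x. ?f (\<omega>, x) \<partial>distr M borel ?X \<partial>distr M (F s) (\<lambda>\<omega>. \<omega>))"
    unfolding eq[symmetric]
    by (rule X.nn_integral_fst[symmetric]) (use f in \<open>simp cong: measurable_cong_sets sets_pair_measure_cong\<close>)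
  also have "\<dots> = (\<integral>\<^sup>+\<omega>. Z \<omega> \<partial>distr M (F s) (\<lambda>\<omega>. \<omega>))"
  proof (intro nn_integral_cong)
    fix \<omega>
    let ?c = "exp (- ((norm (\<eta> \<omega>))\<^sup>2 * (t - s) / 2))"
    have "(\<integral>\<^sup>+x. ?f (\<omega>, x) \<partial>distr M borel ?X) = (\<integral>\<^sup>+x. (Z \<omega> * ennreal ?c) * ennreal (exp (\<eta> \<omega> \<bullet> x)) \<partial>distr M borel ?X)"
      by (intro nn_integral_cong) (simp add: mult.assoc ennreal_mult[symmetric] exp_add[symmetric])
    also have "\<dots> = (Z \<omega> * ennreal ?c) * (\<integral>\<^sup>+\<omega>'. ennreal (exp (\<eta> \<omega> \<bullet> ?X \<omega>')) \<partial>M)"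
      by (subst nn_integral_cmult) (auto simp: nn_integral_distr)
    also have "\<dots> = Z \<omega> * (ennreal ?c * ennreal (exp ((t - s) * (norm (\<eta> \<omega>))\<^sup>2 / 2)))"
      using st by (subst normal_vec_exp[OF _ increment_normal[OF assms(1) st assms(3)]]) (auto simp: mult.assoc)
    also have "\<dots> = Z \<omega>"
      by (simp add: ennreal_mult[symmetric] exp_add[symmetric] mult.commute)
    finally show "(\<integral>\<^sup>+x. ?f (\<omega>, x) \<partial>distr M borel ?X) = Z \<omega>" .
  qed
  also have "\<dots> = (\<integral>\<^sup>+\<omega>. Z \<omega> \<partial>M)"
    by (rule nn_integral_distr[OF id]) (use Z in simp)
  finally show ?thesis by simp
qed simp

end

section \<open>The Ito isometry for simple integrands\<close>

text \<open>The length of the intersection of \<open>{a<..b}\<close> and \<open>{c<..d}\<close>,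
  that is, the L2 inner product of their indicators; \<open>max 0\<close> covers the disjoint
  case.\<close>

definition overlap :: "real \<Rightarrow> real \<Rightarrow> real \<Rightarrow> real \<Rightarrow> real" where
  "overlap a b c d = max 0 (min b d - max a c)"

lemma overlap_commute: "overlap a b c d = overlap c d a b"
  by (simp add: overlap_def min.commute max.commute)

lemma has_bochner_integral_overlap:
  "has_bochner_integral lborel (\<lambda>s. indicat_real {a<..b} s * indicat_real {c<..d} s) (overlap a b c d)"
proof -
  have "(\<lambda>s. indicat_real {a<..b} s * indicat_real {c<..d} s) = indicat_real {max a c<..min b d}"
    by (auto simp: indicator_def fun_eq_iff)
  moreover have "has_bochner_integral lborel (indicat_real {max a c<..min b d}) (measure lborel {max a c<..min b d})"
    proof (rule has_bochner_integral_real_indicator)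
    show "emeasure lborel {max a c<..min b d} < \<infinity>"
    proof (cases "max a c \<le> min b d")
      case True
      then show ?thesis by (simp only: emeasure_lborel_Ioc[OF True]; simp)
    next
      case False
      then have "{max a c<..min b d} = {}" by (simp only: greaterThanAtMost_empty_iff; simp)
      then show ?thesis by (simp only: emeasure_empty; simp)
    qed
  qed simp
  moreover have "measure lborel {max a c<..min b d} = overlap a b c d"
    by (cases "max a c \<le> min b d") (auto simp: overlap_def measure_def)
  ultimately show ?thesis by simp
qed

context brownian
begin

text \<open>The stochastic integral of the one-step integrand with value \<open>\<eta>\<close> on
  \<open>{a<..b}\<close>.\<close>

definition piece :: "real \<Rightarrow> real \<Rightarrow> ('a \<Rightarrow> real ^ 'd) \<Rightarrow> 'a \<Rightarrow> real" where
  "piece a b \<eta> \<omega> = \<eta> \<omega> \<bullet> (B b \<omega> - B a \<omega>)"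

definition adapted_coeff :: "real \<Rightarrow> ('a \<Rightarrow> real ^ 'd) \<Rightarrow> bool" where
  "adapted_coeff a \<eta> \<longleftrightarrow> \<eta> \<in> borel_measurable (F a) \<and> (\<exists>C. \<forall>\<omega>\<in>space M. norm (\<eta> \<omega>) \<le> C)"

lemma adapted_coeff_mono: "0 \<le> a \<Longrightarrow> a \<le> b \<Longrightarrow> b \<le> T \<Longrightarrow> adapted_coeff a \<eta> \<Longrightarrow> adapted_coeff b \<eta>"
  by (auto simp: adapted_coeff_def intro: filt_mono)

lemma adapted_coeff_inner_integrable:
  assumes "0 \<le> a" "a \<le> T" "adapted_coeff a \<eta>" "0 \<le> b" "b \<le> T" "adapted_coeff b \<zeta>"
  shows "integrable M (\<lambda>\<omega>. \<eta> \<omega> \<bullet> \<zeta> \<omega>)"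
proof -
  have [measurable]: "\<eta> \<in> borel_measurable M" "\<zeta> \<in> borel_measurable M"
    using assms by (auto simp: adapted_coeff_def intro: filt_measurable)
  obtain C D where "\<forall>\<omega>\<in>space M. norm (\<eta> \<omega>) \<le> C" "\<forall>\<omega>\<in>space M. norm (\<zeta> \<omega>) \<le> D"
    using assms by (auto simp: adapted_coeff_def)
  then have "\<bar>\<eta> \<omega> \<bullet> \<zeta> \<omega>\<bar> \<le> C * D" if "\<omega> \<in> space M" for \<omega>
    using that Cauchy_Schwarz_ineq2[of "\<eta> \<omega>" "\<zeta> \<omega>"] mult_mono[of "norm (\<eta> \<omega>)" C "norm (\<zeta> \<omega>)" D]
    by (smt (verit) norm_ge_zero)
  then show ?thesis
    by (intro integrable_const_bound[where B="C * D"]) auto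
qed

lemma piece_adapted:
  assumes "0 \<le> a" "a \<le> b" "b \<le> T" "adapted_coeff a \<eta>"
  shows "piece a b \<eta> \<in> borel_measurable (F b)"
proof -
  have [measurable]: "\<eta> \<in> borel_measurable (F b)"
    by (rule filt_mono[of a]) (use assms in \<open>auto simp: adapted_coeff_def\<close>)
  have [measurable]: "B a \<in> borel_measurable (F b)" "B b \<in> borel_measurable (F b)"
    by (rule B_adapted; use assms in simp)+
  show ?thesis unfolding piece_def[abs_def] by measurable
qed

lemma piece_split: "piece a c \<eta> \<omega> = piece a b \<eta> \<omega> + piece b c \<eta> \<omega>"
  by (simp add: piece_def inner_diff_right)

text \<open>The increment after \<open>a\<close> has mean zero and is independent of
  \<open>Y\<close> times any coordinate of \<open>\<eta>\<close>; boundedness of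
  \<open>\<eta>\<close> keeps that product integrable.\<close>

lemma piece_orthogonal:
  assumes ab: "0 \<le> a" "a \<le> b" "b \<le> T" and \<eta>: "adapted_coeff a \<eta>"
    and Y: "Y \<in> borel_measurable (F a)" "integrable M Y"
  shows "has_bochner_integral M (\<lambda>\<omega>. Y \<omega> * piece a b \<eta> \<omega>) 0"
proof (cases "a = b")
  case False
  then have "a < b" using ab by simp
  note normal = increment_measurable[OF ab(1) \<open>a < b\<close> ab(3)] increment_normal[OF ab(1) \<open>a < b\<close> ab(3)] and pos = real_sqrt_gt_zero[of "b - a"]
  obtain C where C: "\<forall>\<omega>\<in>space M. norm (\<eta> \<omega>) \<le> C" using \<eta> by (auto simp: adapted_coeff_def)
  have \<eta>F[measurable]: "\<eta> \<in> borel_measurable (F a)" using \<eta> by (simp add: adapted_coeff_def)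
  note Y(1)[measurable]
  have \<eta>M: "\<eta> \<in> borel_measurable M" "Y \<in> borel_measurable M"
    using ab \<eta>F Y by (auto intro!: filt_measurable[of a])
  have "has_bochner_integral M (\<lambda>\<omega>. \<Sum>i\<in>UNIV. (Y \<omega> * \<eta> \<omega> $ i) * (B b \<omega> - B a \<omega>) $ i) (\<Sum>i\<in>(UNIV :: 'd set). 0)"
  proof (intro has_bochner_integral_sum)
    fix i :: 'd
    have int1: "integrable M (\<lambda>\<omega>. Y \<omega> * \<eta> \<omega> $ i)"
    proof (rule Bochner_Integration.integrable_bound)
      show "integrable M (\<lambda>\<omega>. C * Y \<omega>)" using Y by simp
      show "(\<lambda>\<omega>. Y \<omega> * \<eta> \<omega> $ i) \<in> borel_measurable M" using \<eta>M by measurable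
      show "AE \<omega> in M. norm (Y \<omega> * \<eta> \<omega> $ i) \<le> norm (C * Y \<omega>)"
      proof (intro AE_I2)
        fix \<omega> assume "\<omega> \<in> space M"
        then have "\<bar>\<eta> \<omega> $ i\<bar> \<le> \<bar>C\<bar>"
          using C component_le_norm_cart[of "\<eta> \<omega>" i] by fastforce
        then show "norm (Y \<omega> * \<eta> \<omega> $ i) \<le> norm (C * Y \<omega>)"
          by (simp add: abs_mult mult.commute[of "\<bar>C\<bar>"] mult_left_mono)
      qed
    qed
    have int2: "integrable M (\<lambda>\<omega>. (B b \<omega> - B a \<omega>) $ i)" "(\<integral>\<omega>. (B b \<omega> - B a \<omega>) $ i \<partial>M) = 0"
      using normal_vec_integrable[OF normal pos] normal_vec_expectation[OF normal pos] \<open>a < b\<close> by auto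
    have "indep_var borel (\<lambda>\<omega>. Y \<omega> * \<eta> \<omega> $ i) borel (\<lambda>\<omega>. (B b \<omega> - B a \<omega>) $ i)"
      by (rule increment_indep[OF ab(1) \<open>a < b\<close> ab(3)]) measurable
    from indep_var_lebesgue_integral[OF this int1 int2(1)] indep_var_integrable[OF this int1 int2(1)] int2(2)
    show "has_bochner_integral M (\<lambda>\<omega>. (Y \<omega> * \<eta> \<omega> $ i) * (B b \<omega> - B a \<omega>) $ i) 0"
      by (simp add: has_bochner_integral_iff)
  qed
  then show ?thesis
    by (simp add: piece_def inner_vec_def sum_distrib_left mult.assoc)
qed (simp add: piece_def has_bochner_integral_zero)

lemma piece_integrable:
  assumes "0 \<le> a" "a \<le> b" "b \<le> T" "adapted_coeff a \<eta>"
  shows "integrable M (piece a b \<eta>)"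
proof -
  have "has_bochner_integral M (\<lambda>\<omega>. 1 * piece a b \<eta> \<omega>) 0"
    by (rule piece_orthogonal[OF assms]) auto
  then show ?thesis by (auto simp: has_bochner_integral_iff)
qed

abbreviation mean_inner :: "('a \<Rightarrow> real ^ 'd) \<Rightarrow> ('a \<Rightarrow> real ^ 'd) \<Rightarrow> real" where
  "mean_inner \<eta> \<zeta> \<equiv> \<integral>\<omega>. \<eta> \<omega> \<bullet> \<zeta> \<omega> \<partial>M"

text \<open>The increment has covariance \<open>b - a\<close> times the identity and is independent
  of both coefficients, so only the diagonal of the double sum over coordinates survives.\<close>

lemma piece_inner_same:
  assumes ab: "0 \<le> a" "a \<le> b" "b \<le> T" and \<eta>: "adapted_coeff a \<eta>" and \<zeta>: "adapted_coeff a \<zeta>"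
  shows "has_bochner_integral M (\<lambda>\<omega>. piece a b \<eta> \<omega> * piece a b \<zeta> \<omega>) ((b - a) * mean_inner \<eta> \<zeta>)"
proof (cases "a = b")
  case False
  then have "a < b" using ab by simp
  note normal = increment_measurable[OF ab(1) \<open>a < b\<close> ab(3)] increment_normal[OF ab(1) \<open>a < b\<close> ab(3)] and pos = real_sqrt_gt_zero[of "b - a"]
  obtain C D where C: "\<forall>\<omega>\<in>space M. norm (\<eta> \<omega>) \<le> C" and D: "\<forall>\<omega>\<in>space M. norm (\<zeta> \<omega>) \<le> D"
    using \<eta> \<zeta> by (auto simp: adapted_coeff_def)
  have [measurable]: "\<eta> \<in> borel_measurable (F a)" "\<zeta> \<in> borel_measurable (F a)"
    using \<eta> \<zeta> by (auto simp: adapted_coeff_def)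
  then have M: "\<eta> \<in> borel_measurable M" "\<zeta> \<in> borel_measurable M"
    using ab by (auto intro!: filt_measurable[of a])
  let ?\<Delta> = "\<lambda>\<omega>. B b \<omega> - B a \<omega>"
  have int: "integrable M (\<lambda>\<omega>. \<eta> \<omega> $ i * \<zeta> \<omega> $ j)" for i j
  proof (rule integrable_const_bound)
    show "(\<lambda>\<omega>. \<eta> \<omega> $ i * \<zeta> \<omega> $ j) \<in> borel_measurable M" using M by measurable
    show "AE \<omega> in M. norm (\<eta> \<omega> $ i * \<zeta> \<omega> $ j) \<le> \<bar>C\<bar> * \<bar>D\<bar>"
    proof (intro AE_I2)
      fix \<omega> assume "\<omega> \<in> space M"
      then have "\<bar>\<eta> \<omega> $ i\<bar> \<le> \<bar>C\<bar>" "\<bar>\<zeta> \<omega> $ j\<bar> \<le> \<bar>D\<bar>"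
        using C D component_le_norm_cart[of "\<eta> \<omega>" i] component_le_norm_cart[of "\<zeta> \<omega>" j] by fastforce+
      then show "norm (\<eta> \<omega> $ i * \<zeta> \<omega> $ j) \<le> \<bar>C\<bar> * \<bar>D\<bar>"
        by (simp add: abs_mult mult_mono)
    qed
  qed
  have "has_bochner_integral M (\<lambda>\<omega>. \<Sum>i\<in>UNIV. \<Sum>j\<in>UNIV. (\<eta> \<omega> $ i * \<zeta> \<omega> $ j) * (?\<Delta> \<omega> $ i * ?\<Delta> \<omega> $ j))
    (\<Sum>i\<in>(UNIV :: 'd set). \<Sum>j\<in>(UNIV :: 'd set). (\<integral>\<omega>. \<eta> \<omega> $ i * \<zeta> \<omega> $ j \<partial>M) * (if i = j then b - a else 0))"
  proof (intro has_bochner_integral_sum)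
    fix i j :: 'd
    have "has_bochner_integral M (\<lambda>\<omega>. ?\<Delta> \<omega> $ i * ?\<Delta> \<omega> $ j) (if i = j then b - a else 0)"
      using normal_vec_covariance[OF normal pos, of i j] \<open>a < b\<close> by (simp cong: if_cong)
    then have int2: "integrable M (\<lambda>\<omega>. ?\<Delta> \<omega> $ i * ?\<Delta> \<omega> $ j)"
      "(\<integral>\<omega>. ?\<Delta> \<omega> $ i * ?\<Delta> \<omega> $ j \<partial>M) = (if i = j then b - a else 0)"
      by (auto simp: has_bochner_integral_iff)
    have "indep_var borel (\<lambda>\<omega>. \<eta> \<omega> $ i * \<zeta> \<omega> $ j) borel (\<lambda>\<omega>. ?\<Delta> \<omega> $ i * ?\<Delta> \<omega> $ j)"
      by (rule increment_indep[OF ab(1) \<open>a < b\<close> ab(3), where g="\<lambda>x. x $ i * x $ j"]) measurable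
    from indep_var_lebesgue_integral[OF this int int2(1)] indep_var_integrable[OF this int int2(1)] int2(2)
    show "has_bochner_integral M (\<lambda>\<omega>. (\<eta> \<omega> $ i * \<zeta> \<omega> $ j) * (?\<Delta> \<omega> $ i * ?\<Delta> \<omega> $ j))
      ((\<integral>\<omega>. \<eta> \<omega> $ i * \<zeta> \<omega> $ j \<partial>M) * (if i = j then b - a else 0))"
      by (simp add: has_bochner_integral_iff)
  qed
  moreover have "(\<Sum>i\<in>UNIV. \<Sum>j\<in>UNIV. (\<eta> \<omega> $ i * \<zeta> \<omega> $ j) * (?\<Delta> \<omega> $ i * ?\<Delta> \<omega> $ j))
      = piece a b \<eta> \<omega> * piece a b \<zeta> \<omega>" for \<omega>
    unfolding piece_def inner_vec_def sum_product by (intro sum.cong refl) (simp add: ac_simps)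
  moreover have "(\<Sum>i\<in>(UNIV :: 'd set). \<Sum>j\<in>(UNIV :: 'd set). (\<integral>\<omega>. \<eta> \<omega> $ i * \<zeta> \<omega> $ j \<partial>M) * (if i = j then b - a else 0))
      = (b - a) * mean_inner \<eta> \<zeta>"
  proof -
    have "(\<Sum>j\<in>(UNIV :: 'd set). (\<integral>\<omega>. \<eta> \<omega> $ i * \<zeta> \<omega> $ j \<partial>M) * (if i = j then b - a else 0))
        = (b - a) * (\<integral>\<omega>. \<eta> \<omega> $ i * \<zeta> \<omega> $ i \<partial>M)" for i
      by (simp add: if_distrib[where f="\<lambda>x. _ * x"] cong: if_cong)
    then show ?thesis
      by (simp add: inner_vec_def integral_sum int sum_distrib_left)
  qed
  ultimately show ?thesis by simp
qed (simp add: piece_def has_bochner_integral_zero)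

text \<open>The longer integral is split at \<open>b\<close>; its later part is orthogonal to
  everything known at time \<open>b\<close>.\<close>

lemma piece_inner_start:
  assumes "0 \<le> a" "a \<le> b" "b \<le> c" "c \<le> T" and \<eta>: "adapted_coeff a \<eta>" and \<zeta>: "adapted_coeff a \<zeta>"
  shows "has_bochner_integral M (\<lambda>\<omega>. piece a b \<eta> \<omega> * piece a c \<zeta> \<omega>) ((b - a) * mean_inner \<eta> \<zeta>)"
proof -
  have "has_bochner_integral M (\<lambda>\<omega>. piece a b \<eta> \<omega> * piece a b \<zeta> \<omega> + piece a b \<eta> \<omega> * piece b c \<zeta> \<omega>)
    ((b - a) * mean_inner \<eta> \<zeta> + 0)"
    using assms
    by (intro has_bochner_integral_add piece_inner_same piece_orthogonal piece_adapted piece_integrable)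
      (auto intro: adapted_coeff_mono[of a b])
  then show ?thesis
    by (simp add: piece_split[of a c \<zeta> _ b] distrib_left)
qed

text \<open>The first interval is cut at \<open>c\<close>. What precedes \<open>c\<close> is known
  there, hence orthogonal to the second integral; what follows starts at \<open>c\<close> as well,
  which is the case of \<open>piece_inner_start\<close>.\<close>

lemma piece_inner_le:
  assumes "0 \<le> a" "a \<le> b" "b \<le> T" "0 \<le> c" "c \<le> d" "d \<le> T" "a \<le> c"
    and \<eta>: "adapted_coeff a \<eta>" and \<zeta>: "adapted_coeff c \<zeta>"
  shows "has_bochner_integral M (\<lambda>\<omega>. piece a b \<eta> \<omega> * piece c d \<zeta> \<omega>) (overlap a b c d * mean_inner \<eta> \<zeta>)"
proof (cases "b \<le> c")
  case True
  have "piece a b \<eta> \<in> borel_measurable (F c)"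
    using assms True filt_mono[OF _ True _ piece_adapted[of a b \<eta>]] by auto
  then have "has_bochner_integral M (\<lambda>\<omega>. piece a b \<eta> \<omega> * piece c d \<zeta> \<omega>) 0"
    using assms by (intro piece_orthogonal piece_integrable) auto
  moreover have "overlap a b c d = 0" using True assms by (auto simp: overlap_def)
  ultimately show ?thesis by simp
next
  case False
  have \<eta>c: "adapted_coeff c \<eta>" using assms False by (intro adapted_coeff_mono[of a c]) auto
  have "has_bochner_integral M (\<lambda>\<omega>. piece c b \<eta> \<omega> * piece c d \<zeta> \<omega>) (overlap a b c d * mean_inner \<eta> \<zeta>)"
  proof (cases "b \<le> d")
    case True
    then have "overlap a b c d = b - c" using assms False by (auto simp: overlap_def)
    then show ?thesis
      using piece_inner_start[of c b d \<eta> \<zeta>] assms \<eta>c False True by simp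
  next
    case False
    then have "overlap a b c d = d - c" using assms by (auto simp: overlap_def)
    then show ?thesis
      using piece_inner_start[of c d b \<zeta> \<eta>] assms \<eta>c False by (simp add: mult.commute inner_commute)
  qed
  moreover have "has_bochner_integral M (\<lambda>\<omega>. piece a c \<eta> \<omega> * piece c d \<zeta> \<omega>) 0"
    using assms by (intro piece_orthogonal piece_adapted piece_integrable) auto
  ultimately have "has_bochner_integral M (\<lambda>\<omega>. piece a c \<eta> \<omega> * piece c d \<zeta> \<omega> + piece c b \<eta> \<omega> * piece c d \<zeta> \<omega>)
      (0 + overlap a b c d * mean_inner \<eta> \<zeta>)"
    by (intro has_bochner_integral_add)
  then show ?thesis
    by (simp add: piece_split[of a b \<eta> _ c] distrib_right)
qed

lemma piece_inner:
  assumes "0 \<le> a" "a \<le> b" "b \<le> T" "0 \<le> c" "c \<le> d" "d \<le> T"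
    and \<eta>: "adapted_coeff a \<eta>" and \<zeta>: "adapted_coeff c \<zeta>"
  shows "has_bochner_integral M (\<lambda>\<omega>. piece a b \<eta> \<omega> * piece c d \<zeta> \<omega>) (overlap a b c d * mean_inner \<eta> \<zeta>)"
proof (cases "a \<le> c")
  case True
  then show ?thesis using assms by (intro piece_inner_le) auto
next
  case False
  then show ?thesis
    using piece_inner_le[of c d a b \<zeta> \<eta>] assms by (simp add: mult.commute inner_commute overlap_commute)
qed

text \<open>Both sides expand into the same double sum of mean inner products weighted by overlaps.
  The intervals may intersect, so that a difference of two simple integrals on unrelated time grids
  is an instance.\<close>

lemma elementary_isometry:
  assumes "finite J"
    and J: "\<And>j. j \<in> J \<Longrightarrow> 0 \<le> a j \<and> a j \<le> b j \<and> b j \<le> T \<and> adapted_coeff (a j) (\<eta> j)"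
  shows "(\<integral>\<^sup>+\<omega>. ennreal ((\<Sum>j\<in>J. piece (a j) (b j) (\<eta> j) \<omega>)\<^sup>2) \<partial>M)
    = (\<integral>\<^sup>+\<omega>. sq_norm T (\<lambda>s. \<Sum>j\<in>J. indicat_real {a j<..b j} s *\<^sub>R \<eta> j \<omega>) \<partial>M)"
proof -
  let ?v = "\<Sum>j\<in>J. \<Sum>k\<in>J. overlap (a j) (b j) (a k) (b k) * (\<integral>\<omega>. \<eta> j \<omega> \<bullet> \<eta> k \<omega> \<partial>M)"
  let ?q = "\<lambda>\<omega>. \<Sum>j\<in>J. \<Sum>k\<in>J. overlap (a j) (b j) (a k) (b k) * (\<eta> j \<omega> \<bullet> \<eta> k \<omega>)"
  have "has_bochner_integral M (\<lambda>\<omega>. \<Sum>j\<in>J. \<Sum>k\<in>J. piece (a j) (b j) (\<eta> j) \<omega> * piece (a k) (b k) (\<eta> k) \<omega>) ?v"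
    using J by (intro has_bochner_integral_sum piece_inner) auto
  then have "has_bochner_integral M (\<lambda>\<omega>. (\<Sum>j\<in>J. piece (a j) (b j) (\<eta> j) \<omega>)\<^sup>2) ?v"
    by (simp add: power2_eq_square sum_product)
  then have 1: "(\<integral>\<^sup>+\<omega>. ennreal ((\<Sum>j\<in>J. piece (a j) (b j) (\<eta> j) \<omega>)\<^sup>2) \<partial>M) = ennreal ?v"
    by (subst nn_integral_eq_integral) (auto simp: has_bochner_integral_iff)
  \<comment> \<open>For fixed \<open>\<omega>\<close> the energy expands into the same overlaps.
    Nonnegativity is read off from the integral, because \<open>ennreal\<close> would silently turn
    a negative value into 0.\<close>
  have 2: "sq_norm T (\<lambda>s. \<Sum>j\<in>J. indicat_real {a j<..b j} s *\<^sub>R \<eta> j \<omega>) = ennreal (?q \<omega>) \<and> 0 \<le> ?q \<omega>" for \<omega>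
  proof -
    let ?\<phi> = "\<lambda>s. \<Sum>j\<in>J. indicat_real {a j<..b j} s *\<^sub>R \<eta> j \<omega>"
    have "has_bochner_integral lborel (\<lambda>s. \<Sum>j\<in>J. \<Sum>k\<in>J. (indicat_real {a j<..b j} s * indicat_real {a k<..b k} s) * (\<eta> j \<omega> \<bullet> \<eta> k \<omega>)) (?q \<omega>)"
      by (intro has_bochner_integral_sum has_bochner_integral_mult_left has_bochner_integral_overlap)
    moreover have "(\<Sum>j\<in>J. \<Sum>k\<in>J. (indicat_real {a j<..b j} s * indicat_real {a k<..b k} s) * (\<eta> j \<omega> \<bullet> \<eta> k \<omega>)) = (norm (?\<phi> s))\<^sup>2" for s
      unfolding power2_norm_eq_inner inner_sum_left inner_sum_right by (intro sum.cong refl) (simp add: ac_simps inner_commute)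
    ultimately have bi: "has_bochner_integral lborel (\<lambda>s. (norm (?\<phi> s))\<^sup>2) (?q \<omega>)" by simp
    then have "(\<integral>\<^sup>+s. ennreal ((norm (?\<phi> s))\<^sup>2) \<partial>lborel) = ennreal (?q \<omega>)"
      by (subst nn_integral_eq_integral) (auto simp: has_bochner_integral_iff)
    moreover have "ennreal ((norm (?\<phi> s))\<^sup>2) * indicator {0..T} s = ennreal ((norm (?\<phi> s))\<^sup>2)" for s
    proof (cases "s \<in> {0..T}")
      case False
      then have "?\<phi> s = 0" using J by (intro sum.neutral) (force simp: indicator_def)
      then show ?thesis by simp
    qed simp
    moreover have "0 \<le> ?q \<omega>"
      unfolding has_bochner_integral_integral_eq[OF bi, symmetric] by simp
    ultimately show ?thesis
      unfolding sq_norm_def by simp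
  qed
  have "has_bochner_integral M ?q ?v"
    using J by (intro has_bochner_integral_sum has_bochner_integral_mult_right has_bochner_integral_integrable)
      (metis adapted_coeff_inner_integrable order_trans)
  then have "(\<integral>\<^sup>+\<omega>. ennreal (?q \<omega>) \<partial>M) = ennreal ?v"
    using 2 by (subst nn_integral_eq_integral) (auto simp: has_bochner_integral_iff)
  with 1 2 show ?thesis
    by (simp only:)
qed

lemma simple_integrand_mono:
  assumes "simple_integrand M F T n \<tau> \<eta>" "i \<le> j" "j \<le> n"
  shows "\<tau> i \<le> \<tau> j"
  using assms(2,3)
proof (induction j)
  case (Suc j)
  then show ?case
    using assms(1) by (cases "i = Suc j") (auto simp: simple_integrand_def intro: order_trans)
qed simp

lemma simple_integrandD:
  assumes "simple_integrand M F T n \<tau> \<eta>" "i < n"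
  shows "0 \<le> \<tau> i" "\<tau> i \<le> \<tau> (Suc i)" "\<tau> (Suc i) \<le> T" "adapted_coeff (\<tau> i) (\<eta> i)"
proof -
  show "0 \<le> \<tau> i" "\<tau> (Suc i) \<le> T"
    using simple_integrand_mono[OF assms(1), of 0 i] simple_integrand_mono[OF assms(1), of "Suc i" n] assms by (auto simp: simple_integrand_def)
  show "\<tau> i \<le> \<tau> (Suc i)" "adapted_coeff (\<tau> i) (\<eta> i)"
    using assms by (auto simp: simple_integrand_def adapted_coeff_def)
qed

lemma simple_integral_measurable:
  assumes "simple_integrand M F T n \<tau> \<eta>"
  shows "simple_integral B n \<tau> \<eta> \<in> borel_measurable M"
proof -
  have "piece (\<tau> i) (\<tau> (Suc i)) (\<eta> i) \<in> borel_measurable M" if "i < n" for i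
    using simple_integrandD[OF assms that] filt_measurable[OF _ _ piece_adapted[of "\<tau> i" "\<tau> (Suc i)" "\<eta> i"]] by auto
  then have "(\<lambda>\<omega>. \<Sum>i<n. piece (\<tau> i) (\<tau> (Suc i)) (\<eta> i) \<omega>) \<in> borel_measurable M"
    by (intro borel_measurable_sum) auto
  then show ?thesis by (simp add: simple_integral_def[abs_def] piece_def)
qed

text \<open>The sum type juxtaposes the two families of intervals, the second one with negated
  coefficients.\<close>

lemma simple_isometry:
  assumes 1: "simple_integrand M F T n \<tau> \<eta>" and 2: "simple_integrand M F T m \<sigma> \<zeta>"
  shows "(\<integral>\<^sup>+\<omega>. ennreal ((simple_integral B n \<tau> \<eta> \<omega> - simple_integral B m \<sigma> \<zeta> \<omega>)\<^sup>2) \<partial>M)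
    = (\<integral>\<^sup>+\<omega>. sq_norm T (\<lambda>s. simple_process n \<tau> \<eta> s \<omega> - simple_process m \<sigma> \<zeta> s \<omega>) \<partial>M)"
proof -
  let ?J = "{..<n} <+> {..<m}"
  let ?a = "case_sum \<tau> \<sigma>" and ?b = "case_sum (\<lambda>i. \<tau> (Suc i)) (\<lambda>i. \<sigma> (Suc i))"
    and ?e = "case_sum \<eta> (\<lambda>i \<omega>. - \<zeta> i \<omega>)"
  have neg: "adapted_coeff t (\<lambda>\<omega>. - \<zeta> i \<omega>)" if "adapted_coeff t (\<zeta> i)" for t i
    using that by (auto simp: adapted_coeff_def)
  have "(\<integral>\<^sup>+\<omega>. ennreal ((\<Sum>j\<in>?J. piece (?a j) (?b j) (?e j) \<omega>)\<^sup>2) \<partial>M)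
    = (\<integral>\<^sup>+\<omega>. sq_norm T (\<lambda>s. \<Sum>j\<in>?J. indicat_real {?a j<..?b j} s *\<^sub>R ?e j \<omega>) \<partial>M)"
    using simple_integrandD[OF 1] simple_integrandD[OF 2] by (intro elementary_isometry) (auto intro!: neg)
  moreover have "(\<Sum>j\<in>?J. piece (?a j) (?b j) (?e j) \<omega>) = simple_integral B n \<tau> \<eta> \<omega> - simple_integral B m \<sigma> \<zeta> \<omega>" for \<omega>
    by (subst sum.Plus) (auto simp: simple_integral_def piece_def sum_negf)
  moreover have "(\<Sum>j\<in>?J. indicat_real {?a j<..?b j} s *\<^sub>R ?e j \<omega>) = simple_process n \<tau> \<eta> s \<omega> - simple_process m \<sigma> \<zeta> s \<omega>" for \<omega> s
    by (subst sum.Plus) (auto simp: simple_process_def sum_negf)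
  ultimately show ?thesis by simp
qed

end

section \<open>The Ito integral of processes with bounded energy\<close>

lemma sq_norm_cong: "(\<And>s. s \<in> {0..T} \<Longrightarrow> f s = g s) \<Longrightarrow> sq_norm T f = sq_norm T g"
  unfolding sq_norm_def by (intro nn_integral_cong) (auto simp: indicator_def)

lemma sq_norm_cut: "sq_norm T (\<lambda>s. indicat_real {0..T} s *\<^sub>R f s) = sq_norm T f"
  by (rule sq_norm_cong) simp

text \<open>A weighted Young inequality: if the mean of the square is at most
  \<open>(1 / 4) ^ k\<close>, the mean of the right side is at most \<open>2 * (1 / 2) ^ k\<close>,
  hence summable in \<open>k\<close>.\<close>

lemma ennreal_square_le_linear:
  fixes d :: real
  shows "ennreal \<bar>d\<bar> \<le> ennreal (2 ^ k) * ennreal (d\<^sup>2) + ennreal ((1 / 2) ^ k)"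
proof -
  have *: "x \<le> p * x\<^sup>2 + 1 / p" if "0 < p" for x p :: real
  proof -
    have "p * x \<le> (p * x)\<^sup>2 + 1"
      using zero_le_power2[of "p * x - 1 / 2"] by (simp add: power2_diff power_divide)
    then have "x \<le> ((p * x)\<^sup>2 + 1) / p"
      using that by (simp add: pos_le_divide_eq mult.commute)
    also have "\<dots> = p * x\<^sup>2 + 1 / p"
      using that by (simp add: field_simps power2_eq_square)
    finally show ?thesis .
  qed
  have "\<bar>d\<bar> \<le> 2 ^ k * d\<^sup>2 + (1 / 2) ^ k"
    using *[of "2 ^ k" "\<bar>d\<bar>"] by (simp add: power_one_over)
  then show ?thesis
    by (simp add: ennreal_leI flip: ennreal_plus ennreal_mult)
qed

section \<open>Completeness of L2\<close>

context prob_space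
begin

abbreviation mean_square_dist :: "('a \<Rightarrow> real) \<Rightarrow> ('a \<Rightarrow> real) \<Rightarrow> ennreal" where
  "mean_square_dist X Y \<equiv> \<integral>\<^sup>+\<omega>. ennreal ((X \<omega> - Y \<omega>)\<^sup>2) \<partial>M"

text \<open>A subsequence with summable increments converges almost surely, and Fatou's lemma
  transfers the Cauchy bound to its limit.\<close>

lemma L2_complete:
  fixes S :: "nat \<Rightarrow> 'a \<Rightarrow> real"
  assumes S[measurable]: "\<And>n. S n \<in> borel_measurable M"
    and cauchy: "\<And>e. 0 < e \<Longrightarrow> \<exists>N. \<forall>n\<ge>N. \<forall>m\<ge>N. mean_square_dist (S n) (S m) \<le> ennreal e"
  shows "\<exists>Y\<in>borel_measurable M. (\<lambda>n. mean_square_dist (S n) Y) \<longlonglongrightarrow> 0"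
proof -
  obtain N where N: "\<And>k n m. n \<ge> N k \<Longrightarrow> m \<ge> N k \<Longrightarrow> mean_square_dist (S n) (S m) \<le> ennreal ((1 / 4) ^ k)"
  proof -
    have "\<forall>k. \<exists>N. \<forall>n\<ge>N. \<forall>m\<ge>N. mean_square_dist (S n) (S m) \<le> ennreal ((1 / 4) ^ k)"
      by (intro allI cauchy) simp
    then show ?thesis using that by metis
  qed
  \<comment> \<open>Summing the thresholds makes \<open>r\<close> nondecreasing and at least
    \<open>N k\<close>; the extra \<open>k\<close> makes it unbounded.\<close>
  define r where "r k = (\<Sum>i\<le>k. N i) + k" for k
  have r_ge: "N k \<le> r k" "r k \<le> r (Suc k)" "k \<le> r k" for k
    by (auto simp: r_def member_le_sum intro: trans_le_add1)
  define d where "d k \<omega> = S (r (Suc k)) \<omega> - S (r k) \<omega>" for k \<omega>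
  have d[measurable]: "d k \<in> borel_measurable M" for k unfolding d_def[abs_def] by measurable
  have "(\<integral>\<^sup>+\<omega>. ennreal \<bar>d k \<omega>\<bar> \<partial>M) \<le> ennreal (2 * (1 / 2) ^ k)" for k
  proof -
    have "(\<integral>\<^sup>+\<omega>. ennreal \<bar>d k \<omega>\<bar> \<partial>M) \<le> (\<integral>\<^sup>+\<omega>. ennreal (2 ^ k) * ennreal ((d k \<omega>)\<^sup>2) + ennreal ((1 / 2) ^ k) \<partial>M)"
      by (intro nn_integral_mono ennreal_square_le_linear)
    also have "\<dots> = ennreal (2 ^ k) * (\<integral>\<^sup>+\<omega>. ennreal ((d k \<omega>)\<^sup>2) \<partial>M) + ennreal ((1 / 2) ^ k)"
      by (simp add: nn_integral_add nn_integral_cmult emeasure_space_1)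
    also have "\<dots> \<le> ennreal (2 ^ k) * ennreal ((1 / 4) ^ k) + ennreal ((1 / 2) ^ k)"
      unfolding d_def using r_ge[of k] by (intro add_mono mult_left_mono N) auto
    also have "\<dots> = ennreal (2 * (1 / 2) ^ k)"
      by (simp add: power_mult_distrib[symmetric] flip: ennreal_mult ennreal_plus)
    finally show ?thesis .
  qed
  then have "(\<integral>\<^sup>+\<omega>. (\<Sum>k. ennreal \<bar>d k \<omega>\<bar>) \<partial>M) \<le> (\<Sum>k. ennreal (2 * (1 / 2) ^ k))"
    by (subst nn_integral_suminf) (auto intro: suminf_le)
  also have "\<dots> < \<infinity>"
    by (subst suminf_ennreal2) (auto intro!: summable_mult summable_geometric)
  finally have "AE \<omega> in M. (\<Sum>k. ennreal \<bar>d k \<omega>\<bar>) \<noteq> \<infinity>"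
    by (intro nn_integral_noteq_infinite) auto
  then have conv: "AE \<omega> in M. convergent (\<lambda>k. S (r k) \<omega>)"
  proof eventually_elim
    case (elim \<omega>)
    then have "summable (\<lambda>k. \<bar>d k \<omega>\<bar>)"
      by (intro summable_suminf_not_top) auto
    then have "summable (\<lambda>k. d k \<omega>)"
      by (rule summable_rabs_cancel)
    then have "convergent (\<lambda>n. \<Sum>k<n. d k \<omega>)"
      by (simp add: summable_iff_convergent)
    then have "convergent (\<lambda>n. S (r 0) \<omega> + (\<Sum>k<n. d k \<omega>))"
      by (intro convergent_add convergent_const)
    moreover have "S (r 0) \<omega> + (\<Sum>k<n. d k \<omega>) = S (r n) \<omega>" for n
      unfolding d_def by (subst sum_lessThan_telescope) simp
    ultimately show ?case by simp
  qed
  \<comment> \<open>\<open>lim\<close> is total and measurable in \<open>\<omega>\<close>; its value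
    where the sequence diverges concerns only a null set.\<close>
  define Y where "Y \<omega> = lim (\<lambda>k. S (r k) \<omega>)" for \<omega>
  have Y[measurable]: "Y \<in> borel_measurable M" unfolding Y_def[abs_def] by measurable
  have "(\<lambda>n. mean_square_dist (S n) Y) \<longlonglongrightarrow> 0"
  proof (rule ennreal_tendsto_0I)
    fix e :: real assume "0 < e"
    then obtain L where L: "\<And>n m. n \<ge> L \<Longrightarrow> m \<ge> L \<Longrightarrow> mean_square_dist (S n) (S m) \<le> ennreal e"
      using cauchy by blast
    show "\<forall>\<^sub>F n in sequentially. mean_square_dist (S n) Y \<le> ennreal e"
      using eventually_ge_at_top[of L]
    proof eventually_elim
      case (elim n)
      have "AE \<omega> in M. ennreal ((S n \<omega> - Y \<omega>)\<^sup>2) = liminf (\<lambda>k. ennreal ((S n \<omega> - S (r k) \<omega>)\<^sup>2))"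
        using conv
      proof eventually_elim
        case (elim \<omega>)
        then have "(\<lambda>k. S (r k) \<omega>) \<longlonglongrightarrow> Y \<omega>"
          by (simp add: Y_def convergent_LIMSEQ_iff)
        then have "(\<lambda>k. ennreal ((S n \<omega> - S (r k) \<omega>)\<^sup>2)) \<longlonglongrightarrow> ennreal ((S n \<omega> - Y \<omega>)\<^sup>2)"
          by (intro tendsto_ennrealI tendsto_intros)
        then show ?case by (rule lim_imp_Liminf[OF sequentially_bot, symmetric])
      qed
      then have "mean_square_dist (S n) Y
        = (\<integral>\<^sup>+\<omega>. liminf (\<lambda>k. ennreal ((S n \<omega> - S (r k) \<omega>)\<^sup>2)) \<partial>M)"
        by (rule nn_integral_cong_AE)
      also have "\<dots> \<le> liminf (\<lambda>k. mean_square_dist (S n) (S (r k)))"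
        by (intro nn_integral_liminf) auto
      also have "\<dots> \<le> ennreal e"
      proof (rule Liminf_le)
        show "\<forall>\<^sub>F k in sequentially. mean_square_dist (S n) (S (r k)) \<le> ennreal e"
          using eventually_ge_at_top[of L]
          by eventually_elim (use elim r_ge(3) in \<open>auto intro!: L intro: order_trans\<close>)
      qed auto
      finally show ?case .
    qed
  qed
  then show ?thesis using Y by blast
qed

end

section \<open>Joint measurability and adapted approximation\<close>

context brownian
begin

lemma mean_square_add_le:
  fixes u v :: "'a \<Rightarrow> real"
  assumes "u \<in> borel_measurable M" "v \<in> borel_measurable M"
  shows "(\<integral>\<^sup>+\<omega>. ennreal ((u \<omega> + v \<omega>)\<^sup>2) \<partial>M)
    \<le> 2 * (\<integral>\<^sup>+\<omega>. ennreal ((u \<omega>)\<^sup>2) \<partial>M) + 2 * (\<integral>\<^sup>+\<omega>. ennreal ((v \<omega>)\<^sup>2) \<partial>M)"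
  using nn_integral_norm_add_square_le[OF assms] by simp

abbreviation cut :: "('a, 'd) process \<Rightarrow> 'a \<Rightarrow> real \<Rightarrow> real ^ 'd" where
  "cut a \<omega> \<equiv> \<lambda>s. indicat_real {0..T} s *\<^sub>R a s \<omega>"

text \<open>What Fubini-type arguments on pathwise energies ask of a process; adaptedness is kept
  apart. \<open>\<omega>\<close> comes first so that time is the integrated second factor.\<close>

definition joint :: "('a, 'd) process \<Rightarrow> bool" where
  "joint u \<longleftrightarrow> (\<lambda>(\<omega>, s). indicat_real {0..T} s *\<^sub>R u s \<omega>) \<in> borel_measurable (M \<Otimes>\<^sub>M lborel)"

lemma joint_section:
  assumes "joint u" "\<omega> \<in> space M"
  shows "cut u \<omega> \<in> borel_measurable borel"
  using measurable_compose[OF measurable_Pair1'[OF assms(2), of lborel] assms(1)[unfolded joint_def]] by simp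

lemma joint_add: "joint u \<Longrightarrow> joint v \<Longrightarrow> joint (\<lambda>s \<omega>. u s \<omega> + v s \<omega>)"
  using borel_measurable_add[of "\<lambda>(\<omega>, s). indicat_real {0..T} s *\<^sub>R u s \<omega>" "M \<Otimes>\<^sub>M lborel" "\<lambda>(\<omega>, s). indicat_real {0..T} s *\<^sub>R v s \<omega>"]
  by (simp add: joint_def case_prod_beta' scaleR_add_right)

lemma joint_scaleR: "joint u \<Longrightarrow> joint (\<lambda>s \<omega>. r *\<^sub>R u s \<omega>)"
  using borel_measurable_scaleR[of "\<lambda>_. r" "M \<Otimes>\<^sub>M lborel" "\<lambda>(\<omega>, s). indicat_real {0..T} s *\<^sub>R u s \<omega>"]
  by (simp add: joint_def case_prod_beta' mult.commute)

lemma joint_diff: "joint u \<Longrightarrow> joint v \<Longrightarrow> joint (\<lambda>s \<omega>. u s \<omega> - v s \<omega>)"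
  using joint_add[of u "\<lambda>s \<omega>. (-1) *\<^sub>R v s \<omega>"] joint_scaleR[of v "-1"] by simp

abbreviation path_energy :: "('a, 'd) process \<Rightarrow> 'a \<Rightarrow> ennreal" where
  "path_energy a \<omega> \<equiv> sq_norm T (\<lambda>s. a s \<omega>)"

lemma joint_sq_norm_measurable [measurable (raw)]:
  assumes "joint u"
  shows "(\<lambda>\<omega>. path_energy u \<omega>) \<in> borel_measurable M"
proof -
  have [measurable]: "(\<lambda>p. indicat_real {0..T} (snd p) *\<^sub>R u (snd p) (fst p)) \<in> borel_measurable (M \<Otimes>\<^sub>M lborel)"
    using assms by (simp add: joint_def case_prod_beta')
  have "(\<lambda>\<omega>. \<integral>\<^sup>+s. ennreal ((norm (indicat_real {0..T} s *\<^sub>R u s \<omega>))\<^sup>2) * indicator {0..T} s \<partial>lborel) \<in> borel_measurable M"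
    by (rule lborel.borel_measurable_nn_integral, unfold case_prod_beta', measurable)
  then show ?thesis
    by (subst sq_norm_cut[symmetric]) (simp add: sq_norm_def)
qed

lemma joint_sq_norm_add_le:
  assumes "joint u" "joint v" "\<omega> \<in> space M"
  shows "sq_norm T (\<lambda>s. u s \<omega> + v s \<omega>) \<le> 2 * path_energy u \<omega> + 2 * path_energy v \<omega>"
  using sq_norm_add_le[OF joint_section[OF assms(1,3)] joint_section[OF assms(2,3)], of T]
  by (simp add: sq_norm_cut sq_norm_cut[of T "\<lambda>s. u s \<omega> + v s \<omega>"] flip: scaleR_add_right)

lemma joint_sq_norm_scaleR:
  assumes "joint u" "\<omega> \<in> space M"
  shows "sq_norm T (\<lambda>s. r *\<^sub>R u s \<omega>) = ennreal (r\<^sup>2) * path_energy u \<omega>"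
  using sq_norm_scaleR[OF joint_section[OF assms], of T r] sq_norm_cut[of T "\<lambda>s. r *\<^sub>R u s \<omega>"]
  by (simp add: sq_norm_cut mult.commute)

abbreviation process_dist :: "('a, 'd) process \<Rightarrow> ('a, 'd) process \<Rightarrow> ennreal" where
  "process_dist u v \<equiv> \<integral>\<^sup>+\<omega>. sq_norm T (\<lambda>s. u s \<omega> - v s \<omega>) \<partial>M"

lemma process_square_diff_le:
  assumes "joint u" "joint v" "joint w"
  shows "process_dist u v
    \<le> 2 * process_dist u w + 2 * process_dist v w"
proof -
  have j: "joint (\<lambda>s \<omega>. u s \<omega> - w s \<omega>)" "joint (\<lambda>s \<omega>. v s \<omega> - w s \<omega>)"
    using assms by (auto intro: joint_diff)
  have "process_dist u v
    \<le> (\<integral>\<^sup>+\<omega>. 2 * sq_norm T (\<lambda>s. u s \<omega> - w s \<omega>) + 2 * sq_norm T (\<lambda>s. v s \<omega> - w s \<omega>) \<partial>M)"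
  proof (rule nn_integral_mono)
    fix \<omega> assume \<omega>: "\<omega> \<in> space M"
    show "sq_norm T (\<lambda>s. u s \<omega> - v s \<omega>) \<le> 2 * sq_norm T (\<lambda>s. u s \<omega> - w s \<omega>) + 2 * sq_norm T (\<lambda>s. v s \<omega> - w s \<omega>)"
      using joint_sq_norm_add_le[OF j(1) joint_scaleR[OF j(2), of "-1"] \<omega>] joint_sq_norm_scaleR[OF j(2) \<omega>, of "-1"]
      by simp
  qed
  also have "\<dots> = 2 * process_dist u w + 2 * process_dist v w"
    using j[THEN joint_sq_norm_measurable] by (simp add: nn_integral_add nn_integral_cmult)
  finally show ?thesis .
qed

lemma joint_simple:
  assumes "simple_integrand M F T n \<tau> \<eta>"
  shows "joint (simple_process n \<tau> \<eta>)"
proof -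
  have [measurable]: "i < n \<Longrightarrow> \<eta> i \<in> borel_measurable M" for i
    using simple_integrandD[OF assms, of i] by (auto simp: adapted_coeff_def intro!: filt_measurable[of "\<tau> i"])
  have "(\<lambda>(\<omega>, s). indicat_real {0..T} s *\<^sub>R (\<Sum>i<n. indicat_real {\<tau> i<..\<tau> (Suc i)} s *\<^sub>R \<eta> i \<omega>)) \<in> borel_measurable (M \<Otimes>\<^sub>M lborel)"
    unfolding case_prod_beta' by (intro borel_measurable_scaleR borel_measurable_sum) auto
  then show ?thesis by (simp add: joint_def simple_process_def)
qed

text \<open>Clamping time to \<open>{0..t}\<close> transports measurability from the restricted
  interval to the whole line; the indicator removes the values that clamping adds.\<close>

lemma progressive_cut:
  fixes a :: "('a, 'd) process"
  assumes a: "progressively_measurable F T a" and t: "0 \<le> t" "t \<le> T"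
  shows "(\<lambda>(\<omega>, s). indicat_real {0..t} s *\<^sub>R a s \<omega>) \<in> borel_measurable (F t \<Otimes>\<^sub>M lborel)"
proof -
  have a': "(\<lambda>(s, \<omega>). a s \<omega>) \<in> borel_measurable (restrict_space borel {0..t} \<Otimes>\<^sub>M F t)"
    using assms by (auto simp: progressively_measurable_def)
  have "(\<lambda>s. min t (max 0 s)) \<in> measurable lborel (restrict_space borel {0..t})"
    using t by (intro measurable_restrict_space2) auto
  then have "(\<lambda>p. (min t (max 0 (snd p)), fst p)) \<in> measurable (F t \<Otimes>\<^sub>M lborel) (restrict_space borel {0..t} \<Otimes>\<^sub>M F t)"
    by (intro measurable_Pair measurable_compose[OF measurable_snd] measurable_fst)
  from measurable_compose[OF this a'] have a'':
    "(\<lambda>p. a (min t (max 0 (snd p))) (fst p)) \<in> borel_measurable (F t \<Otimes>\<^sub>M lborel)"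
    by simp
  have "(\<lambda>p. indicat_real {0..t} (snd p) *\<^sub>R a (min t (max 0 (snd p))) (fst p)) \<in> borel_measurable (F t \<Otimes>\<^sub>M lborel)"
    by (rule borel_measurable_scaleR[OF _ a'']) measurable
  also have "(\<lambda>p. indicat_real {0..t} (snd p) *\<^sub>R a (min t (max 0 (snd p))) (fst p))
      = (\<lambda>(\<omega>, s). indicat_real {0..t} s *\<^sub>R a s \<omega>)"
    by (auto simp: fun_eq_iff indicator_def)
  finally show ?thesis .
qed

lemma progressive_joint:
  assumes "progressively_measurable F T a"
  shows "joint a"
proof -
  have "(\<lambda>p. p) \<in> measurable (M \<Otimes>\<^sub>M lborel) (F T \<Otimes>\<^sub>M lborel)"
    using T_pos by (intro measurable_pair) (auto intro!: measurable_compose[OF measurable_fst] filt_measurable[of T] simp: comp_def)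
  from measurable_compose[OF this progressive_cut[OF assms, of T]] show ?thesis
    using T_pos by (simp add: joint_def case_prod_beta')
qed

text \<open>The truncation only changes the coefficient on the null set where the energy of \<open>a\<close>
  exceeds \<open>A\<close>; it makes the coefficient bounded.\<close>

definition approx_coeff :: "real \<Rightarrow> ('a, 'd) process \<Rightarrow> nat \<Rightarrow> nat \<Rightarrow> 'a \<Rightarrow> real ^ 'd" where
  "approx_coeff A a n i \<omega> =
     (let c = step_coeff T n (cut a \<omega>) i
      in if (norm c)\<^sup>2 * (T / real (Suc n)) \<le> A then c else 0)"

abbreviation approx_process :: "real \<Rightarrow> ('a, 'd) process \<Rightarrow> nat \<Rightarrow> ('a, 'd) process" where
  "approx_process A a n \<equiv> simple_process (Suc n) (grid T n) (approx_coeff A a n)"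

abbreviation approx_integral :: "real \<Rightarrow> ('a, 'd) process \<Rightarrow> nat \<Rightarrow> 'a \<Rightarrow> real" where
  "approx_integral A a n \<equiv> simple_integral B (Suc n) (grid T n) (approx_coeff A a n)"

lemma grid_nonneg: "0 \<le> grid T n i"
  using T_pos by (simp add: grid_def)

lemma grid_le: "i \<le> Suc n \<Longrightarrow> grid T n i \<le> T"
  using grid_mono[OF T_pos, of i "Suc n" n] by simp

text \<open>Coefficient \<open>i\<close> integrates over a cell ending at \<open>grid T n i\<close>.
  On that cell, cutting at \<open>T\<close> and cutting at \<open>grid T n i\<close> agree, so
  progressive measurability at this very time applies.\<close>

lemma step_coeff_adapted:
  fixes a :: "('a, 'd) process"
  assumes a: "progressively_measurable F T a" and i: "i \<le> Suc n"
  shows "(\<lambda>\<omega>. step_coeff T n (cut a \<omega>) i) \<in> borel_measurable (F (grid T n i))"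
proof (cases "i = 0")
  case False
  let ?t = "grid T n i" and ?u = "grid T n (i - 1)"
  have t: "0 \<le> ?t" "?t \<le> T" "0 \<le> ?u" using grid_nonneg grid_le i by auto
  have m: "(\<lambda>p. indicat_real {0..?t} (snd p) *\<^sub>R a (snd p) (fst p)) \<in> borel_measurable (F ?t \<Otimes>\<^sub>M lborel)"
    using progressive_cut[OF a t(1,2)] by (simp add: case_prod_beta')
  have "(\<lambda>\<omega>. \<integral>s. indicat_real {?u<..?t} s *\<^sub>R (indicat_real {0..?t} s *\<^sub>R a s \<omega>) \<partial>lborel) \<in> borel_measurable (F ?t)"
    by (rule lborel.borel_measurable_lebesgue_integral, unfold case_prod_beta',
        rule borel_measurable_scaleR[OF _ m]) measurable
  moreover have eq: "indicat_real {?u<..?t} s *\<^sub>R (indicat_real {0..?t} s *\<^sub>R a s \<omega>)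
      = indicat_real {?u<..?t} s *\<^sub>R (indicat_real {0..T} s *\<^sub>R a s \<omega>)" for s \<omega>
    using t by (auto simp: indicator_def)
  ultimately have "(\<lambda>\<omega>. \<integral>s. indicat_real {?u<..?t} s *\<^sub>R (indicat_real {0..T} s *\<^sub>R a s \<omega>) \<partial>lborel) \<in> borel_measurable (F ?t)"
    by (simp only: eq)
  then show ?thesis
    unfolding step_coeff_def set_lebesgue_integral_def if_not_P[OF False]
    by (intro borel_measurable_scaleR measurable_const) auto
qed (simp add: step_coeff_def)

lemma approx_simple:
  assumes a: "progressively_measurable F T a" and A: "0 \<le> A"
  shows "simple_integrand M F T (Suc n) (grid T n) (approx_coeff A a n)"
  unfolding simple_integrand_def
proof (intro conjI allI impI)
  fix i assume i: "i < Suc n"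
  show "grid T n i \<le> grid T n (Suc i)" by (rule grid_mono[OF T_pos]) simp
  have [measurable]: "(\<lambda>\<omega>. step_coeff T n (cut a \<omega>) i) \<in> borel_measurable (F (grid T n i))"
    using i by (intro step_coeff_adapted[OF a]) simp
  show "approx_coeff A a n i \<in> borel_measurable (F (grid T n i))"
    unfolding approx_coeff_def[abs_def] Let_def using i by measurable
  show "\<exists>C. \<forall>\<omega>\<in>space M. norm (approx_coeff A a n i \<omega>) \<le> C"
  proof (intro exI ballI)
    fix \<omega>
    have "(norm (approx_coeff A a n i \<omega>))\<^sup>2 \<le> A / (T / real (Suc n))"
      using A T_pos by (auto simp: approx_coeff_def Let_def pos_le_divide_eq pos_divide_le_eq simp del: of_nat_Suc)
    then show "norm (approx_coeff A a n i \<omega>) \<le> sqrt (A / (T / real (Suc n)))"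
      by (rule real_le_rsqrt)
  qed
qed (use T_pos in auto)

text \<open>By the cell-wise Cauchy-Schwarz bound, a path of energy at most \<open>A\<close> never
  triggers the truncation.\<close>

lemma approx_coeff_eq:
  assumes "joint a" "\<omega> \<in> space M" and A: "path_energy a \<omega> \<le> ennreal A" "0 \<le> A" and i: "i \<le> Suc n"
  shows "approx_coeff A a n i \<omega> = step_coeff T n (cut a \<omega>) i"
proof (cases i)
  case (Suc j)
  let ?f = "cut a \<omega>"
  have [measurable]: "?f \<in> borel_measurable borel" by (rule joint_section[OF assms(1,2)])
  have "ennreal ((norm (step_coeff T n ?f i))\<^sup>2) * ennreal (T / real (Suc n))
    \<le> (\<integral>\<^sup>+s\<in>cell T n j. ennreal ((norm (?f s))\<^sup>2) \<partial>lborel)"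
    unfolding Suc by (rule step_coeff_square_le[OF T_pos]) simp
  also have "\<dots> \<le> sq_norm T ?f"
    unfolding sq_norm_def using grid_nonneg[of n j] grid_le[of "Suc j" n] i Suc
    by (intro nn_integral_mono) (auto simp: indicator_def)
  also have "\<dots> \<le> ennreal A" using A by (simp add: sq_norm_cut)
  finally have "(norm (step_coeff T n ?f i))\<^sup>2 * (T / real (Suc n)) \<le> A"
    using T_pos A by (simp add: ennreal_mult[symmetric] del: of_nat_Suc)
  then show ?thesis by (simp add: approx_coeff_def)
qed (use A in \<open>simp add: approx_coeff_def step_coeff_def\<close>)

lemma approx_process_eq:
  assumes "joint a" "\<omega> \<in> space M" "path_energy a \<omega> \<le> ennreal A" "0 \<le> A"
  shows "approx_process A a n s \<omega> = step_avg T n (cut a \<omega>) s"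
  unfolding simple_process_def step_avg_def by (intro sum.cong refl) (simp add: approx_coeff_eq[OF assms])

lemma joint_L2:
  assumes "joint a" "\<omega> \<in> space M" "path_energy a \<omega> \<le> ennreal A"
  shows "L2 T (cut a \<omega>)"
  using assms joint_section[OF assms(1,2)] by (auto simp: L2_def sq_norm_cut intro: le_less_trans)

lemma approx_converges_pathwise:
  assumes "joint a" "\<omega> \<in> space M" "path_energy a \<omega> \<le> ennreal A" "0 \<le> A"
  shows "(\<lambda>n. sq_norm T (\<lambda>s. approx_process A a n s \<omega> - a s \<omega>)) \<longlonglongrightarrow> 0"
    and "path_energy (approx_process A a n) \<omega> \<le> ennreal A"
proof -
  let ?f = "cut a \<omega>"
  have L2: "L2 T ?f" by (rule joint_L2[OF assms(1-3)])
  have "sq_norm T (\<lambda>s. approx_process A a n s \<omega> - a s \<omega>) = sq_norm T (\<lambda>s. step_avg T n ?f s - ?f s)" for n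
    unfolding approx_process_eq[OF assms] by (rule sq_norm_cong) simp
  then show "(\<lambda>n. sq_norm T (\<lambda>s. approx_process A a n s \<omega> - a s \<omega>)) \<longlonglongrightarrow> 0"
    using step_avg_conv_L2[OF T_pos L2] by (simp add: step_avg_conv_def)
  have "path_energy (approx_process A a n) \<omega> = sq_norm T (step_avg T n ?f)"
    unfolding approx_process_eq[OF assms] ..
  also have "\<dots> \<le> sq_norm T ?f" using L2 by (intro sq_norm_step_avg_le T_pos) (simp add: L2_def)
  finally show "path_energy (approx_process A a n) \<omega> \<le> ennreal A"
    using assms(3) by (simp add: sq_norm_cut)
qed

text \<open>The bound \<open>A\<close> is an explicit argument since it is the truncation level of
  the approximation and governs the second moments of the exponentials. The inequality is not
  strict, so that a deterministic kernel qualifies with its own energy as bound.\<close>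

definition energy_le :: "real \<Rightarrow> ('a, 'd) process \<Rightarrow> bool" where
  "energy_le A a \<longleftrightarrow> 0 \<le> A \<and> progressively_measurable F T a \<and> (AE \<omega> in M. path_energy a \<omega> \<le> ennreal A)"

text \<open>Pathwise convergence, dominated by \<open>4 * A\<close>: process and approximation both
  have energy at most \<open>A\<close>, and the square bound doubles each.\<close>

lemma approx_converges:
  assumes "energy_le A a"
  shows "(\<lambda>n. process_dist (approx_process A a n) a) \<longlonglongrightarrow> 0"
proof -
  have A: "0 \<le> A" and prog: "progressively_measurable F T a" and AE: "AE \<omega> in M. path_energy a \<omega> \<le> ennreal A"
    using assms by (auto simp: energy_le_def)
  note ja = progressive_joint[OF prog]
  have js: "joint (approx_process A a n)" for n by (rule joint_simple[OF approx_simple[OF prog A]])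
  have "(\<lambda>n. process_dist (approx_process A a n) a) \<longlonglongrightarrow> (\<integral>\<^sup>+\<omega>. 0 \<partial>M)"
  proof (rule nn_integral_dominated_convergence[where w="\<lambda>_. ennreal (4 * A)"])
    show "(\<lambda>\<omega>. sq_norm T (\<lambda>s. approx_process A a n s \<omega> - a s \<omega>)) \<in> borel_measurable M" for n
      by (intro joint_sq_norm_measurable joint_diff ja js)
    show "AE \<omega> in M. sq_norm T (\<lambda>s. approx_process A a n s \<omega> - a s \<omega>) \<le> ennreal (4 * A)" for n
      using AE AE_space
    proof eventually_elim
      case (elim \<omega>)
      have "sq_norm T (\<lambda>s. approx_process A a n s \<omega> + (-1) *\<^sub>R a s \<omega>)
        \<le> 2 * path_energy (approx_process A a n) \<omega> + 2 * sq_norm T (\<lambda>s. (-1) *\<^sub>R a s \<omega>)"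
        by (intro joint_sq_norm_add_le js joint_scaleR ja elim)
      also have "\<dots> \<le> 2 * ennreal A + 2 * ennreal A"
        unfolding joint_sq_norm_scaleR[OF ja elim(2)]
        using elim by (intro add_mono mult_left_mono approx_converges_pathwise ja A) auto
      also have "\<dots> = ennreal (4 * A)" using A by (simp flip: ennreal_plus ennreal_numeral ennreal_mult)
      finally show ?case by simp
    qed
    show "AE \<omega> in M. (\<lambda>n. sq_norm T (\<lambda>s. approx_process A a n s \<omega> - a s \<omega>)) \<longlonglongrightarrow> 0"
      using AE AE_space by eventually_elim (rule approx_converges_pathwise[OF ja _ _ A])
  qed (auto simp: emeasure_space_1)
  then show ?thesis by simp
qed

end

text \<open>A difference of squared norms is the inner product of \<open>u - v\<close> and
  \<open>u + v\<close>. Young's inequality with weight \<open>d\<close> splits it into the squared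
  distance times \<open>1 / d\<close> and a small multiple of the two energies.\<close>

lemma sq_norm_le_perturb:
  fixes f g :: "real \<Rightarrow> 'b::euclidean_space"
  assumes [measurable]: "f \<in> borel_measurable borel" "g \<in> borel_measurable borel"
    and "sq_norm T f \<le> ennreal A" "sq_norm T g \<le> ennreal A" "0 \<le> A" "0 < d"
  shows "sq_norm T f \<le> sq_norm T g + ennreal (1 / d) * sq_norm T (\<lambda>s. f s - g s) + ennreal (2 * d * A)"
proof -
  have pw: "ennreal ((norm u)\<^sup>2) \<le> ennreal ((norm v)\<^sup>2) + ennreal (1 / d) * ennreal ((norm (u - v))\<^sup>2)
      + ennreal d * (ennreal ((norm u)\<^sup>2) + ennreal ((norm v)\<^sup>2))" for u v :: 'b
  proof -
    have "norm (u - v) * norm (u + v) \<le> (1 / d * (norm (u - v))\<^sup>2 + d * (norm (u + v))\<^sup>2) / 2"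
      using sum_squares_bound[of "norm (u - v) / sqrt d" "norm (u + v) * sqrt d"] \<open>0 < d\<close>
      by (simp add: power_divide power_mult_distrib field_simps)
    moreover have "(norm (u + v))\<^sup>2 \<le> 2 * (norm u)\<^sup>2 + 2 * (norm v)\<^sup>2"
      using sum_squares_bound[of "norm u" "norm v"] power_mono[OF norm_triangle_ineq[of u v], of 2]
      by (simp add: power2_sum)
    then have "d * (norm (u + v))\<^sup>2 \<le> d * (2 * (norm u)\<^sup>2 + 2 * (norm v)\<^sup>2)"
      using \<open>0 < d\<close> by (intro mult_left_mono) auto
    moreover have "(norm u)\<^sup>2 - (norm v)\<^sup>2 = (u - v) \<bullet> (u + v)"
      by (simp add: power2_norm_eq_inner algebra_simps inner_commute)
    moreover have "(u - v) \<bullet> (u + v) \<le> norm (u - v) * norm (u + v)"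
      by (rule norm_cauchy_schwarz)
    moreover have "0 \<le> 1 / d * (norm (u - v))\<^sup>2" using \<open>0 < d\<close> by simp
    ultimately have "(norm u)\<^sup>2 \<le> (norm v)\<^sup>2 + 1 / d * (norm (u - v))\<^sup>2 + d * ((norm u)\<^sup>2 + (norm v)\<^sup>2)"
      by (simp add: distrib_left)
    from ennreal_leI[OF this] show ?thesis
      using \<open>0 < d\<close>
      by (simp only: ennreal_plus ennreal_mult zero_le_power2 add_nonneg_nonneg mult_nonneg_nonneg
          less_imp_le zero_le_divide_1_iff)
  qed
  have "sq_norm T f \<le> (\<integral>\<^sup>+s. (ennreal ((norm (g s))\<^sup>2) + ennreal (1 / d) * ennreal ((norm (f s - g s))\<^sup>2)
      + ennreal d * (ennreal ((norm (f s))\<^sup>2) + ennreal ((norm (g s))\<^sup>2))) * indicator {0..T} s \<partial>lborel)"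
    unfolding sq_norm_def by (intro nn_integral_mono mult_right_mono pw) auto
  also have "\<dots> = sq_norm T g + ennreal (1 / d) * sq_norm T (\<lambda>s. f s - g s) + ennreal d * (sq_norm T f + sq_norm T g)"
    by (simp add: sq_norm_def distrib_right nn_integral_add nn_integral_cmult mult.assoc distrib_left)
  also have "\<dots> \<le> sq_norm T g + ennreal (1 / d) * sq_norm T (\<lambda>s. f s - g s) + ennreal d * (ennreal A + ennreal A)"
    using assms by (intro add_mono mult_left_mono) auto
  also have "ennreal d * (ennreal A + ennreal A) = ennreal (2 * d * A)"
    using assms by (simp add: algebra_simps flip: ennreal_plus ennreal_mult)
  finally show ?thesis .
qed

lemma sq_norm_tendsto:
  fixes f :: "real \<Rightarrow> 'b::euclidean_space"
  assumes f[measurable]: "f \<in> borel_measurable borel" and g[measurable]: "\<And>n. g n \<in> borel_measurable borel"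
    and fA: "sq_norm T f \<le> ennreal A" and gA: "\<And>n. sq_norm T (g n) \<le> ennreal A" and A: "0 \<le> A"
    and lim: "(\<lambda>n. sq_norm T (\<lambda>s. g n s - f s)) \<longlonglongrightarrow> 0"
  shows "(\<lambda>n. enn2real (sq_norm T (g n))) \<longlonglongrightarrow> enn2real (sq_norm T f)"
proof (rule LIMSEQ_I)
  fix e :: real assume "0 < e"
  \<comment> \<open>This makes \<open>2 * d * A\<close> less than \<open>e / 2\<close>, while
    squared distances below \<open>d * e / 2\<close> contribute at most \<open>e / 2\<close>; the
    summand 4 covers \<open>A = 0\<close>.\<close>
  define d where "d = e / (4 * A + 4)"
  have d: "0 < d" "2 * d * A < e / 2"
    using \<open>0 < e\<close> A by (auto simp: d_def field_simps)
  have sym: "sq_norm T (\<lambda>s. f s - g n s) = sq_norm T (\<lambda>s. g n s - f s)" for n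
    by (simp add: sq_norm_def norm_minus_commute)
  have "\<forall>\<^sub>F n in sequentially. sq_norm T (\<lambda>s. g n s - f s) < ennreal (d * e / 2)"
    using lim by (rule order_tendstoD(2)) (use d \<open>0 < e\<close> in simp)
  then obtain N where N: "\<And>n. n \<ge> N \<Longrightarrow> sq_norm T (\<lambda>s. g n s - f s) < ennreal (d * e / 2)"
    by (auto simp: eventually_sequentially)
  show "\<exists>N. \<forall>n\<ge>N. norm (enn2real (sq_norm T (g n)) - enn2real (sq_norm T f)) < e"
  proof (intro exI allI impI)
    fix n assume n: "n \<ge> N"
    have fin: "sq_norm T f < \<infinity>" "sq_norm T (g n) < \<infinity>"
      using fA gA[of n] by (auto intro: le_less_trans)
    have bound: "ennreal (1 / d) * sq_norm T (\<lambda>s. g n s - f s) + ennreal (2 * d * A) \<le> ennreal (e / 2 + 2 * d * A)"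
    proof -
      have "ennreal (1 / d) * sq_norm T (\<lambda>s. g n s - f s) \<le> ennreal (1 / d) * ennreal (d * e / 2)"
        using N[OF n] by (intro mult_left_mono) auto
      also have "\<dots> = ennreal (e / 2)"
        using d by (simp flip: ennreal_mult')
      finally show ?thesis
        using d A \<open>0 < e\<close> by (auto simp: ennreal_plus intro!: add_mono)
    qed
    have "sq_norm T f \<le> sq_norm T (g n) + ennreal (e / 2 + 2 * d * A)"
      using sq_norm_le_perturb[OF f g[of n] fA gA[of n] A d(1)] bound
      by (simp add: sym add.assoc) (meson add_left_mono order_trans)
    moreover have "sq_norm T (g n) \<le> sq_norm T f + ennreal (e / 2 + 2 * d * A)"
      using sq_norm_le_perturb[OF g[of n] f gA[of n] fA A d(1)] bound
      by (simp add: add.assoc) (meson add_left_mono order_trans)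
    ultimately have "enn2real (sq_norm T f) \<le> enn2real (sq_norm T (g n)) + (e / 2 + 2 * d * A)"
      "enn2real (sq_norm T (g n)) \<le> enn2real (sq_norm T f) + (e / 2 + 2 * d * A)"
      using fin d A \<open>0 < e\<close>
      by (cases "sq_norm T f"; cases "sq_norm T (g n)"; simp flip: ennreal_plus)+
    then show "norm (enn2real (sq_norm T (g n)) - enn2real (sq_norm T f)) < e"
      using d by auto
  qed
qed

context prob_space
begin

lemma mean_square_limit_unique:
  fixes S :: "nat \<Rightarrow> 'a \<Rightarrow> real"
  assumes [measurable]: "\<And>n. S n \<in> borel_measurable M" "Y \<in> borel_measurable M" "Z \<in> borel_measurable M"
    and Y: "(\<lambda>n. mean_square_dist (S n) Y) \<longlonglongrightarrow> 0"
    and Z: "(\<lambda>n. mean_square_dist (S n) Z) \<longlonglongrightarrow> 0"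
  shows "AE \<omega> in M. Y \<omega> = Z \<omega>"
proof -
  have "mean_square_dist Y Z \<le> 0"
  proof (rule LIMSEQ_le_const)
    have "(\<lambda>n. 2 * mean_square_dist (S n) Y + 2 * mean_square_dist (S n) Z)
        \<longlonglongrightarrow> 2 * 0 + 2 * 0"
      by (intro tendsto_add ennreal_tendsto_cmult Y Z) auto
    then show "(\<lambda>n. 2 * mean_square_dist (S n) Y + 2 * mean_square_dist (S n) Z)
        \<longlonglongrightarrow> 0" by simp
    have "mean_square_dist Y Z
      \<le> 2 * mean_square_dist (S n) Y + 2 * mean_square_dist (S n) Z" for n
      using nn_integral_norm_add_square_le[of "\<lambda>\<omega>. Y \<omega> - S n \<omega>" M "\<lambda>\<omega>. S n \<omega> - Z \<omega>"]
      by (simp add: power2_commute[of "Y _"])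
    then show "\<exists>N. \<forall>n\<ge>N. mean_square_dist Y Z
      \<le> 2 * mean_square_dist (S n) Y + 2 * mean_square_dist (S n) Z"
      by blast
  qed
  then have "mean_square_dist Y Z = 0" by simp
  then have "AE \<omega> in M. ennreal ((Y \<omega> - Z \<omega>)\<^sup>2) = 0"
    by (subst (asm) nn_integral_0_iff_AE) auto
  then show ?thesis by eventually_elim simp
qed

text \<open>Fatou gives one inequality. Loss of mass is excluded by uniform integrability: z is at
  most min z R plus z^2 / R. The second term has mean at most \<open>C / R\<close>, and the
  truncated part passes to the limit by bounded convergence.\<close>

lemma nn_integral_limit_L2_bounded:
  fixes Z :: "nat \<Rightarrow> 'a \<Rightarrow> real"
  assumes [measurable]: "\<And>n. Z n \<in> borel_measurable M" "Y \<in> borel_measurable M"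
    and pos: "\<And>n \<omega>. 0 \<le> Z n \<omega>" and lim: "AE \<omega> in M. (\<lambda>n. Z n \<omega>) \<longlonglongrightarrow> Y \<omega>"
    and one: "\<And>n. (\<integral>\<^sup>+\<omega>. ennreal (Z n \<omega>) \<partial>M) = 1"
    and sq: "\<And>n. (\<integral>\<^sup>+\<omega>. ennreal ((Z n \<omega>)\<^sup>2) \<partial>M) \<le> ennreal C" and C: "0 \<le> C"
  shows "(\<integral>\<^sup>+\<omega>. ennreal (Y \<omega>) \<partial>M) = 1"
proof (rule antisym)
  have "AE \<omega> in M. ennreal (Y \<omega>) = liminf (\<lambda>n. ennreal (Z n \<omega>))"
    using lim by eventually_elim (intro lim_imp_Liminf[symmetric] sequentially_bot tendsto_ennrealI)
  then have "(\<integral>\<^sup>+\<omega>. ennreal (Y \<omega>) \<partial>M) = (\<integral>\<^sup>+\<omega>. liminf (\<lambda>n. ennreal (Z n \<omega>)) \<partial>M)"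
    by (rule nn_integral_cong_AE)
  also have "\<dots> \<le> liminf (\<lambda>n. \<integral>\<^sup>+\<omega>. ennreal (Z n \<omega>) \<partial>M)"
    by (intro nn_integral_liminf) auto
  also have "\<dots> = 1" by (simp add: one Liminf_const)
  finally show le: "(\<integral>\<^sup>+\<omega>. ennreal (Y \<omega>) \<partial>M) \<le> 1" .
  show "1 \<le> (\<integral>\<^sup>+\<omega>. ennreal (Y \<omega>) \<partial>M)"
  proof (rule ennreal_le_epsilon)
    fix e :: real assume "0 < e"
    \<comment> \<open>Chosen so that \<open>C / R \<le> e\<close>; the summand 1 keeps
      \<open>R\<close> positive for \<open>C = 0\<close>.\<close>
    define R where "R = (C + 1) / e"
    have R: "0 < R" "C / R \<le> e" using C \<open>0 < e\<close> by (auto simp: R_def field_simps)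
    have "1 \<le> (\<integral>\<^sup>+\<omega>. ennreal (min (Z n \<omega>) R) \<partial>M) + ennreal e" for n
    proof -
      have "1 = (\<integral>\<^sup>+\<omega>. ennreal (Z n \<omega>) \<partial>M)" by (simp add: one)
      also have "\<dots> \<le> (\<integral>\<^sup>+\<omega>. ennreal (min (Z n \<omega>) R) + ennreal (1 / R) * ennreal ((Z n \<omega>)\<^sup>2) \<partial>M)"
      proof (intro nn_integral_mono)
        fix \<omega>
        have "Z n \<omega> \<le> min (Z n \<omega>) R + 1 / R * (Z n \<omega>)\<^sup>2"
        proof (cases "Z n \<omega> \<le> R")
          case False
          then have "R * Z n \<omega> \<le> (Z n \<omega>)\<^sup>2" using R by (simp add: power2_eq_square)
          then have "Z n \<omega> \<le> 1 / R * (Z n \<omega>)\<^sup>2" using R by (simp add: field_simps)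
          then show ?thesis using R pos[of n \<omega>] by (simp add: add_increasing)
        qed (use R in auto)
        from ennreal_leI[OF this] show "ennreal (Z n \<omega>) \<le> ennreal (min (Z n \<omega>) R) + ennreal (1 / R) * ennreal ((Z n \<omega>)\<^sup>2)"
        proof -
          have "0 \<le> min (Z n \<omega>) R" "0 \<le> 1 / R" using R pos[of n \<omega>] by auto
          then have "ennreal (min (Z n \<omega>) R + 1 / R * (Z n \<omega>)\<^sup>2)
              = ennreal (min (Z n \<omega>) R) + ennreal (1 / R) * ennreal ((Z n \<omega>)\<^sup>2)"
            by (subst ennreal_plus) (simp_all only: ennreal_mult zero_le_power2 mult_nonneg_nonneg)
          then show ?thesis using \<open>ennreal (Z n \<omega>) \<le> ennreal (min (Z n \<omega>) R + 1 / R * (Z n \<omega>)\<^sup>2)\<close>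
            by simp
        qed
      qed
      also have "\<dots> = (\<integral>\<^sup>+\<omega>. ennreal (min (Z n \<omega>) R) \<partial>M) + ennreal (1 / R) * (\<integral>\<^sup>+\<omega>. ennreal ((Z n \<omega>)\<^sup>2) \<partial>M)"
        by (simp add: nn_integral_add nn_integral_cmult)
      also have "\<dots> \<le> (\<integral>\<^sup>+\<omega>. ennreal (min (Z n \<omega>) R) \<partial>M) + ennreal (1 / R) * ennreal C"
        by (intro add_left_mono mult_left_mono sq) auto
      also have "ennreal (1 / R) * ennreal C = ennreal (C / R)"
        using R C by (simp flip: ennreal_mult)
      also have "\<dots> \<le> ennreal e" using R by (intro ennreal_leI)
      finally show ?thesis by (simp add: add_left_mono)
    qed
    moreover have "(\<lambda>n. (\<integral>\<^sup>+\<omega>. ennreal (min (Z n \<omega>) R) \<partial>M) + ennreal e)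
        \<longlonglongrightarrow> (\<integral>\<^sup>+\<omega>. ennreal (min (Y \<omega>) R) \<partial>M) + ennreal e"
    proof (intro tendsto_add tendsto_const nn_integral_dominated_convergence[where w="\<lambda>_. ennreal R"])
      show "AE \<omega> in M. (\<lambda>n. ennreal (min (Z n \<omega>) R)) \<longlonglongrightarrow> ennreal (min (Y \<omega>) R)"
        using lim by eventually_elim (intro tendsto_ennrealI tendsto_min tendsto_const)
    qed (auto simp: emeasure_space_1 intro!: AE_I2 ennreal_leI)
    ultimately have "1 \<le> (\<integral>\<^sup>+\<omega>. ennreal (min (Y \<omega>) R) \<partial>M) + ennreal e"
      by (intro LIMSEQ_le_const) auto
    also have "\<dots> \<le> (\<integral>\<^sup>+\<omega>. ennreal (Y \<omega>) \<partial>M) + ennreal e"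
      by (intro add_right_mono nn_integral_mono ennreal_leI) auto
    finally show "1 \<le> (\<integral>\<^sup>+\<omega>. ennreal (Y \<omega>) \<partial>M) + ennreal e" .
  qed
qed

end

section \<open>Existence, uniqueness and linearity of the Ito integral\<close>

context brownian
begin

lemma is_ito_integral_iff:
  "is_ito_integral M F B T a Y \<longleftrightarrow>
     Y \<in> borel_measurable M \<and>
     (\<exists>n \<tau> \<eta>. (\<forall>k::nat. simple_integrand M F T (n k) (\<tau> k) (\<eta> k)) \<and>
        (\<lambda>k. process_dist (simple_process (n k) (\<tau> k) (\<eta> k)) a) \<longlonglongrightarrow> 0 \<and>
        (\<lambda>k. mean_square_dist (simple_integral B (n k) (\<tau> k) (\<eta> k)) Y) \<longlonglongrightarrow> 0)"
  by (simp add: is_ito_integral_def sq_norm_def)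

lemma energy_leD:
  assumes "energy_le A a"
  shows "0 \<le> A" "progressively_measurable F T a" "joint a" "AE \<omega> in M. path_energy a \<omega> \<le> ennreal A"
  using assms progressive_joint by (auto simp: energy_le_def)

lemma approx_simple_energy: "energy_le A a \<Longrightarrow> simple_integrand M F T (Suc n) (grid T n) (approx_coeff A a n)"
  by (intro approx_simple) (auto simp: energy_le_def)

text \<open>The isometry turns convergence of the approximating processes into the Cauchy property
  of their integrals. Existence is what gives the choice in \<open>ito_integral\<close> a
  meaning.\<close>

lemma ito_exists:
  assumes a: "energy_le A a"
  shows "\<exists>Y. is_ito_integral M F B T a Y"
proof -
  note S = approx_simple_energy[OF a]
  have "\<exists>Y\<in>borel_measurable M. (\<lambda>n. mean_square_dist (approx_integral A a n) Y) \<longlonglongrightarrow> 0"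
  proof (rule L2_complete)
    show "approx_integral A a n \<in> borel_measurable M" for n
      by (rule simple_integral_measurable[OF S])
    fix e :: real assume "0 < e"
    then have "0 < ennreal (e / 4)" by simp
    from order_tendstoD(2)[OF approx_converges[OF a] this]
    obtain N where N: "\<And>n. n \<ge> N \<Longrightarrow> process_dist (approx_process A a n) a < ennreal (e / 4)"
      by (auto simp: eventually_sequentially)
    show "\<exists>N. \<forall>n\<ge>N. \<forall>m\<ge>N. mean_square_dist (approx_integral A a n) (approx_integral A a m) \<le> ennreal e"
    proof (intro exI allI impI)
      fix n m assume nm: "n \<ge> N" "m \<ge> N"
      have "mean_square_dist (approx_integral A a n) (approx_integral A a m)
        = process_dist (approx_process A a n) (approx_process A a m)"
        by (rule simple_isometry[OF S S])
      also have "\<dots> \<le> 2 * process_dist (approx_process A a n) a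
          + 2 * process_dist (approx_process A a m) a"
        by (intro process_square_diff_le joint_simple[OF S] energy_leD[OF a])
      also have "\<dots> \<le> 2 * ennreal (e / 4) + 2 * ennreal (e / 4)"
        using N nm by (intro add_mono mult_left_mono less_imp_le) auto
      also have "\<dots> = ennreal e" using \<open>0 < e\<close> by (simp flip: ennreal_plus ennreal_numeral ennreal_mult)
      finally show "mean_square_dist (approx_integral A a n) (approx_integral A a m) \<le> ennreal e" .
    qed
  qed
  then show ?thesis
    unfolding is_ito_integral_iff using S approx_converges[OF a]
    by (blast intro: exI[of _ Suc])
qed

text \<open>The integral may be computed along any convenient approximating sequence: one far member
  of the sequence that defines \<open>Y\<close> is compared, through the isometry, with the tail of
  the given one.\<close>

lemma ito_approx:
  assumes Y: "is_ito_integral M F B T a Y" and a: "joint a"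
    and S: "\<And>k::nat. simple_integrand M F T (n k) (\<tau> k) (\<eta> k)"
    and lim: "(\<lambda>k. process_dist (simple_process (n k) (\<tau> k) (\<eta> k)) a) \<longlonglongrightarrow> 0"
  shows "(\<lambda>k. mean_square_dist (simple_integral B (n k) (\<tau> k) (\<eta> k)) Y) \<longlonglongrightarrow> 0"
proof (rule ennreal_tendsto_0I)
  fix e :: real assume "0 < e"
  obtain m \<sigma> \<zeta> where R: "\<And>k::nat. simple_integrand M F T (m k) (\<sigma> k) (\<zeta> k)"
    and R1: "(\<lambda>k. process_dist (simple_process (m k) (\<sigma> k) (\<zeta> k)) a) \<longlonglongrightarrow> 0"
    and R2: "(\<lambda>k. mean_square_dist (simple_integral B (m k) (\<sigma> k) (\<zeta> k)) Y) \<longlonglongrightarrow> 0"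
    and [measurable]: "Y \<in> borel_measurable M"
    using Y unfolding is_ito_integral_iff by auto
  have e: "0 < ennreal (e / 10)" using \<open>0 < e\<close> by simp
  from eventually_conj[OF order_tendstoD(2)[OF R1 e] order_tendstoD(2)[OF R2 e]]
  obtain l where l: "process_dist (simple_process (m l) (\<sigma> l) (\<zeta> l)) a < ennreal (e / 10)"
    "mean_square_dist (simple_integral B (m l) (\<sigma> l) (\<zeta> l)) Y < ennreal (e / 10)"
    by (auto simp: eventually_sequentially)
  show "\<forall>\<^sub>F k in sequentially. mean_square_dist (simple_integral B (n k) (\<tau> k) (\<eta> k)) Y \<le> ennreal e"
    using order_tendstoD(2)[OF lim e]
  proof eventually_elim
    case (elim k)
    let ?I = "simple_integral B (n k) (\<tau> k) (\<eta> k)" and ?J = "simple_integral B (m l) (\<sigma> l) (\<zeta> l)"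
    note [measurable] = simple_integral_measurable[OF S] simple_integral_measurable[OF R]
    have "mean_square_dist ?I ?J
        = process_dist (simple_process (n k) (\<tau> k) (\<eta> k)) (simple_process (m l) (\<sigma> l) (\<zeta> l))"
      by (rule simple_isometry[OF S R])
    also have "\<dots> \<le> 2 * process_dist (simple_process (n k) (\<tau> k) (\<eta> k)) a
        + 2 * process_dist (simple_process (m l) (\<sigma> l) (\<zeta> l)) a"
      by (intro process_square_diff_le joint_simple[OF S] joint_simple[OF R] a)
    also have "\<dots> \<le> 2 * ennreal (e / 10) + 2 * ennreal (e / 10)"
      using elim l by (intro add_mono mult_left_mono less_imp_le) auto
    finally have IJ: "mean_square_dist ?I ?J \<le> 2 * ennreal (e / 10) + 2 * ennreal (e / 10)" .
    have "mean_square_dist ?I Y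
        \<le> 2 * mean_square_dist ?I ?J + 2 * mean_square_dist ?J Y"
      using mean_square_add_le[of "\<lambda>\<omega>. ?I \<omega> - ?J \<omega>" "\<lambda>\<omega>. ?J \<omega> - Y \<omega>"] by simp
    also have "\<dots> \<le> 2 * (2 * ennreal (e / 10) + 2 * ennreal (e / 10)) + 2 * ennreal (e / 10)"
      using IJ l by (intro add_mono mult_left_mono less_imp_le[OF l(2)]) auto
    also have "\<dots> = ennreal e" using \<open>0 < e\<close> by (simp flip: ennreal_plus ennreal_numeral ennreal_mult)
    finally show ?case .
  qed
qed

text \<open>A sequence approximating \<open>b\<close> also approximates \<open>a\<close>, since
  their distance is 0, and mean square limits are almost surely unique.\<close>

lemma ito_unique:
  assumes Y: "is_ito_integral M F B T a Y" and Z: "is_ito_integral M F B T b Z"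
    and j: "joint a" "joint b" and eq: "AE \<omega> in M. sq_norm T (\<lambda>s. a s \<omega> - b s \<omega>) = 0"
  shows "AE \<omega> in M. Y \<omega> = Z \<omega>"
proof -
  obtain m \<sigma> \<zeta> where R: "\<And>k::nat. simple_integrand M F T (m k) (\<sigma> k) (\<zeta> k)"
    and R1: "(\<lambda>k. process_dist (simple_process (m k) (\<sigma> k) (\<zeta> k)) b) \<longlonglongrightarrow> 0"
    and R2: "(\<lambda>k. mean_square_dist (simple_integral B (m k) (\<sigma> k) (\<zeta> k)) Z) \<longlonglongrightarrow> 0"
    and Zm: "Z \<in> borel_measurable M"
    using Z unfolding is_ito_integral_iff by auto
  have Ym: "Y \<in> borel_measurable M" using Y unfolding is_ito_integral_iff by auto
  have ab: "process_dist a b = 0"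
    using nn_integral_0_iff_AE[OF joint_sq_norm_measurable[OF joint_diff[OF j]]] eq by simp
  have "(\<lambda>k. process_dist (simple_process (m k) (\<sigma> k) (\<zeta> k)) a) \<longlonglongrightarrow> 0"
  proof (rule tendsto_sandwich[OF _ _ tendsto_const])
    show "\<forall>\<^sub>F k in sequentially. process_dist (simple_process (m k) (\<sigma> k) (\<zeta> k)) a
        \<le> 2 * process_dist (simple_process (m k) (\<sigma> k) (\<zeta> k)) b"
      using process_square_diff_le[OF joint_simple[OF R] j] by (intro always_eventually allI) (simp add: ab)
    show "(\<lambda>k. 2 * process_dist (simple_process (m k) (\<sigma> k) (\<zeta> k)) b) \<longlonglongrightarrow> 0"
      using ennreal_tendsto_cmult[OF _ R1, of 2] by simp
  qed auto
  from ito_approx[OF Y j(1) R this] R2 show ?thesis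
    by (intro mean_square_limit_unique[OF simple_integral_measurable[OF R] Ym Zm])
qed

lemma energy_le_lincomb:
  assumes a: "energy_le A a" and b: "energy_le C b"
  shows "energy_le (2 * (p\<^sup>2 * A) + 2 * (q\<^sup>2 * C)) (\<lambda>s \<omega>. p *\<^sub>R a s \<omega> + q *\<^sub>R b s \<omega>)"
  unfolding energy_le_def
proof (intro conjI)
  show "0 \<le> 2 * (p\<^sup>2 * A) + 2 * (q\<^sup>2 * C)" using energy_leD(1)[OF a] energy_leD(1)[OF b] by simp
  show "progressively_measurable F T (\<lambda>s \<omega>. p *\<^sub>R a s \<omega> + q *\<^sub>R b s \<omega>)"
    using energy_leD(2)[OF a] energy_leD(2)[OF b] unfolding progressively_measurable_def case_prod_beta'
    by (intro ballI borel_measurable_add borel_measurable_scaleR borel_measurable_const) auto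
  show "AE \<omega> in M. sq_norm T (\<lambda>s. p *\<^sub>R a s \<omega> + q *\<^sub>R b s \<omega>) \<le> ennreal (2 * (p\<^sup>2 * A) + 2 * (q\<^sup>2 * C))"
    using energy_leD(4)[OF a] energy_leD(4)[OF b] AE_space
  proof eventually_elim
    case (elim \<omega>)
    note j = energy_leD(3)[OF a] energy_leD(3)[OF b]
    have "sq_norm T (\<lambda>s. p *\<^sub>R a s \<omega> + q *\<^sub>R b s \<omega>)
        \<le> 2 * (ennreal (p\<^sup>2) * path_energy a \<omega>) + 2 * (ennreal (q\<^sup>2) * path_energy b \<omega>)"
      using joint_sq_norm_add_le[OF joint_scaleR[OF j(1)] joint_scaleR[OF j(2)] elim(3), of p q]
      by (simp add: joint_sq_norm_scaleR[OF j(1) elim(3)] joint_sq_norm_scaleR[OF j(2) elim(3)])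
    also have "\<dots> \<le> 2 * (ennreal (p\<^sup>2) * ennreal A) + 2 * (ennreal (q\<^sup>2) * ennreal C)"
      using elim by (intro add_mono mult_left_mono) auto
    also have "\<dots> = ennreal (2 * (p\<^sup>2 * A) + 2 * (q\<^sup>2 * C))"
      using energy_leD(1)[OF a] energy_leD(1)[OF b] by (simp add: ennreal_plus ennreal_mult)
    finally show ?case .
  qed
qed

text \<open>Delayed averages are linear in the process. On almost every path the energy bounds of
  \<open>a\<close>, \<open>b\<close> and the combination all hold, so none of the three truncations
  acts and the approximating integrals combine exactly.\<close>

lemma ito_lincomb:
  assumes a: "energy_le A a" and b: "energy_le C b"
    and Y: "is_ito_integral M F B T a Y" and Z: "is_ito_integral M F B T b Z"
  shows "is_ito_integral M F B T (\<lambda>s \<omega>. p *\<^sub>R a s \<omega> + q *\<^sub>R b s \<omega>) (\<lambda>\<omega>. p * Y \<omega> + q * Z \<omega>)"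
proof -
  let ?c = "\<lambda>s \<omega>. p *\<^sub>R a s \<omega> + q *\<^sub>R b s \<omega>" and ?E = "2 * (p\<^sup>2 * A) + 2 * (q\<^sup>2 * C)"
  note c = energy_le_lincomb[OF a b, of p q]
  have [measurable]: "Y \<in> borel_measurable M" "Z \<in> borel_measurable M"
    using Y Z by (auto simp: is_ito_integral_iff)
  note [measurable] = simple_integral_measurable[OF approx_simple_energy[OF a]] simple_integral_measurable[OF approx_simple_energy[OF b]]
    simple_integral_measurable[OF approx_simple_energy[OF c]]
  have lin: "AE \<omega> in M. approx_integral ?E ?c n \<omega> = p * approx_integral A a n \<omega> + q * approx_integral C b n \<omega>" for n
    using energy_leD(4)[OF a] energy_leD(4)[OF b] energy_leD(4)[OF c] AE_space
  proof eventually_elim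
    case (elim \<omega>)
    let ?f = "cut a \<omega>" and ?g = "cut b \<omega>"
    have L2: "L2 T ?f" "L2 T ?g"
      using joint_L2[OF energy_leD(3)[OF a] elim(4) elim(1)] joint_L2[OF energy_leD(3)[OF b] elim(4) elim(2)] by auto
    have fg: "indicat_real {0..T} s *\<^sub>R ?c s \<omega> = p *\<^sub>R ?f s + q *\<^sub>R ?g s" for s
      by (simp add: scaleR_add_right mult.commute)
    have "approx_coeff ?E ?c n i \<omega> = p *\<^sub>R approx_coeff A a n i \<omega> + q *\<^sub>R approx_coeff C b n i \<omega>" if "i < Suc n" for i
      unfolding approx_coeff_eq[OF energy_leD(3)[OF a] elim(4) elim(1) energy_leD(1)[OF a] less_imp_le[OF that]]
        approx_coeff_eq[OF energy_leD(3)[OF b] elim(4) elim(2) energy_leD(1)[OF b] less_imp_le[OF that]]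
        approx_coeff_eq[OF energy_leD(3)[OF c] elim(4) elim(3) energy_leD(1)[OF c] less_imp_le[OF that]]
        fg step_coeff_add[OF T_pos L2_scaleR[OF L2(1)] L2_scaleR[OF L2(2)] that[unfolded less_Suc_eq_le]] step_coeff_scaleR ..
    then show ?case
      unfolding simple_integral_def sum_distrib_left sum.distrib[symmetric]
      by (intro sum.cong refl) (simp add: inner_add_left)
  qed
  have "(\<lambda>n. mean_square_dist (approx_integral ?E ?c n) (\<lambda>\<omega>. p * Y \<omega> + q * Z \<omega>)) \<longlonglongrightarrow> 0"
  proof (rule tendsto_sandwich[OF _ _ tendsto_const])
    let ?u = "\<lambda>n. 2 * (ennreal (p\<^sup>2) * mean_square_dist (approx_integral A a n) Y)
        + 2 * (ennreal (q\<^sup>2) * mean_square_dist (approx_integral C b n) Z)"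
    show "\<forall>\<^sub>F n in sequentially. mean_square_dist (approx_integral ?E ?c n) (\<lambda>\<omega>. p * Y \<omega> + q * Z \<omega>) \<le> ?u n"
    proof (intro always_eventually allI)
      fix n
      have "mean_square_dist (approx_integral ?E ?c n) (\<lambda>\<omega>. p * Y \<omega> + q * Z \<omega>)
          = (\<integral>\<^sup>+\<omega>. ennreal ((p * (approx_integral A a n \<omega> - Y \<omega>) + q * (approx_integral C b n \<omega> - Z \<omega>))\<^sup>2) \<partial>M)"
        using lin[of n] by (intro nn_integral_cong_AE, eventually_elim) (simp add: algebra_simps)
      also have "\<dots> \<le> ?u n"
        using mean_square_add_le[of "\<lambda>\<omega>. p * (approx_integral A a n \<omega> - Y \<omega>)" "\<lambda>\<omega>. q * (approx_integral C b n \<omega> - Z \<omega>)"]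
        by (simp add: power_mult_distrib ennreal_mult nn_integral_cmult)
      finally show "mean_square_dist (approx_integral ?E ?c n) (\<lambda>\<omega>. p * Y \<omega> + q * Z \<omega>) \<le> ?u n" .
    qed
    have "?u \<longlonglongrightarrow> 2 * (ennreal (p\<^sup>2) * 0) + 2 * (ennreal (q\<^sup>2) * 0)"
      by (intro tendsto_add ennreal_tendsto_cmult ito_approx[OF Y energy_leD(3)[OF a] approx_simple_energy[OF a] approx_converges[OF a]]
          ito_approx[OF Z energy_leD(3)[OF b] approx_simple_energy[OF b] approx_converges[OF b]]) auto
    then show "?u \<longlonglongrightarrow> 0" by simp
  qed auto
  then show ?thesis
    unfolding is_ito_integral_iff using approx_simple_energy[OF c] approx_converges[OF c]
    by (intro conjI exI[of _ Suc] exI[of _ "grid T"] exI[of _ "approx_coeff ?E ?c"]) auto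
qed

end

section \<open>Stochastic exponentials\<close>

context brownian
begin

lemma simple_integrand_SucD:
  assumes "simple_integrand M F T (Suc n) \<tau> \<eta>"
  shows "simple_integrand M F T n \<tau> \<eta>"
  using assms by (auto simp: simple_integrand_def intro: order_trans)

definition simple_energy :: "nat \<Rightarrow> (nat \<Rightarrow> real) \<Rightarrow> (nat \<Rightarrow> 'a \<Rightarrow> real ^ 'd) \<Rightarrow> 'a \<Rightarrow> real" where
  "simple_energy n \<tau> \<eta> \<omega> = (\<Sum>i<n. (norm (\<eta> i \<omega>))\<^sup>2 * (\<tau> (Suc i) - \<tau> i))"

lemma simple_integral_adapted:
  assumes S: "simple_integrand M F T n \<tau> \<eta>"
  shows "simple_integral B n \<tau> \<eta> \<in> borel_measurable (F (\<tau> n))"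
    and "simple_energy n \<tau> \<eta> \<in> borel_measurable (F (\<tau> n))"
proof -
  have T: "\<tau> n \<le> T" using S by (simp add: simple_integrand_def)
  have 1: "piece (\<tau> i) (\<tau> (Suc i)) (\<eta> i) \<in> borel_measurable (F (\<tau> n))" if "i < n" for i
    using simple_integrandD[OF S that] simple_integrand_mono[OF S, of "Suc i" n] that T
    by (intro filt_mono[OF _ _ _ piece_adapted[of "\<tau> i" "\<tau> (Suc i)" "\<eta> i"]]) auto
  have 2: "\<eta> i \<in> borel_measurable (F (\<tau> n))" if "i < n" for i
    using simple_integrandD[OF S that] simple_integrand_mono[OF S, of i n] that T
    by (intro filt_mono[of "\<tau> i" "\<tau> n"]) (auto simp: adapted_coeff_def)
  have "(\<lambda>\<omega>. \<Sum>i<n. piece (\<tau> i) (\<tau> (Suc i)) (\<eta> i) \<omega>) \<in> borel_measurable (F (\<tau> n))"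
    by (intro borel_measurable_sum 1) auto
  then show "simple_integral B n \<tau> \<eta> \<in> borel_measurable (F (\<tau> n))"
    by (simp add: simple_integral_def[abs_def] piece_def)
  show "simple_energy n \<tau> \<eta> \<in> borel_measurable (F (\<tau> n))"
    unfolding simple_energy_def[abs_def]
    by (intro borel_measurable_sum borel_measurable_times borel_measurable_power measurable_compose[OF 2 borel_measurable_norm]) auto
qed

abbreviation simple_exponential :: "nat \<Rightarrow> (nat \<Rightarrow> real) \<Rightarrow> (nat \<Rightarrow> 'a \<Rightarrow> real ^ 'd) \<Rightarrow> 'a \<Rightarrow> real" where
  "simple_exponential n \<tau> \<eta> \<omega> \<equiv> exp (simple_integral B n \<tau> \<eta> \<omega> - simple_energy n \<tau> \<eta> \<omega> / 2)"

text \<open>The exponential over the earlier intervals is known at \<open>\<tau> n\<close>, so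
  \<open>exp_increment\<close> integrates out the last factor.\<close>

lemma simple_exp:
  assumes "simple_integrand M F T n \<tau> \<eta>"
  shows "(\<integral>\<^sup>+\<omega>. ennreal (simple_exponential n \<tau> \<eta> \<omega>) \<partial>M) = 1"
  using assms
proof (induction n)
  case 0
  then show ?case by (simp add: simple_integral_def simple_energy_def emeasure_space_1)
next
  case (Suc n)
  note S = simple_integrand_SucD[OF Suc.prems] and D = simple_integrandD[OF Suc.prems lessI]
  let ?Z = "\<lambda>\<omega>. ennreal (simple_exponential n \<tau> \<eta> \<omega>)"
  note [measurable] = simple_integral_adapted[OF S]
  have "(\<integral>\<^sup>+\<omega>. ennreal (simple_exponential (Suc n) \<tau> \<eta> \<omega>) \<partial>M)
    = (\<integral>\<^sup>+\<omega>. ?Z \<omega> * ennreal (exp (\<eta> n \<omega> \<bullet> (B (\<tau> (Suc n)) \<omega> - B (\<tau> n) \<omega>)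
        - (norm (\<eta> n \<omega>))\<^sup>2 * (\<tau> (Suc n) - \<tau> n) / 2)) \<partial>M)"
  proof (intro nn_integral_cong)
    fix \<omega>
    have "simple_integral B (Suc n) \<tau> \<eta> \<omega> - simple_energy (Suc n) \<tau> \<eta> \<omega> / 2
      = (simple_integral B n \<tau> \<eta> \<omega> - simple_energy n \<tau> \<eta> \<omega> / 2) + (\<eta> n \<omega> \<bullet> (B (\<tau> (Suc n)) \<omega> - B (\<tau> n) \<omega>)
        - (norm (\<eta> n \<omega>))\<^sup>2 * (\<tau> (Suc n) - \<tau> n) / 2)"
      by (simp add: simple_integral_def simple_energy_def add_divide_distrib)
    then show "ennreal (simple_exponential (Suc n) \<tau> \<eta> \<omega>)
      = ?Z \<omega> * ennreal (exp (\<eta> n \<omega> \<bullet> (B (\<tau> (Suc n)) \<omega> - B (\<tau> n) \<omega>)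
        - (norm (\<eta> n \<omega>))\<^sup>2 * (\<tau> (Suc n) - \<tau> n) / 2))"
      by (simp add: exp_add ennreal_mult)
  qed
  also have "\<dots> = (\<integral>\<^sup>+\<omega>. ?Z \<omega> \<partial>M)"
    using D by (intro exp_increment) (auto simp: adapted_coeff_def)
  also have "\<dots> = 1" by (rule Suc.IH[OF S])
  finally show ?case .
qed

lemma sq_norm_simple_process:
  assumes S: "simple_integrand M F T n \<tau> \<eta>"
  shows "sq_norm T (\<lambda>s. simple_process n \<tau> \<eta> s \<omega>) = ennreal (simple_energy n \<tau> \<eta> \<omega>)"
    and "0 \<le> simple_energy n \<tau> \<eta> \<omega>"
proof -
  let ?I = "\<lambda>i. {\<tau> i<..\<tau> (Suc i)}"
  have "(norm (simple_process n \<tau> \<eta> s \<omega>))\<^sup>2 = (\<Sum>i<n. indicat_real (?I i) s *\<^sub>R (norm (\<eta> i \<omega>))\<^sup>2)" for s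
    unfolding simple_process_def
    by (rule sum_intervals_apply[where g="\<lambda>x. (norm x)\<^sup>2"]) (auto intro: simple_integrandD[OF S])
  then have norm: "ennreal ((norm (simple_process n \<tau> \<eta> s \<omega>))\<^sup>2)
      = (\<Sum>i<n. ennreal ((norm (\<eta> i \<omega>))\<^sup>2) * indicator (?I i) s)" for s
    by (simp add: ennreal_mult ennreal_indicator mult.commute flip: sum_ennreal)
  have sub: "indicator (?I i) s * indicator {0..T} s = (indicator (?I i) s :: ennreal)" if "i < n" for i s
    using simple_integrandD[OF S that] by (auto simp: indicator_def)
  have cut: "ennreal ((norm (simple_process n \<tau> \<eta> s \<omega>))\<^sup>2) * indicator {0..T} s
      = (\<Sum>i<n. ennreal ((norm (\<eta> i \<omega>))\<^sup>2) * indicator (?I i) s)" for s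
    unfolding norm sum_distrib_right by (intro sum.cong refl) (simp add: mult.assoc sub)
  have "sq_norm T (\<lambda>s. simple_process n \<tau> \<eta> s \<omega>) = (\<Sum>i<n. \<integral>\<^sup>+s. ennreal ((norm (\<eta> i \<omega>))\<^sup>2) * indicator (?I i) s \<partial>lborel)"
    unfolding sq_norm_def cut by (intro nn_integral_sum) auto
  also have "\<dots> = (\<Sum>i<n. ennreal ((norm (\<eta> i \<omega>))\<^sup>2 * (\<tau> (Suc i) - \<tau> i)))"
    using simple_integrandD[OF S] by (intro sum.cong refl) (simp add: nn_integral_cmult_indicator ennreal_mult)
  also have "\<dots> = ennreal (simple_energy n \<tau> \<eta> \<omega>)"
    using simple_integrandD[OF S] unfolding simple_energy_def by (intro sum_ennreal) auto
  finally show "sq_norm T (\<lambda>s. simple_process n \<tau> \<eta> s \<omega>) = ennreal (simple_energy n \<tau> \<eta> \<omega>)" .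
  show "0 \<le> simple_energy n \<tau> \<eta> \<omega>"
    using simple_integrandD[OF S] unfolding simple_energy_def by (intro sum_nonneg) auto
qed

text \<open>Doubling the coefficients quadruples the energy. Hence the square of the exponential is
  the exponential for the doubled coefficients, which has mean one, times \<open>exp\<close> of the
  energy.\<close>

lemma simple_exp_square_le:
  assumes S: "simple_integrand M F T n \<tau> \<eta>" and A: "AE \<omega> in M. simple_energy n \<tau> \<eta> \<omega> \<le> A"
  shows "(\<integral>\<^sup>+\<omega>. ennreal ((simple_exponential n \<tau> \<eta> \<omega>)\<^sup>2) \<partial>M) \<le> ennreal (exp A)"
proof -
  let ?\<zeta> = "\<lambda>i \<omega>. 2 *\<^sub>R \<eta> i \<omega>"
  have S2: "simple_integrand M F T n \<tau> ?\<zeta>"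
    unfolding simple_integrand_def
  proof (intro conjI allI impI)
    fix i assume "i < n"
    then obtain C where "\<eta> i \<in> borel_measurable (F (\<tau> i))" "\<forall>\<omega>\<in>space M. norm (\<eta> i \<omega>) \<le> C"
      using S unfolding simple_integrand_def by blast
    then show "?\<zeta> i \<in> borel_measurable (F (\<tau> i))" "\<exists>C. \<forall>\<omega>\<in>space M. norm (?\<zeta> i \<omega>) \<le> C"
      by (auto intro!: exI[of _ "2 * C"])
  qed (use S in \<open>auto simp: simple_integrand_def\<close>)
  have 2: "simple_integral B n \<tau> ?\<zeta> \<omega> = 2 * simple_integral B n \<tau> \<eta> \<omega>" "simple_energy n \<tau> ?\<zeta> \<omega> = 4 * simple_energy n \<tau> \<eta> \<omega>" for \<omega>
    by (simp_all add: simple_integral_def simple_energy_def sum_distrib_left power_mult_distrib mult.assoc)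
  let ?Z = "\<lambda>\<omega>. simple_exponential n \<tau> ?\<zeta> \<omega>"
  have [measurable]: "?Z \<in> borel_measurable M"
  proof -
    have "0 \<le> \<tau> n" "\<tau> n \<le> T"
      using S2 simple_integrand_mono[OF S2, of 0 n] by (auto simp: simple_integrand_def)
    note [measurable] = simple_integral_adapted[OF S2, THEN filt_measurable[OF this]]
    show ?thesis by measurable
  qed
  have "(\<integral>\<^sup>+\<omega>. ennreal ((simple_exponential n \<tau> \<eta> \<omega>)\<^sup>2) \<partial>M)
      \<le> (\<integral>\<^sup>+\<omega>. ennreal (exp A) * ennreal (?Z \<omega>) \<partial>M)"
    using A
  proof (intro nn_integral_mono_AE, eventually_elim)
    fix \<omega> assume "simple_energy n \<tau> \<eta> \<omega> \<le> A"
    then have "(simple_exponential n \<tau> \<eta> \<omega>)\<^sup>2 \<le> exp A * ?Z \<omega>"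
      by (simp add: 2 power2_eq_square exp_add[symmetric])
    then show "ennreal ((simple_exponential n \<tau> \<eta> \<omega>)\<^sup>2) \<le> ennreal (exp A) * ennreal (?Z \<omega>)"
      by (simp add: ennreal_leI flip: ennreal_mult)
  qed
  also have "\<dots> = ennreal (exp A)"
    using simple_exp[OF S2] by (simp add: nn_integral_cmult)
  finally show ?thesis .
qed

text \<open>The squared differences converge to 0 in L1 once they are integrable; the shift by
  \<open>N\<close> discards the terms that might not be.\<close>

lemma mean_square_AE_subseq:
  fixes S :: "nat \<Rightarrow> 'a \<Rightarrow> real"
  assumes [measurable]: "\<And>n. S n \<in> borel_measurable M" "Y \<in> borel_measurable M"
    and lim: "(\<lambda>n. mean_square_dist (S n) Y) \<longlonglongrightarrow> 0"
  shows "\<exists>r::nat \<Rightarrow> nat. strict_mono r \<and> (AE \<omega> in M. (\<lambda>n. S (r n) \<omega>) \<longlonglongrightarrow> Y \<omega>)"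
proof -
  from order_tendstoD(2)[OF lim, of 1]
  obtain N where N: "\<And>n. n \<ge> N \<Longrightarrow> mean_square_dist (S n) Y < 1"
    by (auto simp: eventually_sequentially)
  let ?u = "\<lambda>n \<omega>. (S (n + N) \<omega> - Y \<omega>)\<^sup>2"
  have int: "integrable M (?u n)" for n
    using N[of "n + N"] by (intro integrableI_bounded) (auto intro: less_trans)
  have "(\<lambda>n. \<integral>\<omega>. norm (?u n \<omega>) \<partial>M) \<longlonglongrightarrow> 0"
  proof -
    have "(\<lambda>n. enn2real (\<integral>\<^sup>+\<omega>. ennreal (?u n \<omega>) \<partial>M)) \<longlonglongrightarrow> 0"
      using LIMSEQ_ignore_initial_segment[OF lim, of N] by (intro tendsto_enn2real) simp_all
    then show ?thesis
      by (simp add: integral_eq_nn_integral)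
  qed
  from tendsto_L1_AE_subseq[OF int this] obtain r where r: "strict_mono r"
    and AE: "AE \<omega> in M. (\<lambda>n. ?u (r n) \<omega>) \<longlonglongrightarrow> 0" by blast
  show ?thesis
  proof (intro exI[of _ "\<lambda>n. r n + N"] conjI)
    show "strict_mono (\<lambda>n. r n + N)" using r by (simp add: strict_mono_def)
    show "AE \<omega> in M. (\<lambda>n. S (r n + N) \<omega>) \<longlonglongrightarrow> Y \<omega>"
      using AE
    proof eventually_elim
      case (elim \<omega>)
      then have "(\<lambda>n. S (r n + N) \<omega> - Y \<omega>) \<longlonglongrightarrow> 0"
        by (simp add: power_tendsto_0_iff)
      then show ?case by (rule LIM_zero_cancel)
    qed
  qed
qed

text \<open>The stochastic exponentials of the approximations have mean one and are bounded in \<open>L\<^sup>2\<close>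
  by \<open>e\<^sup>A\<close>, so they are uniformly integrable and the mean is preserved in the limit.\<close>

lemma exp_martingale:
  assumes a: "energy_le A a" and Y: "is_ito_integral M F B T a Y"
  shows "(\<integral>\<^sup>+\<omega>. ennreal (exp (Y \<omega> - enn2real (path_energy a \<omega>) / 2)) \<partial>M) = 1"
proof -
  note S = approx_simple_energy[OF a] and j = energy_leD(3)[OF a] and A = energy_leD(1)[OF a]
  let ?q = "\<lambda>n. simple_energy (Suc n) (grid T n) (approx_coeff A a n)"
  let ?S = "approx_integral A a"
  have [measurable]: "Y \<in> borel_measurable M" using Y by (simp add: is_ito_integral_iff)
  have Sm[measurable]: "?S n \<in> borel_measurable M" "?q n \<in> borel_measurable M" for n
    using simple_integral_adapted[OF S[of n]] T_pos filt_measurable[of T] by auto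
  obtain r where r: "strict_mono r" "AE \<omega> in M. (\<lambda>n. ?S (r n) \<omega>) \<longlonglongrightarrow> Y \<omega>"
    using mean_square_AE_subseq[OF Sm(1) _ ito_approx[OF Y j S approx_converges[OF a]]] by auto
  \<comment> \<open>Both facts hold on paths of energy at most \<open>A\<close>: averaging does not
    raise the energy, and L2 convergence of the paths gives convergence of their energies.\<close>
  have q: "AE \<omega> in M. (\<forall>n. ?q n \<omega> \<le> A) \<and> (\<lambda>n. ?q n \<omega>) \<longlonglongrightarrow> enn2real (path_energy a \<omega>)"
    using energy_leD(4)[OF a] AE_space
  proof eventually_elim
    case (elim \<omega>)
    note app = approx_converges_pathwise[OF j elim(2,1) A]
    let ?f = "cut a \<omega>"
    have eq: "sq_norm T (\<lambda>s. approx_process A a n s \<omega> - ?f s) = sq_norm T (\<lambda>s. approx_process A a n s \<omega> - a s \<omega>)" for n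
      by (rule sq_norm_cong) simp
    have m: "(\<lambda>s. approx_process A a n s \<omega>) \<in> borel_measurable borel" for n
      unfolding simple_process_def by measurable
    have fA: "sq_norm T ?f \<le> ennreal A" using elim(1) by (simp only: sq_norm_cut)
    have "(\<lambda>n. sq_norm T (\<lambda>s. approx_process A a n s \<omega> - ?f s)) \<longlonglongrightarrow> 0"
      unfolding eq by (rule app(1))
    from sq_norm_tendsto[OF joint_section[OF j elim(2)] m fA app(2) A this]
    have "(\<lambda>n. ?q n \<omega>) \<longlonglongrightarrow> enn2real (path_energy a \<omega>)"
      by (simp only: sq_norm_simple_process[OF S] sq_norm_cut enn2real_ennreal)
    moreover have "?q n \<omega> \<le> A" for n
      using app(2)[of n] A by (simp add: sq_norm_simple_process[OF S])
    ultimately show ?case by blast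
  qed
  show ?thesis
  proof (rule nn_integral_limit_L2_bounded)
    let ?Z = "\<lambda>n \<omega>. exp (?S (r n) \<omega> - ?q (r n) \<omega> / 2)"
    show "?Z n \<in> borel_measurable M" for n by measurable
    have [measurable]: "(\<lambda>\<omega>. path_energy a \<omega>) \<in> borel_measurable M"
      by (rule joint_sq_norm_measurable[OF j])
    show "(\<lambda>\<omega>. exp (Y \<omega> - enn2real (path_energy a \<omega>) / 2)) \<in> borel_measurable M" by measurable
    show "AE \<omega> in M. (\<lambda>n. ?Z n \<omega>) \<longlonglongrightarrow> exp (Y \<omega> - enn2real (path_energy a \<omega>) / 2)"
      using r(2) q
    proof eventually_elim
      case (elim \<omega>)
      then have "(\<lambda>n. ?q (r n) \<omega>) \<longlonglongrightarrow> enn2real (path_energy a \<omega>)"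
        using LIMSEQ_subseq_LIMSEQ[OF _ r(1), of "\<lambda>n. ?q n \<omega>"] by (simp add: comp_def)
      with elim show ?case by (intro tendsto_exp tendsto_diff tendsto_divide tendsto_const) auto
    qed
    show "(\<integral>\<^sup>+\<omega>. ennreal (?Z n \<omega>) \<partial>M) = 1" for n by (rule simple_exp[OF S])
    show "(\<integral>\<^sup>+\<omega>. ennreal ((?Z n \<omega>)\<^sup>2) \<partial>M) \<le> ennreal (exp A)" for n
      using q by (intro simple_exp_square_le[OF S]) (auto elim: eventually_mono)
  qed auto
qed

end

section \<open>Energies of combinations, radial matrices, augmented filtrations\<close>

lemma sq_norm_integral:
  fixes f :: "real \<Rightarrow> 'b::euclidean_space"
  assumes "L2 T f"
  shows "set_integrable lborel {0..T} (\<lambda>s. (norm (f s))\<^sup>2)"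
    and "enn2real (sq_norm T f) = (LBINT s:{0..T}. (norm (f s))\<^sup>2)"
proof -
  have [measurable]: "f \<in> borel_measurable borel" and fin: "sq_norm T f < \<infinity>"
    using assms by (auto simp: L2_def)
  have eq: "ennreal (norm (indicat_real {0..T} s *\<^sub>R (norm (f s))\<^sup>2)) = ennreal ((norm (f s))\<^sup>2) * indicator {0..T} s" for s
    by (auto simp: indicator_def)
  show "set_integrable lborel {0..T} (\<lambda>s. (norm (f s))\<^sup>2)"
    unfolding set_integrable_def
    by (rule integrableI_bounded) (use fin in \<open>simp_all only: eq sq_norm_def, measurable\<close>)
  have "(LBINT s:{0..T}. (norm (f s))\<^sup>2) = enn2real (\<integral>\<^sup>+s. ennreal (indicat_real {0..T} s *\<^sub>R (norm (f s))\<^sup>2) \<partial>lborel)"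
    unfolding set_lebesgue_integral_def by (rule integral_eq_nn_integral) auto
  also have "(\<integral>\<^sup>+s. ennreal (indicat_real {0..T} s *\<^sub>R (norm (f s))\<^sup>2) \<partial>lborel) = sq_norm T f"
    unfolding sq_norm_def by (intro nn_integral_cong) (auto simp: indicator_def)
  finally show "enn2real (sq_norm T f) = (LBINT s:{0..T}. (norm (f s))\<^sup>2)" ..
qed

text \<open>Polarisation: the cross term is expressed through the energy of \<open>f + g\<close>, so
  that only energies occur on the right.\<close>

lemma sq_norm_lincomb:
  fixes f g :: "real \<Rightarrow> 'b::euclidean_space"
  assumes "L2 T f" "L2 T g"
  shows "enn2real (sq_norm T (\<lambda>s. p *\<^sub>R f s + q *\<^sub>R g s))
    = (p\<^sup>2 - p * q) * enn2real (sq_norm T f) + (q\<^sup>2 - p * q) * enn2real (sq_norm T g)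
      + p * q * enn2real (sq_norm T (\<lambda>s. f s + g s))"
proof -
  note int = sq_norm_integral(1)[OF assms(1)] sq_norm_integral(1)[OF assms(2)] sq_norm_integral(1)[OF L2_add[OF assms]]
  have "(norm (p *\<^sub>R u + q *\<^sub>R v))\<^sup>2
      = (p\<^sup>2 - p * q) * (norm u)\<^sup>2 + (q\<^sup>2 - p * q) * (norm v)\<^sup>2 + p * q * (norm (u + v))\<^sup>2" for u v :: 'b
    unfolding power2_norm_eq_inner
    by (simp add: inner_add_left inner_add_right inner_commute algebra_simps power2_eq_square)
  then show ?thesis
    using int unfolding sq_norm_integral(2)[OF L2_add[OF L2_scaleR[OF assms(1)] L2_scaleR[OF assms(2)]]]
      sq_norm_integral(2)[OF assms(1)] sq_norm_integral(2)[OF assms(2)] sq_norm_integral(2)[OF L2_add[OF assms]]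
    by (simp add: set_integral_add set_integral_mult_right set_integrable_mult_right)
qed

text \<open>\<open>matrix_inv\<close> chooses some two-sided inverse; associativity forces it to be
  the evident one.\<close>

lemma matrix_inv_scaleR_mat:
  assumes "\<kappa> \<noteq> 0"
  shows "matrix_inv (\<kappa> *\<^sub>R mat 1 :: real ^ 'd ^ 'd) = (1 / \<kappa>) *\<^sub>R mat 1"
proof -
  let ?A = "\<kappa> *\<^sub>R mat 1 :: real ^ 'd ^ 'd" and ?B = "(1 / \<kappa>) *\<^sub>R mat 1 :: real ^ 'd ^ 'd"
  have AB: "?A ** ?B = mat 1" "?B ** ?A = mat 1"
    using assms by (simp_all add: matrix_scalar_ac scalar_matrix_assoc[symmetric] flip: scalar_mult_eq_scaleR)
  have "?A ** matrix_inv ?A = mat 1 \<and> matrix_inv ?A ** ?A = mat 1"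
    unfolding matrix_inv_def by (rule someI[of _ ?B]) (use AB in simp)
  then have "matrix_inv ?A = (?B ** ?A) ** matrix_inv ?A" using AB by simp
  also have "\<dots> = ?B" using \<open>_ \<and> _\<close> by (simp flip: matrix_mul_assoc)
  finally show ?thesis .
qed

lemma fstar_radial:
  assumes "\<kappa> \<noteq> 0"
  shows "fstar \<gamma>A (\<kappa> *\<^sub>R mat 1) z = (\<gamma>A - 1 / \<kappa>) / 2 * (norm z)\<^sup>2"
  unfolding fstar_def matrix_inv_scaleR_mat[OF assms]
  by (simp add: power2_norm_eq_inner flip: scaleR_matrix_vector_assoc scaleR_diff_left)

lemma reply_radial:
  assumes "\<kappa> \<noteq> 0"
  shows "reply (\<kappa> *\<^sub>R mat 1) \<beta> s \<omega> = (1 / \<kappa>) *\<^sub>R \<beta> s \<omega>"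
  unfolding reply_def matrix_inv_scaleR_mat[OF assms] by (simp flip: scaleR_matrix_vector_assoc)

text \<open>The positive part of a CARA utility vanishes, so the extended expectation is minus one
  nonnegative integral and never infinity minus infinity.\<close>

lemma extended_expectation_neg_exp:
  "extended_expectation N (\<lambda>\<omega>. - exp (h \<omega>)) = - enn2ereal (\<integral>\<^sup>+\<omega>. ennreal (exp (h \<omega>)) \<partial>N)"
  by (simp add: extended_expectation_def ennreal_neg zero_ennreal.rep_eq minus_ereal_def)

lemma
  fixes M X t
  defines "G \<equiv> augmented_filtration M X t"
    and "gen \<equiv> {X s -` A \<inter> space M | s A. s \<in> {0..t} \<and> A \<in> sets borel} \<union> null_sets (completion M)"
  shows sets_augmented_filtration: "sets G = sigma_sets (space M) gen"
    and space_augmented_filtration: "space G = space M"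
proof -
  have "gen \<subseteq> Pow (space M)"
    unfolding gen_def using sets.sets_into_space[of _ "completion M"] by (auto simp: null_sets_def)
  then show "sets G = sigma_sets (space M) gen" "space G = space M"
    unfolding G_def gen_def augmented_filtration_def by (auto simp: space_measure_of_conv)
qed

text \<open>Every subset of a null set belongs to the augmented sigma-algebra, so a change of
  \<open>h\<close> on a null set keeps measurability. This matters because the optimal contract is
  an affine function of the output only almost surely.\<close>

lemma borel_measurable_augmented_AE:
  fixes f h :: "'a \<Rightarrow> real"
  assumes h: "h \<in> borel_measurable (augmented_filtration M X t)"
    and [measurable]: "f \<in> borel_measurable M" "h \<in> borel_measurable M" and AE: "AE \<omega> in M. f \<omega> = h \<omega>"
  shows "f \<in> borel_measurable (augmented_filtration M X t)"
proof -
  let ?G = "augmented_filtration M X t"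
  define N where "N = {\<omega> \<in> space M. f \<omega> \<noteq> h \<omega>}"
  have "N \<in> null_sets M"
    unfolding N_def using AE by (subst AE_iff_null[symmetric]) auto
  then have null: "S \<in> sets ?G" if "S \<subseteq> N" for S
    using null_sets_completion_subset[OF that null_sets_completionI] unfolding sets_augmented_filtration
    by (intro sigma_sets.Basic) auto
  show ?thesis
  proof (rule measurableI)
    fix A :: "real set" assume A: "A \<in> sets borel"
    have "f -` A \<inter> space ?G = ((h -` A \<inter> space ?G) - N) \<union> (f -` A \<inter> N)"
      by (auto simp: N_def space_augmented_filtration)
    also have "\<dots> \<in> sets ?G"
      using measurable_sets[OF h A] null[of N] null[of "f -` A \<inter> N"] by auto
    finally show "f -` A \<inter> space ?G \<in> sets ?G" .
  qed auto
qed

lemma borel_measurable_augmented: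
  assumes "s \<in> {0..t}"
  shows "X s \<in> borel_measurable (augmented_filtration M X t)"
proof (rule measurableI)
  let ?G = "augmented_filtration M X t"
  fix A :: "real set" assume "A \<in> sets borel"
  then show "X s -` A \<inter> space ?G \<in> sets ?G"
    unfolding sets_augmented_filtration space_augmented_filtration using assms by (intro sigma_sets.Basic) auto
qed auto

section \<open>Admissible processes and their chosen integrals\<close>

context brownian
begin

definition energy :: "('a, 'd) process \<Rightarrow> 'a \<Rightarrow> real" where
  "energy a \<omega> = enn2real (path_energy a \<omega>)"

lemma energy_measurable: "joint a \<Longrightarrow> energy a \<in> borel_measurable M"
  unfolding energy_def[abs_def] by (intro measurable_compose[OF joint_sq_norm_measurable]) auto

lemma energy_lincomb:
  assumes "joint a" "joint b" "\<omega> \<in> space M"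
    and "path_energy a \<omega> \<le> ennreal A" "path_energy b \<omega> \<le> ennreal C"
  shows "energy (\<lambda>s \<omega>. p *\<^sub>R a s \<omega> + q *\<^sub>R b s \<omega>) \<omega>
    = (p\<^sup>2 - p * q) * energy a \<omega> + (q\<^sup>2 - p * q) * energy b \<omega> + p * q * energy (\<lambda>s \<omega>. a s \<omega> + b s \<omega>) \<omega>"
proof -
  let ?f = "cut a \<omega>" and ?g = "cut b \<omega>"
  have "L2 T ?f" "L2 T ?g" using assms by (auto intro: joint_L2)
  from sq_norm_lincomb[OF this, of p q]
  have "enn2real (sq_norm T (\<lambda>s. p *\<^sub>R ?f s + q *\<^sub>R ?g s))
    = (p\<^sup>2 - p * q) * energy a \<omega> + (q\<^sup>2 - p * q) * energy b \<omega> + p * q * enn2real (sq_norm T (\<lambda>s. ?f s + ?g s))"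
    by (simp only: energy_def sq_norm_cut)
  moreover have "sq_norm T (\<lambda>s. p *\<^sub>R ?f s + q *\<^sub>R ?g s) = sq_norm T (\<lambda>s. p *\<^sub>R a s \<omega> + q *\<^sub>R b s \<omega>)"
    "sq_norm T (\<lambda>s. ?f s + ?g s) = sq_norm T (\<lambda>s. a s \<omega> + b s \<omega>)"
    by (rule sq_norm_cong; simp)+
  ultimately show ?thesis by (simp add: energy_def)
qed

text \<open>On a path of infinite energy the Bochner integral and \<open>enn2real\<close> both take
  the default 0, so the identity holds on every path.\<close>

lemma set_integral_energy:
  assumes "joint a" "\<omega> \<in> space M"
  shows "(LBINT s:{0..T}. (norm (a s \<omega>))\<^sup>2) = energy a \<omega>"
proof -
  define f where "f s = indicat_real {0..T} s *\<^sub>R a s \<omega>" for s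
  have [measurable]: "f \<in> borel_measurable borel"
    unfolding f_def[abs_def] by (rule joint_section[OF assms])
  have eq: "indicat_real {0..T} s *\<^sub>R (norm (a s \<omega>))\<^sup>2 = (norm (f s))\<^sup>2" for s
    by (auto simp: indicator_def f_def)
  have "(LBINT s:{0..T}. (norm (a s \<omega>))\<^sup>2) = enn2real (\<integral>\<^sup>+s. ennreal ((norm (f s))\<^sup>2) \<partial>lborel)"
    unfolding set_lebesgue_integral_def eq by (rule integral_eq_nn_integral) auto
  also have "(\<integral>\<^sup>+s. ennreal ((norm (f s))\<^sup>2) \<partial>lborel) = path_energy a \<omega>"
    unfolding sq_norm_def by (intro nn_integral_cong) (auto simp: indicator_def f_def)
  finally show ?thesis by (simp add: energy_def)
qed

text \<open>Passing to \<open>A + 1\<close> turns the non-strict bound into the strict one, with a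
  positive constant, of \<open>admissible\<close>.\<close>

lemma admissible_iff: "a \<in> admissible M F T \<longleftrightarrow> (\<exists>A. energy_le A a)"
proof
  assume "a \<in> admissible M F T"
  then obtain A where "A > 0" "progressively_measurable F T a" "AE \<omega> in M. path_energy a \<omega> < ennreal A"
    by (auto simp: admissible_def sq_norm_def)
  then have "energy_le A a"
    unfolding energy_le_def by (auto elim!: eventually_mono)
  then show "\<exists>A. energy_le A a" ..
next
  assume "\<exists>A. energy_le A a"
  then obtain A where A: "0 \<le> A" "progressively_measurable F T a" "AE \<omega> in M. path_energy a \<omega> \<le> ennreal A"
    by (auto simp: energy_le_def)
  then have "AE \<omega> in M. path_energy a \<omega> < ennreal (A + 1)"
    by (auto elim!: eventually_mono intro: le_less_trans ennreal_lessI)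
  with A show "a \<in> admissible M F T"
    unfolding admissible_def sq_norm_def by (auto intro!: exI[of _ "A + 1"])
qed

abbreviation ito :: "('a, 'd) process \<Rightarrow> 'a \<Rightarrow> real" where
  "ito \<equiv> ito_integral M F B T"

lemma ito_spec: "energy_le A a \<Longrightarrow> is_ito_integral M F B T a (ito a)"
  unfolding ito_integral_def by (rule someI_ex[OF ito_exists])

lemma ito_measurable: "energy_le A a \<Longrightarrow> ito a \<in> borel_measurable M"
  using ito_spec by (auto simp: is_ito_integral_iff)

lemma energy_le_scaleR: "energy_le A a \<Longrightarrow> energy_le (2 * (p\<^sup>2 * A)) (\<lambda>s \<omega>. p *\<^sub>R a s \<omega>)"
  using energy_le_lincomb[of A a A a p 0] by simp

lemma ito_scaleR:
  assumes "energy_le A a"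
  shows "AE \<omega> in M. ito (\<lambda>s \<omega>. p *\<^sub>R a s \<omega>) \<omega> = p * ito a \<omega>"
proof (rule ito_unique)
  show "is_ito_integral M F B T (\<lambda>s \<omega>. p *\<^sub>R a s \<omega>) (\<lambda>\<omega>. p * ito a \<omega>)"
    using ito_lincomb[OF assms assms ito_spec[OF assms] ito_spec[OF assms], of p 0] by simp
qed (use energy_leD(3)[OF energy_le_scaleR[OF assms, of p]] ito_spec[OF energy_le_scaleR[OF assms, of p]]
  in \<open>auto simp: sq_norm_def\<close>)

lemma energy_scaleR:
  assumes "joint a" "\<omega> \<in> space M"
  shows "energy (\<lambda>s \<omega>. p *\<^sub>R a s \<omega>) \<omega> = p\<^sup>2 * energy a \<omega>"
  by (simp add: energy_def joint_sq_norm_scaleR[OF assms] enn2real_mult)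

end

section \<open>The radial principal-agent problem\<close>

locale volterra_agency = brownian M F T B
  for M :: "'a measure" and F T and B :: "('a, 'd::finite) process" +
  fixes g0 :: "real \<Rightarrow> real" and K :: "real \<Rightarrow> real \<Rightarrow> real ^ 'd" and \<gamma>P \<gamma>A \<kappa> :: real
  assumes kernel: "volterra_kernel T K" and \<gamma>P: "0 < \<gamma>P" and \<gamma>A: "0 < \<gamma>A" and \<kappa>: "0 < \<kappa>"
begin

definition kern :: "('a, 'd) process" where "kern s \<omega> = K T s"

definition share :: real where "share = (\<gamma>P + 1 / \<kappa>) / (\<gamma>A + \<gamma>P + 1 / \<kappa>)"

definition opt :: "('a, 'd) process" where "opt s \<omega> = share *\<^sub>R K T s"

abbreviation kernel_energy :: real where "kernel_energy \<equiv> enn2real (sq_norm T (K T))"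

lemma share_eq: "(\<gamma>A + \<gamma>P + 1 / \<kappa>) * share = \<gamma>P + 1 / \<kappa>"
  using \<gamma>P \<gamma>A \<kappa> by (simp add: share_def add_pos_pos less_imp_neq[symmetric])

text \<open>A deterministic process is progressive as soon as it is Borel in time, and the supremum
  over \<open>t\<close>, taken at \<open>t = T\<close>, bounds its energy.\<close>

lemma energy_le_kern: "energy_le kernel_energy kern"
proof -
  have K: "(\<lambda>(t, s). K t s) \<in> borel_measurable (restrict_space borel ({0..T} \<times> {0..T}))"
    using kernel by (simp add: volterra_kernel_def)
  have T: "(\<lambda>s. (T, s)) \<in> measurable (restrict_space borel {0..T}) (restrict_space borel ({0..T} \<times> {0..T}))"
    using T_pos by (intro measurable_restrict_space2 measurable_restrict_space1) (auto simp: space_restrict_space)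
  have KT: "K T \<in> borel_measurable (restrict_space borel {0..T})"
    using measurable_compose[OF T K] by simp
  have fin: "sq_norm T (K T) < \<infinity>"
  proof -
    have "sq_norm T (K T) \<le> (SUP t\<in>{0..T}. \<integral>\<^sup>+s\<in>{0..T}. ennreal ((norm (K t s))\<^sup>2) \<partial>lborel)"
      unfolding sq_norm_def using T_pos by (intro SUP_upper) simp
    also have "\<dots> < \<infinity>" using kernel by (simp add: volterra_kernel_def)
    finally show ?thesis .
  qed
  have "progressively_measurable F T kern"
    unfolding progressively_measurable_def
  proof
    fix t assume "t \<in> {0..T}"
    then have "K T \<in> borel_measurable (restrict_space borel {0..t})"
      by (intro measurable_restrict_mono[OF KT]) auto
    then show "(\<lambda>(s, \<omega>). kern s \<omega>) \<in> borel_measurable (restrict_space borel {0..t} \<Otimes>\<^sub>M F t)"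
      unfolding kern_def case_prod_beta' by (rule measurable_compose[OF measurable_fst])
  qed
  then show ?thesis
    using fin by (auto simp: energy_le_def kern_def)
qed

lemma energy_kern: "energy kern \<omega> = kernel_energy"
  by (simp add: energy_def kern_def)

lemma opt_kern: "opt = (\<lambda>s \<omega>. share *\<^sub>R kern s \<omega>)"
  by (simp add: opt_def kern_def fun_eq_iff)

lemma energy_le_opt: "energy_le (2 * (share\<^sup>2 * kernel_energy)) opt"
  unfolding opt_kern by (rule energy_le_scaleR[OF energy_le_kern])

lemma volterra_output_eq: "volterra_output M F B g0 K T \<omega> = g0 T + ito kern \<omega>"
  by (simp add: volterra_output_def kern_def[abs_def])

abbreviation radial_contract :: "real \<Rightarrow> ('a, 'd) process \<Rightarrow> 'a \<Rightarrow> real" where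
  "radial_contract \<equiv> contract M F B T \<gamma>A (\<kappa> *\<^sub>R mat 1)"

lemma contract_eq:
  assumes "joint \<beta>" "\<omega> \<in> space M"
  shows "radial_contract y \<beta> \<omega> = y + (\<gamma>A - 1 / \<kappa>) / 2 * energy \<beta> \<omega> + ito \<beta> \<omega>"
  using \<kappa> by (simp add: contract_def fstar_radial set_integral_mult_right set_integral_energy[OF assms])

lemma contract_measurable:
  assumes "energy_le A \<beta>"
  shows "radial_contract y \<beta> \<in> borel_measurable M"
proof -
  note [measurable] = ito_measurable[OF assms] energy_measurable[OF energy_leD(3)[OF assms]]
  have "(\<lambda>\<omega>. y + (\<gamma>A - 1 / \<kappa>) / 2 * energy \<beta> \<omega> + ito \<beta> \<omega>) \<in> borel_measurable M" by measurable
  then show ?thesis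
    by (subst measurable_cong[OF contract_eq[OF energy_leD(3)[OF assms]]])
qed

text \<open>Completing the square: under the reply \<open>\<beta> / \<kappa>\<close> the integrand of the principal's expected
  disutility is a stochastic exponential (of \<open>tilt \<beta>\<close>) times \<open>exp\<close> of a nonnegative multiple
  of the energy of \<open>gap \<beta>\<close>, which vanishes only at the optimum.\<close>

definition tilt :: "('a, 'd) process \<Rightarrow> ('a, 'd) process" where
  "tilt \<beta> = (\<lambda>s \<omega>. (\<gamma>P + 1 / \<kappa>) *\<^sub>R \<beta> s \<omega> + (- \<gamma>P) *\<^sub>R kern s \<omega>)"

definition gap :: "('a, 'd) process \<Rightarrow> ('a, 'd) process" where
  "gap \<beta> = (\<lambda>s \<omega>. 1 *\<^sub>R \<beta> s \<omega> + (- share) *\<^sub>R kern s \<omega>)"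

text \<open>Written with a combination of two chosen integrals and not with
  \<open>ito (tilt \<beta>)\<close>: the two agree only almost surely, the former is what the
  exponent produces, and \<open>exp_martingale\<close> accepts any version.\<close>

definition tilt_density :: "('a, 'd) process \<Rightarrow> 'a \<Rightarrow> real" where
  "tilt_density \<beta> \<omega> = exp ((\<gamma>P + 1 / \<kappa>) * ito \<beta> \<omega> + (- \<gamma>P) * ito kern \<omega> - energy (tilt \<beta>) \<omega> / 2)"

definition gap_factor :: "('a, 'd) process \<Rightarrow> 'a \<Rightarrow> real" where
  "gap_factor \<beta> \<omega> = exp (\<gamma>P * (\<gamma>A + \<gamma>P + 1 / \<kappa>) / 2 * energy (gap \<beta>) \<omega>)"

definition loss :: "('a, 'd) process \<Rightarrow> ennreal" where
  "loss \<beta> = (\<integral>\<^sup>+\<omega>. ennreal (tilt_density \<beta> \<omega>) * ennreal (gap_factor \<beta> \<omega>) \<partial>M)"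

text \<open>The constant that completing the square leaves over; minus this number turns out to be
  the value of the enlarged problem at \<open>y\<close>.\<close>

definition loss_scale :: "real \<Rightarrow> real" where
  "loss_scale y = exp (\<gamma>P * (y - g0 T) + \<gamma>P * (\<gamma>P - (\<gamma>P + 1 / \<kappa>) * share) / 2 * kernel_energy)"

text \<open>Here \<open>k\<close> stands for \<open>1 / \<kappa>\<close>, \<open>Ib\<close> and
  \<open>IK\<close> for the Ito integrals of \<open>\<beta>\<close> and the kernel, and
  \<open>eb\<close>, \<open>eK\<close>, \<open>es\<close> for the energies of
  \<open>\<beta>\<close>, the kernel and their sum. The three groups on the right are the logarithms
  of \<open>loss_scale\<close>, \<open>tilt_density\<close> and \<open>gap_factor\<close>, with the
  energies of tilt and gap in the shape that \<open>energy_lincomb\<close> produces.\<close>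

lemma exponent_identity:
  fixes D c p k eb eK es
  assumes "D * c = p" "p = \<gamma>P + k" "D = \<gamma>A + \<gamma>P + k"
  shows "(k * Ib - k\<^sup>2 * eb / 2) - \<gamma>P * (g + IK - (y + (\<gamma>A - k) / 2 * eb + Ib))
    = (\<gamma>P * (y - g) + \<gamma>P * (\<gamma>P - p * c) / 2 * eK)
      + (p * Ib + (- \<gamma>P) * IK - ((p\<^sup>2 - p * (- \<gamma>P)) * eb + ((- \<gamma>P)\<^sup>2 - p * (- \<gamma>P)) * eK + p * (- \<gamma>P) * es) / 2)
      + \<gamma>P * D / 2 * ((1\<^sup>2 - 1 * (- c)) * eb + ((- c)\<^sup>2 - 1 * (- c)) * eK + 1 * (- c) * es)"
proof -
  \<comment> \<open>Multiplying by \<open>D\<close> first lets every \<open>D * c\<close> become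
    \<open>p\<close>, so that no division by \<open>D\<close> enters the remaining
    arithmetic.\<close>
  have "D * ((1\<^sup>2 - 1 * (- c)) * eb + ((- c)\<^sup>2 - 1 * (- c)) * eK + 1 * (- c) * es)
      = (D + D * c) * eb + (D * c * c + D * c) * eK - D * c * es"
    by (simp add: algebra_simps power2_eq_square)
  also have "\<dots> = (D + p) * eb + (p * c + p) * eK - p * es"
    by (simp add: assms(1))
  finally have *: "\<gamma>P * D / 2 * ((1\<^sup>2 - 1 * (- c)) * eb + ((- c)\<^sup>2 - 1 * (- c)) * eK + 1 * (- c) * es)
      = \<gamma>P / 2 * ((D + p) * eb + (p * c + p) * eK - p * es)"
    by simp
  show ?thesis
    unfolding * unfolding assms(2,3) by (simp add: field_simps power2_eq_square)
qed

text \<open>The density moves the expectation back to \<open>M\<close>, where the exponent is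
  rearranged almost surely. The loss lives in \<open>ennreal\<close>, so a divergent loss
  corresponds to utility minus infinity.\<close>

lemma principal_utility_eq:
  assumes \<beta>: "energy_le A \<beta>"
  shows "principal_utility M F B T g0 K \<gamma>P \<gamma>A (\<kappa> *\<^sub>R mat 1) y \<beta> = - enn2ereal (ennreal (loss_scale y) * loss \<beta>)"
proof -
  let ?\<Gamma> = "\<kappa> *\<^sub>R mat 1 :: real ^ 'd ^ 'd" and ?k = "1 / \<kappa>"
  let ?dens = "\<lambda>\<omega>. exp (ito (reply ?\<Gamma> \<beta>) \<omega> - (LBINT s:{0..T}. (norm (reply ?\<Gamma> \<beta> s \<omega>))\<^sup>2) / 2)"
  let ?u = "\<lambda>\<omega>. exp (- \<gamma>P * (volterra_output M F B g0 K T \<omega> - contract M F B T \<gamma>A ?\<Gamma> y \<beta> \<omega>))"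
  have reply: "reply ?\<Gamma> \<beta> = (\<lambda>s \<omega>. ?k *\<^sub>R \<beta> s \<omega>)"
    using \<kappa> by (simp add: fun_eq_iff reply_radial)
  note r = energy_le_scaleR[OF \<beta>, of ?k, folded reply] and jb = energy_leD(3)[OF \<beta>] and jk = energy_leD(3)[OF energy_le_kern]
  note jr = energy_leD(3)[OF r]
  note [measurable] = ito_measurable[OF r] energy_measurable[OF jr] contract_measurable[OF \<beta>, of y]
    ito_measurable[OF energy_le_kern]
  have out[measurable]: "volterra_output M F B g0 K T \<in> borel_measurable M"
    unfolding volterra_output_eq[abs_def] by measurable
  have "(\<lambda>\<omega>. LBINT s:{0..T}. (norm (reply ?\<Gamma> \<beta> s \<omega>))\<^sup>2) \<in> borel_measurable M"
    by (subst measurable_cong[OF set_integral_energy[OF jr]]) measurable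
  then have dens[measurable]: "?dens \<in> borel_measurable M" by measurable
  have u[measurable]: "?u \<in> borel_measurable M" by measurable
  have tilt: "energy_le (2 * ((\<gamma>P + ?k)\<^sup>2 * A) + 2 * ((- \<gamma>P)\<^sup>2 * kernel_energy)) (tilt \<beta>)"
    and gap: "energy_le (2 * (1\<^sup>2 * A) + 2 * ((- share)\<^sup>2 * kernel_energy)) (gap \<beta>)"
    unfolding tilt_def gap_def by (rule energy_le_lincomb[OF \<beta> energy_le_kern])+
  note [measurable] = ito_measurable[OF \<beta>] energy_measurable[OF energy_leD(3)[OF tilt]] energy_measurable[OF energy_leD(3)[OF gap]]
  have "principal_utility M F B T g0 K \<gamma>P \<gamma>A ?\<Gamma> y \<beta>
    = - enn2ereal (\<integral>\<^sup>+\<omega>. ennreal (?u \<omega>) \<partial>density M (\<lambda>\<omega>. ennreal (?dens \<omega>)))"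
    unfolding principal_utility_def effort_measure_def cara_utility_def by (rule extended_expectation_neg_exp)
  also have "(\<integral>\<^sup>+\<omega>. ennreal (?u \<omega>) \<partial>density M (\<lambda>\<omega>. ennreal (?dens \<omega>))) = (\<integral>\<^sup>+\<omega>. ennreal (?dens \<omega>) * ennreal (?u \<omega>) \<partial>M)"
    using dens u by (intro nn_integral_density) auto
  also have "\<dots> = (\<integral>\<^sup>+\<omega>. ennreal (loss_scale y) * (ennreal (tilt_density \<beta> \<omega>) * ennreal (gap_factor \<beta> \<omega>)) \<partial>M)"
  proof (rule nn_integral_cong_AE)
    show "AE \<omega> in M. ennreal (?dens \<omega>) * ennreal (?u \<omega>)
        = ennreal (loss_scale y) * (ennreal (tilt_density \<beta> \<omega>) * ennreal (gap_factor \<beta> \<omega>))"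
      using ito_scaleR[OF \<beta>, of ?k, folded reply] energy_leD(4)[OF \<beta>] energy_leD(4)[OF energy_le_kern] AE_space
    proof eventually_elim
      case (elim \<omega>)
      have en: "(LBINT s:{0..T}. (norm (reply ?\<Gamma> \<beta> s \<omega>))\<^sup>2) = ?k\<^sup>2 * energy \<beta> \<omega>"
        unfolding set_integral_energy[OF jr elim(4)] unfolding reply by (rule energy_scaleR[OF jb elim(4)])
      note et = energy_lincomb[OF jb jk elim(4,2,3), of "\<gamma>P + ?k" "- \<gamma>P", folded tilt_def, unfolded energy_kern]
      note eg = energy_lincomb[OF jb jk elim(4,2,3), of 1 "- share", folded gap_def, unfolded energy_kern]
      have "?dens \<omega> * ?u \<omega> = loss_scale y * (tilt_density \<beta> \<omega> * gap_factor \<beta> \<omega>)"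
        unfolding loss_scale_def tilt_density_def gap_factor_def exp_add[symmetric] elim(1) en et eg
          contract_eq[OF jb elim(4)] volterra_output_eq
        using exponent_identity[OF share_eq refl refl, of "ito \<beta> \<omega>" "energy \<beta> \<omega>" "g0 T" "ito kern \<omega>" y
            kernel_energy "energy (\<lambda>s \<omega>. \<beta> s \<omega> + kern s \<omega>) \<omega>"]
        by (simp only: mult_minus_left diff_conv_add_uminus[symmetric] add.assoc)
      then show ?case
        by (simp add: loss_scale_def tilt_density_def gap_factor_def flip: ennreal_mult)
    qed
  qed
  also have "\<dots> = ennreal (loss_scale y) * loss \<beta>"
    unfolding loss_def
    by (rule nn_integral_cmult) (unfold tilt_density_def[abs_def] gap_factor_def[abs_def], measurable)
  finally show ?thesis .
qed

text \<open>\<open>gap_factor\<close> is at least 1 and \<open>tilt_density\<close> has mean one, so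
  the loss exceeds 1 by the mean of the density times \<open>gap_factor - 1\<close>. As the density
  is strictly positive, this excess vanishes only if the gap has zero energy almost surely.\<close>

lemma
  assumes \<beta>: "energy_le A \<beta>"
  shows loss_ge_1: "1 \<le> loss \<beta>"
    and loss_eq_1D: "loss \<beta> = 1 \<Longrightarrow> AE \<omega> in M. path_energy (gap \<beta>) \<omega> = 0"
    and loss_eq_1I: "(\<And>\<omega>. energy (gap \<beta>) \<omega> = 0) \<Longrightarrow> loss \<beta> = 1"
proof -
  note tilt = energy_le_lincomb[OF \<beta> energy_le_kern, of "\<gamma>P + 1 / \<kappa>" "- \<gamma>P", folded tilt_def]
  note gap = energy_le_lincomb[OF \<beta> energy_le_kern, of 1 "- share", folded gap_def]
  note [measurable] = ito_measurable[OF \<beta>] ito_measurable[OF energy_le_kern]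
    energy_measurable[OF energy_leD(3)[OF tilt]] energy_measurable[OF energy_leD(3)[OF gap]]
  have [measurable]: "tilt_density \<beta> \<in> borel_measurable M" "gap_factor \<beta> \<in> borel_measurable M"
    unfolding tilt_density_def[abs_def] gap_factor_def[abs_def] by measurable
  have one: "(\<integral>\<^sup>+\<omega>. ennreal (tilt_density \<beta> \<omega>) \<partial>M) = 1"
    unfolding tilt_density_def energy_def
    by (rule exp_martingale[OF tilt])
      (unfold tilt_def, rule ito_lincomb[OF \<beta> energy_le_kern ito_spec[OF \<beta>] ito_spec[OF energy_le_kern]])
  have D: "0 < \<gamma>P * (\<gamma>A + \<gamma>P + 1 / \<kappa>) / 2" using \<gamma>P \<gamma>A \<kappa> by (simp add: add_pos_pos)
  have fac: "1 \<le> gap_factor \<beta> \<omega>" for \<omega>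
    unfolding gap_factor_def using D by (intro one_le_exp_iff[THEN iffD2] mult_nonneg_nonneg) (auto simp: energy_def)
  have split: "loss \<beta> = 1 + (\<integral>\<^sup>+\<omega>. ennreal (tilt_density \<beta> \<omega>) * ennreal (gap_factor \<beta> \<omega> - 1) \<partial>M)"
  proof -
    have "ennreal (gap_factor \<beta> \<omega>) = 1 + ennreal (gap_factor \<beta> \<omega> - 1)" for \<omega>
      using fac[of \<omega>] by (simp flip: ennreal_1 ennreal_plus)
    then have "loss \<beta> = (\<integral>\<^sup>+\<omega>. ennreal (tilt_density \<beta> \<omega>) + ennreal (tilt_density \<beta> \<omega>) * ennreal (gap_factor \<beta> \<omega> - 1) \<partial>M)"
      unfolding loss_def by (intro nn_integral_cong) (simp add: distrib_left)
    then show ?thesis by (simp add: nn_integral_add one)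
  qed
  then show "1 \<le> loss \<beta>" by simp
  show "loss \<beta> = 1" if "\<And>\<omega>. energy (gap \<beta>) \<omega> = 0"
    unfolding loss_def gap_factor_def that by (simp add: one)
  assume "loss \<beta> = 1"
  with split have "(\<integral>\<^sup>+\<omega>. ennreal (tilt_density \<beta> \<omega>) * ennreal (gap_factor \<beta> \<omega> - 1) \<partial>M) = 0"
    by (metis add.right_neutral ennreal_add_left_cancel ennreal_one_neq_top infinity_ennreal_def)
  then have "AE \<omega> in M. ennreal (tilt_density \<beta> \<omega>) * ennreal (gap_factor \<beta> \<omega> - 1) = 0"
    by (subst (asm) nn_integral_0_iff_AE) auto
  then show "AE \<omega> in M. path_energy (gap \<beta>) \<omega> = 0"
    using energy_leD(4)[OF gap]
  proof eventually_elim
    case (elim \<omega>)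
    then have "gap_factor \<beta> \<omega> - 1 \<le> 0"
      by (simp add: tilt_density_def ennreal_eq_0_iff)
    then have "\<gamma>P * (\<gamma>A + \<gamma>P + 1 / \<kappa>) / 2 * energy (gap \<beta>) \<omega> \<le> \<gamma>P * (\<gamma>A + \<gamma>P + 1 / \<kappa>) / 2 * 0"
      by (simp only: gap_factor_def diff_le_0_iff_le exp_le_one_iff mult_zero_right)
    then have "energy (gap \<beta>) \<omega> \<le> 0"
      using D by (rule mult_left_le_imp_le)
    then have "enn2real (path_energy (gap \<beta>) \<omega>) = 0"
      using enn2real_nonneg[of "path_energy (gap \<beta>) \<omega>"] by (simp add: energy_def)
    \<comment> \<open>\<open>enn2real\<close> also sends infinity to 0; the energy bound excludes
      that case.\<close>
    moreover have "path_energy (gap \<beta>) \<omega> < top"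
      using elim(2) by (rule le_less_trans) simp
    ultimately show ?case
      by (auto simp: enn2real_eq_0_iff)
  qed
qed

lemma loss_opt: "loss opt = 1"
proof (rule loss_eq_1I[OF energy_le_opt])
  have "gap opt = (\<lambda>s \<omega>. 0)" by (simp add: gap_def opt_def kern_def fun_eq_iff)
  then show "energy (gap opt) \<omega> = 0" for \<omega> by (simp add: energy_def sq_norm_def)
qed

section \<open>Values and optimisers of both problems\<close>

abbreviation utility :: "real \<Rightarrow> ('a, 'd) process \<Rightarrow> ereal" where
  "utility \<equiv> principal_utility M F B T g0 K \<gamma>P \<gamma>A (\<kappa> *\<^sub>R mat 1)"

lemma loss_scale_pos: "0 < loss_scale y" by (simp add: loss_scale_def)

lemma loss_scale_mono: "y0 \<le> y \<Longrightarrow> loss_scale y0 \<le> loss_scale y" and loss_scale_strict: "y0 < y \<Longrightarrow> loss_scale y0 < loss_scale y"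
  using \<gamma>P by (auto simp: loss_scale_def)

lemma utility_opt: "utility y opt = - ereal (loss_scale y)"
  using loss_scale_pos[of y] by (simp add: principal_utility_eq[OF energy_le_opt] loss_opt enn2ereal_ennreal)

lemma utility_le:
  assumes "energy_le A \<beta>" "y0 \<le> y"
  shows "utility y \<beta> \<le> - ereal (loss_scale y0)"
proof -
  have "ennreal (loss_scale y0) * 1 \<le> ennreal (loss_scale y) * loss \<beta>"
    using loss_scale_mono[OF assms(2)] by (intro mult_mono loss_ge_1[OF assms(1)] ennreal_leI) auto
  then have "enn2ereal (ennreal (loss_scale y0)) \<le> enn2ereal (ennreal (loss_scale y) * loss \<beta>)"
    by (simp add: less_eq_ennreal.rep_eq)
  then show ?thesis
    unfolding principal_utility_eq[OF assms(1)] ereal_minus_le_minus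
    using loss_scale_pos[of y0] by (simp add: enn2ereal_ennreal)
qed

text \<open>The loss is at least 1 and its scale is strictly increasing in \<open>y\<close>, so
  attaining the bound forces equality in both factors.\<close>

lemma utility_eqD:
  assumes \<beta>: "energy_le A \<beta>" and "y0 \<le> y" and eq: "utility y \<beta> = - ereal (loss_scale y0)"
  shows "y = y0" "AE \<omega> in M. path_energy (gap \<beta>) \<omega> = 0"
proof -
  have "enn2ereal (ennreal (loss_scale y) * loss \<beta>) = enn2ereal (ennreal (loss_scale y0))"
    using eq loss_scale_pos[of y0] by (simp add: principal_utility_eq[OF \<beta>] enn2ereal_ennreal ereal_uminus_eq_reorder)
  then have e: "ennreal (loss_scale y) * loss \<beta> = ennreal (loss_scale y0)"
    by (simp add: enn2ereal_inject)
  have "ennreal (loss_scale y) * 1 \<le> ennreal (loss_scale y) * loss \<beta>"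
    by (intro mult_left_mono loss_ge_1[OF \<beta>]) simp
  then have "loss_scale y \<le> loss_scale y0" using e loss_scale_pos[of y0] by simp
  then show "y = y0" using loss_scale_strict[of y0 y] \<open>y0 \<le> y\<close> by (cases "y = y0") auto
  with e have "ennreal (loss_scale y0) * loss \<beta> = ennreal (loss_scale y0) * 1" by simp
  then have "loss \<beta> = 1"
    using loss_scale_pos[of y0] by (subst (asm) ennreal_mult_cancel_left) auto
  then show "AE \<omega> in M. path_energy (gap \<beta>) \<omega> = 0" by (rule loss_eq_1D[OF \<beta>])
qed

lemma V_SB_at_eq: "V_SB_at M F B T g0 K \<gamma>P \<gamma>A (\<kappa> *\<^sub>R mat 1) y = - ereal (loss_scale y)"
  unfolding V_SB_at_def
proof (rule antisym)
  show "(SUP \<beta>\<in>admissible M F T. utility y \<beta>) \<le> - ereal (loss_scale y)"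
    by (rule SUP_least) (auto simp: admissible_iff simp del: uminus_ereal.simps intro: utility_le)
  show "- ereal (loss_scale y) \<le> (SUP \<beta>\<in>admissible M F T. utility y \<beta>)"
    unfolding utility_opt[symmetric] using energy_le_opt by (intro SUP_upper) (auto simp: admissible_iff)
qed

lemma V_SB_eq: "V_SB M F B T g0 K \<gamma>P \<gamma>A (\<kappa> *\<^sub>R mat 1) y0 = - ereal (loss_scale y0)"
  unfolding V_SB_def V_SB_at_eq
proof (rule antisym)
  show "(SUP y\<in>{y0..}. - ereal (loss_scale y)) \<le> - ereal (loss_scale y0)"
    by (rule SUP_least) (auto intro: loss_scale_mono)
  show "- ereal (loss_scale y0) \<le> (SUP y\<in>{y0..}. - ereal (loss_scale y))"
    by (rule SUP_upper) simp
qed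

text \<open>The optimal integrand is a scalar multiple of the kernel, so its Ito integral is almost
  surely the same multiple of the output minus \<open>g0 T\<close>. This makes the contract affine
  in the output.\<close>

lemma contract_opt:
  "AE \<omega> in M. radial_contract y opt \<omega>
    = y + (\<gamma>A - 1 / \<kappa>) / 2 * energy opt \<omega> + share * (volterra_output M F B g0 K T \<omega> - g0 T)"
  using ito_scaleR[OF energy_le_kern, of share, folded opt_kern] AE_space
  by eventually_elim (simp add: contract_eq[OF energy_leD(3)[OF energy_le_opt]] volterra_output_eq)

lemma energy_opt: "energy opt \<omega> = enn2real (sq_norm T (\<lambda>s. share *\<^sub>R K T s))"
  by (simp add: energy_def opt_def)

lemma contract_opt_augmented:
  "radial_contract y opt \<in> borel_measurable (augmented_filtration M (volterra_output M F B g0 K) T)"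
proof (rule borel_measurable_augmented_AE[OF _ contract_measurable[OF energy_le_opt] _ contract_opt])
  let ?h = "\<lambda>\<omega>. y + (\<gamma>A - 1 / \<kappa>) / 2 * energy opt \<omega> + share * (volterra_output M F B g0 K T \<omega> - g0 T)"
  have m: "?h \<in> borel_measurable N" if "volterra_output M F B g0 K T \<in> borel_measurable N" for N
    using that unfolding energy_opt by measurable
  show "?h \<in> borel_measurable (augmented_filtration M (volterra_output M F B g0 K) T)"
    using T_pos by (intro m borel_measurable_augmented) auto
  show "?h \<in> borel_measurable M"
    using ito_measurable[OF energy_le_kern] by (intro m) (simp add: volterra_output_eq[abs_def])
qed

text \<open>The measurability constraint only shrinks the supremum, so the same upper bound applies,
  and the unconstrained optimum is feasible by \<open>contract_opt_augmented\<close>.\<close>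

lemma V_P_eq: "V_P M F B T g0 K \<gamma>P \<gamma>A (\<kappa> *\<^sub>R mat 1) y0 = - ereal (loss_scale y0)"
  unfolding V_P_def
proof (rule antisym, goal_cases)
  case 1
  show ?case by (rule SUP_least) (auto simp: admissible_iff simp del: uminus_ereal.simps intro: utility_le)
next
  case 2
  show ?case
    using energy_le_opt contract_opt_augmented
    by (intro SUP_upper2[of "(y0, opt)"]) (auto simp: admissible_iff utility_opt)
qed

text \<open>A gap of zero energy vanishes at almost every time. Then \<open>ito_unique\<close>
  identifies the stochastic integrals, and the energies agree path by path.\<close>

lemma gap_zeroD:
  assumes \<beta>: "energy_le A \<beta>" and zero: "AE \<omega> in M. path_energy (gap \<beta>) \<omega> = 0"
  shows "AE \<omega> in M. AE s in lborel. s \<in> {0..T} \<longrightarrow> \<beta> s \<omega> = opt s \<omega>"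
    and "AE \<omega> in M. radial_contract y \<beta> \<omega> = radial_contract y opt \<omega>"
proof -
  note gap = energy_le_lincomb[OF \<beta> energy_le_kern, of 1 "- share", folded gap_def]
  have gap_eq: "gap \<beta> s \<omega> = \<beta> s \<omega> - opt s \<omega>" for s \<omega>
    by (simp add: gap_def opt_def kern_def)
  show ae: "AE \<omega> in M. AE s in lborel. s \<in> {0..T} \<longrightarrow> \<beta> s \<omega> = opt s \<omega>"
    using zero AE_space
  proof eventually_elim
    case (elim \<omega>)
    have [measurable]: "(\<lambda>s. indicat_real {0..T} s *\<^sub>R gap \<beta> s \<omega>) \<in> borel_measurable borel"
      by (rule joint_section[OF energy_leD(3)[OF gap] elim(2)])
    have "(\<integral>\<^sup>+s. ennreal ((norm (indicat_real {0..T} s *\<^sub>R gap \<beta> s \<omega>))\<^sup>2) \<partial>lborel) = path_energy (gap \<beta>) \<omega>"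
      unfolding sq_norm_def by (intro nn_integral_cong) (auto simp: indicator_def)
    with elim(1) have "(\<integral>\<^sup>+s. ennreal ((norm (indicat_real {0..T} s *\<^sub>R gap \<beta> s \<omega>))\<^sup>2) \<partial>lborel) = 0"
      by simp
    moreover have "(\<lambda>s. ennreal ((norm (indicat_real {0..T} s *\<^sub>R gap \<beta> s \<omega>))\<^sup>2)) \<in> borel_measurable lborel"
      by (intro measurable_compose[OF _ measurable_ennreal] borel_measurable_power
          measurable_compose[OF _ borel_measurable_norm]) simp
    ultimately have "AE s in lborel. ennreal ((norm (indicat_real {0..T} s *\<^sub>R gap \<beta> s \<omega>))\<^sup>2) = 0"
      by (subst (asm) nn_integral_0_iff_AE)
    then show ?case
      by eventually_elim (auto simp: gap_eq indicator_def)
  qed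
  have "AE \<omega> in M. ito \<beta> \<omega> = ito opt \<omega>"
    using zero
    by (intro ito_unique[OF ito_spec[OF \<beta>] ito_spec[OF energy_le_opt] energy_leD(3)[OF \<beta>] energy_leD(3)[OF energy_le_opt]])
      (simp add: gap_eq)
  with ae AE_space show "AE \<omega> in M. radial_contract y \<beta> \<omega> = radial_contract y opt \<omega>"
  proof eventually_elim
    case (elim \<omega>)
    have "path_energy \<beta> \<omega> = path_energy opt \<omega>"
      unfolding sq_norm_def using elim(1) by (intro nn_integral_cong_AE, eventually_elim) (auto simp: indicator_def)
    then show ?case
      using elim(2,3) by (simp add: contract_eq energy_leD(3)[OF \<beta>] energy_leD(3)[OF energy_le_opt] energy_def)
  qed
qed

end

text \<open>Optimality is read as attainment together with uniqueness up to null sets, since the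
  utility sees \<open>\<beta>\<close> only through energies and almost sure classes of integrals.
  The effort is the same for every \<open>y\<close> because \<open>y\<close> merely scales the loss;
  the contract is pinned to \<open>y0\<close> because that scale is strictly increasing.\<close>

theorem corollary5p2:
  fixes M :: "'a measure" and F :: "real \<Rightarrow> 'a measure" and T :: real
    and B :: "real \<Rightarrow> 'a \<Rightarrow> real ^ 'd"
    and g0 :: "real \<Rightarrow> real" and K :: "real \<Rightarrow> real \<Rightarrow> real ^ 'd"
    and \<gamma>P \<gamma>A \<kappa> y0 :: real and \<Gamma> :: "real ^ 'd ^ 'd"
  assumes "prob_space M" and "0 < T"
    and "filtration_upto M F T" and "standard_brownian_motion M F T B"
    and "g0 \<in> borel_measurable (restrict_space borel {0..T})"
    and "volterra_kernel T K"
    and "0 < \<gamma>P" and "0 < \<gamma>A"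
    and "0 < \<kappa>" and "\<Gamma> = \<kappa> *\<^sub>R mat 1"
  shows
    "let c = (\<gamma>P + 1 / \<kappa>) / (\<gamma>A + \<gamma>P + 1 / \<kappa>);
         \<beta>' = (\<lambda>t (\<omega>::'a). c *\<^sub>R K T t);
         \<xi>' = (\<lambda>\<omega>. y0 - c * g0 T + (\<gamma>A - 1 / \<kappa>) / 2 * (LBINT s:{0..T}. \<beta>' s \<omega> \<bullet> \<beta>' s \<omega>)
                     + c * volterra_output M F B g0 K T \<omega>)
     in (\<forall>y\<ge>y0.
           optimal_effort M F B T g0 K \<gamma>P \<gamma>A \<Gamma> y (reply \<Gamma> \<beta>') \<and>
           (\<forall>a. optimal_effort M F B T g0 K \<gamma>P \<gamma>A \<Gamma> y a \<longrightarrow>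
                (AE \<omega> in M. AE s in lborel. s \<in> {0..T} \<longrightarrow> a s \<omega> = reply \<Gamma> \<beta>' s \<omega>))) \<and>
        optimal_contract M F B T g0 K \<gamma>P \<gamma>A \<Gamma> y0 \<xi>' \<and>
        (\<forall>\<xi>. optimal_contract M F B T g0 K \<gamma>P \<gamma>A \<Gamma> y0 \<xi> \<longrightarrow> (AE \<omega> in M. \<xi> \<omega> = \<xi>' \<omega>)) \<and>
        V_SB M F B T g0 K \<gamma>P \<gamma>A \<Gamma> y0 = V_P M F B T g0 K \<gamma>P \<gamma>A \<Gamma> y0"
proof -
  interpret volterra_agency M F T B g0 K \<gamma>P \<gamma>A \<kappa>
    using assms by (intro volterra_agency.intro brownian.intro brownian_axioms.intro volterra_agency_axioms.intro)
  define \<xi>' where "\<xi>' \<omega> = y0 - share * g0 T + (\<gamma>A - 1 / \<kappa>) / 2 * (LBINT s:{0..T}. opt s \<omega> \<bullet> opt s \<omega>)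
      + share * volterra_output M F B g0 K T \<omega>" for \<omega>
  have \<xi>': "AE \<omega> in M. \<xi>' \<omega> = contract M F B T \<gamma>A \<Gamma> y0 opt \<omega>"
    using contract_opt[of y0] AE_space unfolding assms(10)
  proof eventually_elim
    case (elim \<omega>)
    have "(LBINT s:{0..T}. opt s \<omega> \<bullet> opt s \<omega>) = energy opt \<omega>"
      using set_integral_energy[OF energy_leD(3)[OF energy_le_opt] elim(2)] by (simp add: power2_norm_eq_inner)
    then show ?case
      unfolding \<xi>'_def elim(1) by (simp add: algebra_simps)
  qed
  have adm: "opt \<in> admissible M F T" using energy_le_opt by (auto simp: admissible_iff)
  have "optimal_effort M F B T g0 K \<gamma>P \<gamma>A \<Gamma> y (reply \<Gamma> opt)" for y
    unfolding optimal_effort_def assms(10) V_SB_at_eq using adm utility_opt by blast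
  moreover have "AE \<omega> in M. AE s in lborel. s \<in> {0..T} \<longrightarrow> a s \<omega> = reply \<Gamma> opt s \<omega>"
    if opt: "optimal_effort M F B T g0 K \<gamma>P \<gamma>A \<Gamma> y a" for y a
  proof -
    from opt obtain \<beta> A where \<beta>: "energy_le A \<beta>" "a = reply \<Gamma> \<beta>" "utility y \<beta> = - ereal (loss_scale y)"
      unfolding optimal_effort_def assms(10) V_SB_at_eq by (auto simp: admissible_iff)
    from gap_zeroD(1)[OF \<beta>(1) utility_eqD(2)[OF \<beta>(1) order_refl \<beta>(3)]] show ?thesis
      unfolding \<beta>(2) reply_def by eventually_elim (auto elim: eventually_mono)
  qed
  moreover have "optimal_contract M F B T g0 K \<gamma>P \<gamma>A \<Gamma> y0 \<xi>'"
    unfolding optimal_contract_def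
    by (intro exI[of _ y0] bexI[OF _ adm] conjI order_refl \<xi>') (simp add: assms(10) V_SB_eq utility_opt)
  moreover have "AE \<omega> in M. \<xi> \<omega> = \<xi>' \<omega>" if "optimal_contract M F B T g0 K \<gamma>P \<gamma>A \<Gamma> y0 \<xi>" for \<xi>
  proof -
    from that obtain y \<beta> A where y: "y0 \<le> y" and \<beta>: "energy_le A \<beta>" and \<xi>: "AE \<omega> in M. \<xi> \<omega> = contract M F B T \<gamma>A \<Gamma> y \<beta> \<omega>"
      and "utility y \<beta> = - ereal (loss_scale y0)"
      unfolding optimal_contract_def assms(10) V_SB_eq by (auto simp: admissible_iff)
    note eq = utility_eqD[OF \<beta> y this(4)]
    from \<xi> gap_zeroD(2)[OF \<beta> eq(2), of y] \<xi>' show ?thesis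
      unfolding assms(10) eq(1) by eventually_elim simp
  qed
  moreover have "V_SB M F B T g0 K \<gamma>P \<gamma>A \<Gamma> y0 = V_P M F B T g0 K \<gamma>P \<gamma>A \<Gamma> y0"
    by (simp add: assms(10) V_SB_eq V_P_eq)
  ultimately show ?thesis
    unfolding Let_def \<xi>'_def[abs_def] opt_def[abs_def] share_def by blast
qed

end
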